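(* Let $\Gamma$ be a discrete group, let $0\to K\to L\stackrel{\phi}{\to}M\to 0$ be a short exact sequence of $\mathbb{Z}\Gamma$-modules, let $C_*$ and $D_*$ be chain complexes of free $\mathbb{Z}\Gamma$-modules, and let $a^*\in H^n(C\otimes D^\Gamma;\mathbb{Z})$. Then the diagram $$\begin{array}{ccc} H_{n-k}(D^\Gamma(M)) & \stackrel{a^*/}{\longrightarrow} & H^k(C,M)\\ {\scriptstyle\bar\partial}\downarrow & & \downarrow{\scriptstyle\bar\delta}\\ H_{n-k-1}(D^\Gamma(K)) & \stackrel{a^*/}{\longrightarrow} & H^{k+1}(C,K) \end{array}$$ commutes up to sign, where $\bar\partial$ and $\bar\delta$ are the connecting homomorphisms in the coefficient homology and cohomology long exact sequences.
   Context: $D_m$ is given with a $\mathbb{Z}$-basis $S_m$ freely permuted by $\Gamma$ (the model case is $D_*=C_*(P)$, the simplicial chain complex of a locally finite simplicial complex $P$ with free simplicial $\Gamma$-action, with $S_m$ the set of oriented $m$-simplices), and each $\tau\in S_{m-1}$ occurs in $\partial\sigma$ for only finitely many $\sigma\in S_m$. For a $\mathbb{Z}\Gamma$-module $N$, $D^\Gamma_m(N)$ is the group of $\Gamma$-invariant, possibly infinite, formal sums $\sum_{\sigma\in S_m}\lambda_\sigma\sigma$ with $\lambda_\sigma\in N$ and $\lambda_{\gamma\sigma}=\gamma\lambda_\sigma$ for all $\gamma\in\Gamma$; with the boundary $\partial(\sum\lambda_\sigma\sigma)=\sum\lambda_\sigma\partial\sigma$ it is a chain complex with homology $H_*(D^\Gamma(N))$;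 write $D^\Gamma=D^\Gamma(\mathbb{Z})$. $H^k(C,N)$ is the cohomology of $\mathrm{Hom}_\Gamma(C_*,N)$. For a short exact sequence $0\to K\to L\to M\to0$ of $\mathbb{Z}\Gamma$-modules, both $0\to D^\Gamma_*(K)\to D^\Gamma_*(L)\to D^\Gamma_*(M)\to 0$ and $0\to \mathrm{Hom}_\Gamma(C_*,K)\to\mathrm{Hom}_\Gamma(C_*,L)\to\mathrm{Hom}_\Gamma(C_*,M)\to 0$ are exact, and $\bar\partial$, $\bar\delta$ are the associated connecting homomorphisms. The class $a^*$ is represented by a $\Gamma$-invariant cocycle $a:(C\otimes D)_n\to\mathbb{Z}$ (i.e. $a(\gamma c\otimes\gamma\sigma)=a(c\otimes\sigma)$ and $a\circ\partial=0$, $\otimes$ over $\mathbb{Z}$), such that for each $c\in C_k$ only finitely many $\sigma\in S_{n-k}$ satisfy $a(c\otimes\sigma)\neq0$, so that $a$ extends to $C\otimes D^\Gamma$ by summation. The slant product $a^*/:H_{n-k}(D^\Gamma(N))\to H^k(C,N)$ is induced by $(a/z)(c)=\sum_{\sigma\in S_{n-k}}a(c\otimes\sigma)\lambda_\sigma$ for $z=\sum_\sigma\lambda_\sigma\sigma\in D^\Gamma_{n-k}(N)$. *)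

theory Defs
  imports "HOL-Algebra.Free_Abelian_Groups" "HOL-Algebra.Module"
begin

section \<open>Modules over an integral group ring\<close>

text \<open>
  HOL-Algebra has modules over commutative rings only.  A (left) module over the integral group
  ring of \<open>\<Gamma>\<close> is an abelian group with an additive \<open>\<Gamma>\<close>-action; the action is carried by the
  \<open>smult\<close> field of the library's module record, and the multiplicative part of that record plays
  no role.
\<close>

locale ZG_module = group \<Gamma> + abelian_group M
  for \<Gamma> :: "('g, 'x) monoid_scheme" and M :: "('g, 'a, 'y) module_scheme" +
  assumes act_closed: "\<lbrakk>\<gamma> \<in> carrier \<Gamma>; x \<in> carrier M\<rbrakk> \<Longrightarrow> \<gamma> \<odot>\<^bsub>M\<^esub> x \<in> carrier M"
    and act_add: "\<lbrakk>\<gamma> \<in> carrier \<Gamma>; x \<in> carrier M; y \<in> carrier M\<rbrakk>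
      \<Longrightarrow> \<gamma> \<odot>\<^bsub>M\<^esub> (x \<oplus>\<^bsub>M\<^esub> y) = \<gamma> \<odot>\<^bsub>M\<^esub> x \<oplus>\<^bsub>M\<^esub> \<gamma> \<odot>\<^bsub>M\<^esub> y"
    and act_mult: "\<lbrakk>\<gamma> \<in> carrier \<Gamma>; \<gamma>' \<in> carrier \<Gamma>; x \<in> carrier M\<rbrakk>
      \<Longrightarrow> (\<gamma> \<otimes>\<^bsub>\<Gamma>\<^esub> \<gamma>') \<odot>\<^bsub>M\<^esub> x = \<gamma> \<odot>\<^bsub>M\<^esub> (\<gamma>' \<odot>\<^bsub>M\<^esub> x)"
    and act_one: "x \<in> carrier M \<Longrightarrow> \<one>\<^bsub>\<Gamma>\<^esub> \<odot>\<^bsub>M\<^esub> x = x"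

definition ZG_hom ::
  "('g, 'x) monoid_scheme \<Rightarrow> ('g, 'a, 'y) module_scheme \<Rightarrow> ('g, 'b, 'z) module_scheme
    \<Rightarrow> ('a \<Rightarrow> 'b) set"
  where "ZG_hom \<Gamma> M N =
    {f \<in> hom (add_monoid M) (add_monoid N).
      \<forall>\<gamma>\<in>carrier \<Gamma>. \<forall>x\<in>carrier M. f (\<gamma> \<odot>\<^bsub>M\<^esub> x) = \<gamma> \<odot>\<^bsub>N\<^esub> f x}"

definition ZG_short_exact ::
  "('g, 'x) monoid_scheme \<Rightarrow> ('g, 'k, 'y) module_scheme \<Rightarrow> ('k \<Rightarrow> 'l)
    \<Rightarrow> ('g, 'l, 'z) module_scheme \<Rightarrow> ('l \<Rightarrow> 'm) \<Rightarrow> ('g, 'm, 'w) module_scheme \<Rightarrow> bool"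
  where "ZG_short_exact \<Gamma> K \<iota> L \<phi> M \<longleftrightarrow>
    ZG_module \<Gamma> K \<and> ZG_module \<Gamma> L \<and> ZG_module \<Gamma> M \<and>
    \<iota> \<in> ZG_hom \<Gamma> K L \<and> \<phi> \<in> ZG_hom \<Gamma> L M \<and>
    inj_on \<iota> (carrier K) \<and> \<iota> ` carrier K = kernel (add_monoid L) (add_monoid M) \<phi> \<and> \<phi> ` carrier L = carrier M"

definition int_comb :: "('a, 'y) ring_scheme \<Rightarrow> ('i \<Rightarrow> 'a) \<Rightarrow> ('i \<Rightarrow>\<^sub>0 int) \<Rightarrow> 'a"
  where "int_comb M f u =
    (\<Oplus>\<^bsub>M\<^esub>i\<in>Poly_Mapping.keys u. [Poly_Mapping.lookup u i] \<cdot>\<^bsub>M\<^esub> f i)"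

definition Z_basis :: "('a, 'y) ring_scheme \<Rightarrow> 'a set \<Rightarrow> bool"
  where "Z_basis M B \<longleftrightarrow> B \<subseteq> carrier M \<and>
    bij_betw (int_comb M (\<lambda>b. b)) (carrier (free_Abelian_group B)) (carrier M)"

text \<open>
  \<open>B\<close> is a basis over the group ring iff every element is a unique finite combination
  \<open>\<Sum> n\<^sub>\<gamma>\<^sub>b \<gamma>b\<close> with integers \<open>n\<^sub>\<gamma>\<^sub>b\<close>: the coefficient of \<open>b\<close> is the group ring element
  \<open>\<Sum> n\<^sub>\<gamma>\<^sub>b \<gamma>\<close>.
\<close>

definition ZG_free :: "('g, 'x) monoid_scheme \<Rightarrow> ('g, 'a, 'y) module_scheme \<Rightarrow> bool"
  where "ZG_free \<Gamma> M \<longleftrightarrow> ZG_module \<Gamma> M \<and>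
    (\<exists>B \<subseteq> carrier M.
      bij_betw (int_comb M (\<lambda>(\<gamma>, b). \<gamma> \<odot>\<^bsub>M\<^esub> b))
        (carrier (free_Abelian_group (carrier \<Gamma> \<times> B))) (carrier M))"

definition trivial_Z :: "('g, int) module"
  where "trivial_Z =
    \<lparr>carrier = UNIV, monoid.mult = (*), one = 1, ring.zero = 0, ring.add = (+), smult = (\<lambda>\<gamma> x. x)\<rparr>"

definition free_chain_complex ::
  "('g, 'x) monoid_scheme \<Rightarrow> (int \<Rightarrow> ('g, 'c, 'y) module_scheme) \<Rightarrow> (int \<Rightarrow> 'c \<Rightarrow> 'c) \<Rightarrow> bool"
  where "free_chain_complex \<Gamma> C d \<longleftrightarrow>
    (\<forall>m. ZG_free \<Gamma> (C m) \<and> d m \<in> ZG_hom \<Gamma> (C m) (C (m - 1)) \<and>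
      (\<forall>x\<in>carrier (C m). d (m - 1) (d m x) = \<zero>\<^bsub>C (m - 2)\<^esub>))"


section \<open>Homology, induced maps and connecting homomorphisms\<close>

text \<open>
  Groups of chains and cochains are monoid records, so HOL-Algebra writes them multiplicatively.
  \<open>homology_at A f B g C\<close> is the homology at \<open>B\<close> of \<open>A \<rightarrow> B \<rightarrow> C\<close>; its elements are the cosets
  of the image of \<open>f\<close> in the kernel of \<open>g\<close>.
\<close>

definition homology_at ::
  "('a, 'x) monoid_scheme \<Rightarrow> ('a \<Rightarrow> 'b) \<Rightarrow> ('b, 'y) monoid_scheme \<Rightarrow> ('b \<Rightarrow> 'c)
    \<Rightarrow> ('c, 'z) monoid_scheme \<Rightarrow> 'b set monoid"
  where "homology_at A f B g C = B\<lparr>carrier := kernel B C g\<rparr> Mod (f ` carrier A)"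

text \<open>
  The map on cosets given by \<open>f\<close> on representatives, with values in the cosets of \<open>R\<close> in \<open>G\<close>.
\<close>

definition induced :: "('b, 'y) monoid_scheme \<Rightarrow> 'b set \<Rightarrow> ('a \<Rightarrow> 'b) \<Rightarrow> 'a set \<Rightarrow> 'b set"
  where "induced G R f X = (THE Y. \<exists>x\<in>X. Y = R #>\<^bsub>G\<^esub> f x)"

text \<open>
  The connecting map of a short exact sequence of complexes, from the homology of the quotient
  complex at one spot to the homology of the subcomplex at the next spot.  Here \<open>E\<close> is the group
  of the middle complex at the first spot, \<open>p\<close> its projection to the quotient complex, \<open>d\<close> the
  differential of the middle complex, \<open>G\<close> the group of the subcomplex at the next spot, \<open>i\<close> its
  inclusion and \<open>R\<close> the set of boundaries in \<open>G\<close>.  The class of a cycle \<open>z = p y\<close> goes to the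
  class of the \<open>w\<close> with \<open>i w = d y\<close>.
\<close>

definition connecting ::
  "('e, 'x) monoid_scheme \<Rightarrow> ('e \<Rightarrow> 'q) \<Rightarrow> ('e \<Rightarrow> 'f) \<Rightarrow> ('s, 'y) monoid_scheme \<Rightarrow> ('s \<Rightarrow> 'f)
    \<Rightarrow> 's set \<Rightarrow> 'q set \<Rightarrow> 's set"
  where "connecting E p d G i R X =
    (THE Y. \<exists>z\<in>X. \<exists>y\<in>carrier E. \<exists>w\<in>carrier G. p y = z \<and> i w = d y \<and> Y = R #>\<^bsub>G\<^esub> w)"

text \<open>Homomorphisms into an abelian group \<open>B\<close>, made extensional so that equality is equality on \<open>A\<close>.\<close>

definition hom_group ::
  "('a, 'x) monoid_scheme \<Rightarrow> ('b, 'y) monoid_scheme \<Rightarrow> ('a \<Rightarrow> 'b) monoid"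
  where "hom_group A B =
    \<lparr>carrier = hom A B \<inter> extensional (carrier A),
     monoid.mult = (\<lambda>f g. \<lambda>x\<in>carrier A. f x \<otimes>\<^bsub>B\<^esub> g x),
     one = (\<lambda>x\<in>carrier A. \<one>\<^bsub>B\<^esub>)\<rparr>"


section \<open>Cohomology with coefficients\<close>

definition Hom_G ::
  "('g, 'x) monoid_scheme \<Rightarrow> ('g, 'c, 'y) module_scheme \<Rightarrow> ('g, 'n, 'z) module_scheme
    \<Rightarrow> ('c \<Rightarrow> 'n) monoid"
  where "Hom_G \<Gamma> P N = (hom_group (add_monoid P) (add_monoid N))
    \<lparr>carrier := ZG_hom \<Gamma> P N \<inter> extensional (carrier P)\<rparr>"

text \<open>The coboundary from degree \<open>m\<close> to degree \<open>m + 1\<close> is \<open>f \<mapsto> f \<circ> \<partial>\<close>, without a sign.\<close>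

definition coboundary ::
  "(int \<Rightarrow> ('c, 'y) ring_scheme) \<Rightarrow> (int \<Rightarrow> 'c \<Rightarrow> 'c) \<Rightarrow> int \<Rightarrow> ('c \<Rightarrow> 'n) \<Rightarrow> 'c \<Rightarrow> 'n"
  where "coboundary C d m f = compose (carrier (C (m + 1))) f (d (m + 1))"

definition coboundaries ::
  "('g, 'x) monoid_scheme \<Rightarrow> (int \<Rightarrow> ('g, 'c, 'y) module_scheme) \<Rightarrow> (int \<Rightarrow> 'c \<Rightarrow> 'c)
    \<Rightarrow> ('g, 'n, 'z) module_scheme \<Rightarrow> int \<Rightarrow> ('c \<Rightarrow> 'n) set"
  where "coboundaries \<Gamma> C d N m = coboundary C d (m - 1) ` carrier (Hom_G \<Gamma> (C (m - 1)) N)"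

definition cohomology ::
  "('g, 'x) monoid_scheme \<Rightarrow> (int \<Rightarrow> ('g, 'c, 'y) module_scheme) \<Rightarrow> (int \<Rightarrow> 'c \<Rightarrow> 'c)
    \<Rightarrow> ('g, 'n, 'z) module_scheme \<Rightarrow> int \<Rightarrow> ('c \<Rightarrow> 'n) set monoid"
  where "cohomology \<Gamma> C d N m =
    homology_at (Hom_G \<Gamma> (C (m - 1)) N) (coboundary C d (m - 1))
      (Hom_G \<Gamma> (C m) N) (coboundary C d m) (Hom_G \<Gamma> (C (m + 1)) N)"

definition cohomology_connecting ::
  "('g, 'x) monoid_scheme \<Rightarrow> (int \<Rightarrow> ('g, 'c, 'y) module_scheme) \<Rightarrow> (int \<Rightarrow> 'c \<Rightarrow> 'c)
    \<Rightarrow> ('g, 'k, 'u) module_scheme \<Rightarrow> ('k \<Rightarrow> 'l) \<Rightarrow> ('g, 'l, 'v) module_scheme \<Rightarrow> ('l \<Rightarrow> 'm)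
    \<Rightarrow> int \<Rightarrow> ('c \<Rightarrow> 'm) set \<Rightarrow> ('c \<Rightarrow> 'k) set"
  where "cohomology_connecting \<Gamma> C d K \<iota> L \<phi> m =
    connecting (Hom_G \<Gamma> (C m) L) (compose (carrier (C m)) \<phi>) (coboundary C d m)
      (Hom_G \<Gamma> (C (m + 1)) K) (compose (carrier (C (m + 1))) \<iota>)
      (coboundaries \<Gamma> C d K (m + 1))"


section \<open>Invariant infinite chains\<close>

definition freely_permuted_basis ::
  "('g, 'x) monoid_scheme \<Rightarrow> ('g, 'd, 'y) module_scheme \<Rightarrow> 'd set \<Rightarrow> bool"
  where "freely_permuted_basis \<Gamma> D S \<longleftrightarrow> Z_basis D S \<and>
    (\<forall>\<gamma>\<in>carrier \<Gamma>. \<forall>\<sigma>\<in>S. \<gamma> \<odot>\<^bsub>D\<^esub> \<sigma> \<in> S \<and> (\<gamma> \<odot>\<^bsub>D\<^esub> \<sigma> = \<sigma> \<longrightarrow> \<gamma> = \<one>\<^bsub>\<Gamma>\<^esub>))"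

text \<open>The coefficient of the basis element \<open>\<tau> \<in> S\<close> in \<open>x\<close>.\<close>

definition basis_coeff :: "('d, 'y) ring_scheme \<Rightarrow> 'd set \<Rightarrow> 'd \<Rightarrow> 'd \<Rightarrow> int"
  where "basis_coeff D S x \<tau> =
    Poly_Mapping.lookup
      (inv_into (carrier (free_Abelian_group S)) (int_comb D (\<lambda>b. b)) x) \<tau>"

definition incidence ::
  "(int \<Rightarrow> ('d, 'y) ring_scheme) \<Rightarrow> (int \<Rightarrow> 'd set) \<Rightarrow> (int \<Rightarrow> 'd \<Rightarrow> 'd) \<Rightarrow> int \<Rightarrow> 'd \<Rightarrow> 'd \<Rightarrow> int"
  where "incidence D S d m \<sigma> \<tau> = basis_coeff (D (m - 1)) (S (m - 1)) (d m \<sigma>) \<tau>"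

text \<open>
  The formal sum \<open>\<Sum> \<lambda>\<^sub>\<sigma> \<sigma>\<close> over \<open>\<sigma> \<in> S\<close>, possibly infinite, is the function \<open>\<sigma> \<mapsto> \<lambda>\<^sub>\<sigma>\<close> on \<open>S\<close>.
\<close>

definition inv_chains ::
  "('g, 'x) monoid_scheme \<Rightarrow> ('g, 'd, 'y) module_scheme \<Rightarrow> 'd set \<Rightarrow> ('g, 'n, 'z) module_scheme
    \<Rightarrow> ('d \<Rightarrow> 'n) monoid"
  where "inv_chains \<Gamma> D S N =
    \<lparr>carrier = {z \<in> S \<rightarrow>\<^sub>E carrier N.
       \<forall>\<gamma>\<in>carrier \<Gamma>. \<forall>\<sigma>\<in>S. z (\<gamma> \<odot>\<^bsub>D\<^esub> \<sigma>) = \<gamma> \<odot>\<^bsub>N\<^esub> z \<sigma>},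
     monoid.mult = (\<lambda>z w. \<lambda>\<sigma>\<in>S. z \<sigma> \<oplus>\<^bsub>N\<^esub> w \<sigma>),
     one = (\<lambda>\<sigma>\<in>S. \<zero>\<^bsub>N\<^esub>)\<rparr>"

text \<open>
  \<open>\<partial>(\<Sum> \<lambda>\<^sub>\<sigma> \<sigma>) = \<Sum> \<lambda>\<^sub>\<sigma> \<partial>\<sigma>\<close>: the coefficient at \<open>\<tau>\<close> is the sum of \<open>[\<partial>\<sigma> : \<tau>] \<lambda>\<^sub>\<sigma>\<close> over the \<open>\<sigma>\<close> such
  that \<open>\<tau>\<close> occurs in \<open>\<partial>\<sigma>\<close>, a finite set under the local finiteness hypothesis (the library's
  \<open>finsum\<close> is \<open>\<zero>\<close> on infinite index sets).
\<close>

definition inv_boundary ::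
  "(int \<Rightarrow> ('d, 'y) ring_scheme) \<Rightarrow> (int \<Rightarrow> 'd set) \<Rightarrow> (int \<Rightarrow> 'd \<Rightarrow> 'd)
    \<Rightarrow> ('n, 'z) ring_scheme \<Rightarrow> int \<Rightarrow> ('d \<Rightarrow> 'n) \<Rightarrow> ('d \<Rightarrow> 'n)"
  where "inv_boundary D S d N m z =
    (\<lambda>\<tau>\<in>S (m - 1).
      \<Oplus>\<^bsub>N\<^esub>\<sigma>\<in>{\<sigma> \<in> S m. incidence D S d m \<sigma> \<tau> \<noteq> 0}. [incidence D S d m \<sigma> \<tau>] \<cdot>\<^bsub>N\<^esub> z \<sigma>)"

definition inv_boundaries ::
  "('g, 'x) monoid_scheme \<Rightarrow> (int \<Rightarrow> ('g, 'd, 'y) module_scheme) \<Rightarrow> (int \<Rightarrow> 'd set)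
    \<Rightarrow> (int \<Rightarrow> 'd \<Rightarrow> 'd) \<Rightarrow> ('g, 'n, 'z) module_scheme \<Rightarrow> int \<Rightarrow> ('d \<Rightarrow> 'n) set"
  where "inv_boundaries \<Gamma> D S d N m =
    inv_boundary D S d N (m + 1) ` carrier (inv_chains \<Gamma> (D (m + 1)) (S (m + 1)) N)"

definition inv_homology ::
  "('g, 'x) monoid_scheme \<Rightarrow> (int \<Rightarrow> ('g, 'd, 'y) module_scheme) \<Rightarrow> (int \<Rightarrow> 'd set)
    \<Rightarrow> (int \<Rightarrow> 'd \<Rightarrow> 'd) \<Rightarrow> ('g, 'n, 'z) module_scheme \<Rightarrow> int \<Rightarrow> ('d \<Rightarrow> 'n) set monoid"
  where "inv_homology \<Gamma> D S d N m =
    homology_at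
      (inv_chains \<Gamma> (D (m + 1)) (S (m + 1)) N) (inv_boundary D S d N (m + 1))
      (inv_chains \<Gamma> (D m) (S m) N) (inv_boundary D S d N m)
      (inv_chains \<Gamma> (D (m - 1)) (S (m - 1)) N)"

definition inv_homology_connecting ::
  "('g, 'x) monoid_scheme \<Rightarrow> (int \<Rightarrow> ('g, 'd, 'y) module_scheme) \<Rightarrow> (int \<Rightarrow> 'd set)
    \<Rightarrow> (int \<Rightarrow> 'd \<Rightarrow> 'd) \<Rightarrow> ('g, 'k, 'u) module_scheme \<Rightarrow> ('k \<Rightarrow> 'l)
    \<Rightarrow> ('g, 'l, 'v) module_scheme \<Rightarrow> ('l \<Rightarrow> 'm) \<Rightarrow> int \<Rightarrow> ('d \<Rightarrow> 'm) set \<Rightarrow> ('d \<Rightarrow> 'k) set"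
  where "inv_homology_connecting \<Gamma> D S d K \<iota> L \<phi> m =
    connecting (inv_chains \<Gamma> (D m) (S m) L) (compose (S m) \<phi>) (inv_boundary D S d L m)
      (inv_chains \<Gamma> (D (m - 1)) (S (m - 1)) K) (compose (S (m - 1)) \<iota>)
      (inv_boundaries \<Gamma> D S d K (m - 1))"


section \<open>Tensor products of complexes of abelian groups\<close>

text \<open>
  \<open>(A \<otimes> B)\<^sub>n\<close> is the direct sum of the \<open>A\<^sub>p \<otimes> B\<^sub>q\<close> with \<open>p + q = n\<close>, presented by generators
  \<open>(p, x, y)\<close>, standing for \<open>x \<otimes> y\<close> with \<open>x \<in> A\<^sub>p\<close> and \<open>y \<in> B\<^bsub>n-p\<^esub>\<close>, and the relations of
  additivity in \<open>x\<close> and in \<open>y\<close> for fixed \<open>p\<close>.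
\<close>

definition tensor_free ::
  "(int \<Rightarrow> ('a, 'x) monoid_scheme) \<Rightarrow> (int \<Rightarrow> ('b, 'y) monoid_scheme) \<Rightarrow> int
    \<Rightarrow> (int \<times> 'a \<times> 'b \<Rightarrow>\<^sub>0 int) monoid"
  where "tensor_free A B n =
    free_Abelian_group {(p, x, y). x \<in> carrier (A p) \<and> y \<in> carrier (B (n - p))}"

definition tensor_relations ::
  "(int \<Rightarrow> ('a, 'x) monoid_scheme) \<Rightarrow> (int \<Rightarrow> ('b, 'y) monoid_scheme) \<Rightarrow> int
    \<Rightarrow> (int \<times> 'a \<times> 'b \<Rightarrow>\<^sub>0 int) set"
  where "tensor_relations A B n = generate (tensor_free A B n)
    ({frag_of (p, x \<otimes>\<^bsub>A p\<^esub> x', y) - frag_of (p, x, y) - frag_of (p, x', y) | p x x' y.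
        x \<in> carrier (A p) \<and> x' \<in> carrier (A p) \<and> y \<in> carrier (B (n - p))} \<union>
     {frag_of (p, x, y \<otimes>\<^bsub>B (n - p)\<^esub> y') - frag_of (p, x, y) - frag_of (p, x, y') | p x y y'.
        x \<in> carrier (A p) \<and> y \<in> carrier (B (n - p)) \<and> y' \<in> carrier (B (n - p))})"

definition tensor ::
  "(int \<Rightarrow> ('a, 'x) monoid_scheme) \<Rightarrow> (int \<Rightarrow> ('b, 'y) monoid_scheme) \<Rightarrow> int
    \<Rightarrow> (int \<times> 'a \<times> 'b \<Rightarrow>\<^sub>0 int) set monoid"
  where "tensor A B n = tensor_free A B n Mod tensor_relations A B n"

definition pure_tensor ::
  "(int \<Rightarrow> ('a, 'x) monoid_scheme) \<Rightarrow> (int \<Rightarrow> ('b, 'y) monoid_scheme) \<Rightarrow> int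
    \<Rightarrow> int \<Rightarrow> 'a \<Rightarrow> 'b \<Rightarrow> (int \<times> 'a \<times> 'b \<Rightarrow>\<^sub>0 int) set"
  where "pure_tensor A B n p x y =
    tensor_relations A B n #>\<^bsub>tensor_free A B n\<^esub> frag_of (p, x, y)"

text \<open>\<open>\<partial>(x \<otimes> y) = \<partial>x \<otimes> y + (-1)\<^sup>p x \<otimes> \<partial>y\<close> for \<open>x \<in> A\<^sub>p\<close>.\<close>

definition tensor_boundary ::
  "(int \<Rightarrow> ('a, 'x) monoid_scheme) \<Rightarrow> (int \<Rightarrow> 'a \<Rightarrow> 'a) \<Rightarrow> (int \<Rightarrow> ('b, 'y) monoid_scheme)
    \<Rightarrow> (int \<Rightarrow> 'b \<Rightarrow> 'b) \<Rightarrow> int \<Rightarrow> (int \<times> 'a \<times> 'b \<Rightarrow>\<^sub>0 int) set \<Rightarrow> (int \<times> 'a \<times> 'b \<Rightarrow>\<^sub>0 int) set"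
  where "tensor_boundary A dA B dB n =
    induced (tensor_free A B (n - 1)) (tensor_relations A B (n - 1))
      (frag_extend (\<lambda>(p, x, y).
        frag_of (p - 1, dA p x, y) +
        frag_cmul (if even p then 1 else - 1) (frag_of (p, x, dB (n - p) y))))"

definition tensor_coboundary ::
  "(int \<Rightarrow> ('a, 'x) monoid_scheme) \<Rightarrow> (int \<Rightarrow> 'a \<Rightarrow> 'a) \<Rightarrow> (int \<Rightarrow> ('b, 'y) monoid_scheme)
    \<Rightarrow> (int \<Rightarrow> 'b \<Rightarrow> 'b) \<Rightarrow> int \<Rightarrow> ((int \<times> 'a \<times> 'b \<Rightarrow>\<^sub>0 int) set \<Rightarrow> int)
    \<Rightarrow> ((int \<times> 'a \<times> 'b \<Rightarrow>\<^sub>0 int) set \<Rightarrow> int)"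
  where "tensor_coboundary A dA B dB m f =
    compose (carrier (tensor A B (m + 1))) f (tensor_boundary A dA B dB (m + 1))"

text \<open>\<open>H\<^sup>n(A \<otimes> B; \<int>)\<close>\<close>

definition tensor_cohomology ::
  "(int \<Rightarrow> ('a, 'x) monoid_scheme) \<Rightarrow> (int \<Rightarrow> 'a \<Rightarrow> 'a) \<Rightarrow> (int \<Rightarrow> ('b, 'y) monoid_scheme)
    \<Rightarrow> (int \<Rightarrow> 'b \<Rightarrow> 'b) \<Rightarrow> int \<Rightarrow> ((int \<times> 'a \<times> 'b \<Rightarrow>\<^sub>0 int) set \<Rightarrow> int) set monoid"
  where "tensor_cohomology A dA B dB n =
    homology_at (hom_group (tensor A B (n - 1)) integer_group) (tensor_coboundary A dA B dB (n - 1))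
      (hom_group (tensor A B n) integer_group) (tensor_coboundary A dA B dB n)
      (hom_group (tensor A B (n + 1)) integer_group)"


section \<open>The cocycle and its slant product\<close>

text \<open>
  The value \<open>a(c \<otimes> x)\<close> for \<open>c \<in> C\<^sub>p\<close> and \<open>x \<in> D\<^bsub>n-p\<^esub>\<close>.
\<close>

definition tensor_value ::
  "(int \<Rightarrow> ('c, 'y) ring_scheme) \<Rightarrow> (int \<Rightarrow> ('d, 'z) ring_scheme) \<Rightarrow> int
    \<Rightarrow> ((int \<times> 'c \<times> 'd \<Rightarrow>\<^sub>0 int) set \<Rightarrow> int) \<Rightarrow> int \<Rightarrow> 'c \<Rightarrow> 'd \<Rightarrow> int"
  where "tensor_value C D n a p c x =
    a (pure_tensor (\<lambda>m. add_monoid (C m)) (\<lambda>m. add_monoid (D m)) n p c x)"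

definition cocycle_support ::
  "(int \<Rightarrow> ('c, 'y) ring_scheme) \<Rightarrow> (int \<Rightarrow> ('d, 'z) ring_scheme) \<Rightarrow> (int \<Rightarrow> 'd set) \<Rightarrow> int
    \<Rightarrow> ((int \<times> 'c \<times> 'd \<Rightarrow>\<^sub>0 int) set \<Rightarrow> int) \<Rightarrow> int \<Rightarrow> 'c \<Rightarrow> 'd set"
  where "cocycle_support C D S n a p c = {\<sigma> \<in> S (n - p). tensor_value C D n a p c \<sigma> \<noteq> 0}"

definition inv_finite_cocycle ::
  "('g, 'x) monoid_scheme \<Rightarrow> (int \<Rightarrow> ('g, 'c, 'y) module_scheme) \<Rightarrow> (int \<Rightarrow> 'c \<Rightarrow> 'c)
    \<Rightarrow> (int \<Rightarrow> ('g, 'd, 'z) module_scheme) \<Rightarrow> (int \<Rightarrow> 'd set) \<Rightarrow> (int \<Rightarrow> 'd \<Rightarrow> 'd) \<Rightarrow> int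
    \<Rightarrow> ((int \<times> 'c \<times> 'd \<Rightarrow>\<^sub>0 int) set \<Rightarrow> int) \<Rightarrow> bool"
  where "inv_finite_cocycle \<Gamma> C dC D S dD n a \<longleftrightarrow>
    (let A = (\<lambda>m. add_monoid (C m)); B = (\<lambda>m. add_monoid (D m)) in
      a \<in> hom (tensor A B n) integer_group \<and>
      (\<forall>X\<in>carrier (tensor A B (n + 1)). a (tensor_boundary A dC B dD (n + 1) X) = 0) \<and>
      (\<forall>p. \<forall>\<gamma>\<in>carrier \<Gamma>. \<forall>c\<in>carrier (C p). \<forall>x\<in>carrier (D (n - p)).
        tensor_value C D n a p (\<gamma> \<odot>\<^bsub>C p\<^esub> c) (\<gamma> \<odot>\<^bsub>D (n - p)\<^esub> x) = tensor_value C D n a p c x) \<and>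
      (\<forall>p. \<forall>c\<in>carrier (C p). finite (cocycle_support C D S n a p c)))"

text \<open>
  The extension of \<open>a\<close> to \<open>C \<otimes> D\<^sup>\<Gamma>\<close>, where \<open>D\<^sup>\<Gamma> = D\<^sup>\<Gamma>(\<int>)\<close>, is the cochain with
  \<open>c \<otimes> z \<mapsto> \<Sum> a(c \<otimes> \<sigma>) z\<^sub>\<sigma>\<close>; \<open>a\<close> represents the class that contains it.
\<close>

definition represents_class ::
  "('g, 'x) monoid_scheme \<Rightarrow> (int \<Rightarrow> ('g, 'c, 'y) module_scheme) \<Rightarrow> (int \<Rightarrow> 'c \<Rightarrow> 'c)
    \<Rightarrow> (int \<Rightarrow> ('g, 'd, 'z) module_scheme) \<Rightarrow> (int \<Rightarrow> 'd set) \<Rightarrow> (int \<Rightarrow> 'd \<Rightarrow> 'd) \<Rightarrow> int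
    \<Rightarrow> ((int \<times> 'c \<times> 'd \<Rightarrow>\<^sub>0 int) set \<Rightarrow> int)
    \<Rightarrow> ((int \<times> 'c \<times> ('d \<Rightarrow> int) \<Rightarrow>\<^sub>0 int) set \<Rightarrow> int) set \<Rightarrow> bool"
  where "represents_class \<Gamma> C dC D S dD n a astar \<longleftrightarrow>
    (let A = (\<lambda>m. add_monoid (C m)); E = (\<lambda>m. inv_chains \<Gamma> (D m) (S m) trivial_Z);
         dE = inv_boundary D S dD (trivial_Z :: ('g, int) module) in
      astar \<in> carrier (tensor_cohomology A dC E dE n) \<and>
      (\<exists>e\<in>astar. \<forall>p. \<forall>c\<in>carrier (C p). \<forall>z\<in>carrier (E (n - p)).
        e (pure_tensor A E n p c z) =
          (\<Sum>\<sigma>\<in>cocycle_support C D S n a p c. tensor_value C D n a p c \<sigma> * z \<sigma>)))"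

text \<open>
  \<open>(a/z)(c) = \<Sum> a(c \<otimes> \<sigma>) \<lambda>\<^sub>\<sigma>\<close> for \<open>z = \<Sum> \<lambda>\<^sub>\<sigma> \<sigma>\<close> in degree \<open>n - k\<close> and \<open>c \<in> C\<^sub>k\<close>.
\<close>

definition slant_chain ::
  "(int \<Rightarrow> ('c, 'y) ring_scheme) \<Rightarrow> (int \<Rightarrow> ('d, 'z) ring_scheme) \<Rightarrow> (int \<Rightarrow> 'd set) \<Rightarrow> int
    \<Rightarrow> ((int \<times> 'c \<times> 'd \<Rightarrow>\<^sub>0 int) set \<Rightarrow> int) \<Rightarrow> ('n, 'w) ring_scheme \<Rightarrow> int
    \<Rightarrow> ('d \<Rightarrow> 'n) \<Rightarrow> ('c \<Rightarrow> 'n)"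
  where "slant_chain C D S n a N k z =
    (\<lambda>c\<in>carrier (C k).
      \<Oplus>\<^bsub>N\<^esub>\<sigma>\<in>cocycle_support C D S n a k c. [tensor_value C D n a k c \<sigma>] \<cdot>\<^bsub>N\<^esub> z \<sigma>)"

definition slant ::
  "('g, 'x) monoid_scheme \<Rightarrow> (int \<Rightarrow> ('g, 'c, 'y) module_scheme) \<Rightarrow> (int \<Rightarrow> 'c \<Rightarrow> 'c)
    \<Rightarrow> (int \<Rightarrow> ('g, 'd, 'z) module_scheme) \<Rightarrow> (int \<Rightarrow> 'd set) \<Rightarrow> int
    \<Rightarrow> ((int \<times> 'c \<times> 'd \<Rightarrow>\<^sub>0 int) set \<Rightarrow> int) \<Rightarrow> ('g, 'n, 'w) module_scheme \<Rightarrow> int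
    \<Rightarrow> ('d \<Rightarrow> 'n) set \<Rightarrow> ('c \<Rightarrow> 'n) set"
  where "slant \<Gamma> C dC D S n a N k =
    induced (Hom_G \<Gamma> (C k) N) (coboundaries \<Gamma> C dC N k) (slant_chain C D S n a N k)"

end

theory Submission
  imports Defs
begin

text \<open>
  Transposing the boundary operator across the pairing of finitely supported functions on the basis
  with formal sums shows that \<open>a(c \<otimes> \<partial>z) = \<Sum> a(c \<otimes> \<partial>\<sigma>) \<lambda>\<^sub>\<sigma>\<close>.  Hence the cocycle condition gives
  \<open>\<delta>(a/z) = (-1)\<^sup>k (a/\<partial>z)\<close> on infinite chains with arbitrary coefficients, and slanting is natural in
  the coefficients.  If \<open>z\<close> is a cycle over \<open>M\<close> with lift \<open>y\<close> over \<open>L\<close> and \<open>\<iota> w = \<partial>y\<close>, then \<open>a/y\<close> lifts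
  \<open>a/z\<close> and \<open>\<delta>(a/y) = (-1)\<^sup>k \<iota>(a/w)\<close>, so both ways around the square give \<open>[a/w]\<close> up to the sign
  \<open>(-1)\<^sup>k\<close>.
\<close>

section \<open>Maps on cosets\<close>

text \<open>All four maps of the square are given by descriptions on cosets, so each must be shown
  well defined before it can be evaluated on a representative. For the connecting maps this requires
  the coefficient sequence to stay exact on chains and on cochains. Freeness enters there twice:
  lifts of invariant chains are chosen at orbit representatives in \<open>S\<close> and spread by
  the free action, and lifts of equivariant cochains are chosen on a basis of \<open>C\<close> over
  the group ring. The other obstacle is that formal sums are infinite, so nothing can be proved by
  additivity over their terms. What is finite is the functional that reads them: the incidences with
  a fixed \<open>\<tau>\<close>, or the values of \<open>a\<close> at a fixed \<open>c\<close>. Sums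
  are therefore treated as finite combinations governed by such a functional, and rearrangements
  take place in the free abelian group on \<open>S\<close>. Groups of chains and classes are written
  multiplicatively, so the sign appears as an exponent 1 or -1.\<close>

lemma induced_rcoset:
  assumes "group G" "group H" "f \<in> hom G H" "subgroup Q G" "subgroup R H"
    and sub: "f ` Q \<subseteq> R" and z: "z \<in> carrier G"
  shows "induced H R f (Q #>\<^bsub>G\<^esub> z) = R #>\<^bsub>H\<^esub> f z"
proof -
  interpret f: group_hom G H f
    using assms by (simp add: group_hom_def group_hom_axioms_def)
  interpret Q: subgroup Q G by fact
  interpret R: subgroup R H by fact
  \<comment> \<open>Another representative is \<open>q\<close> times \<open>z\<close> with
    \<open>q\<close> in \<open>Q\<close>; its image differs from \<open>f z\<close> by
    \<open>f q\<close>, which lies in \<open>R\<close>. This is the uniqueness that the description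
    in \<open>induced\<close> requires.\<close>
  have const: "R #>\<^bsub>H\<^esub> f x = R #>\<^bsub>H\<^esub> f z" if "x \<in> Q #>\<^bsub>G\<^esub> z" for x
  proof -
    obtain q where q: "q \<in> Q" "x = q \<otimes>\<^bsub>G\<^esub> z"
      using \<open>x \<in> Q #>\<^bsub>G\<^esub> z\<close> by (auto simp: r_coset_def)
    then have "f x \<in> R #>\<^bsub>H\<^esub> f z"
      using z sub by (auto simp: r_coset_def)
    then show ?thesis
      using f.H.repr_independence[OF _ _ assms(5)] z by simp
  qed
  have "z \<in> Q #>\<^bsub>G\<^esub> z"
    using f.G.rcos_self[OF z assms(4)] .
  then show ?thesis
    unfolding induced_def by (intro the_equality) (use const in blast)+
qed

text \<open>The description in \<open>connecting\<close> ranges over all representatives of the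
  class, all lifts and all preimages; the diagram chase shows that they give one coset. It spans
  three consecutive degrees: surjectivity is applied at \<open>M2\<close>, exactness at
  \<open>L1\<close>, injectivity at \<open>K0\<close>.\<close>

lemma connecting_rcoset:
  assumes groups: "group K1" "group K0" "group L2" "group L1" "group L0" "group M2" "group M1"
    and homs: "dK \<in> hom K1 K0" "dL2 \<in> hom L2 L1" "dL1 \<in> hom L1 L0" "dM \<in> hom M2 M1"
      "i1 \<in> hom K1 L1" "i0 \<in> hom K0 L0" "p2 \<in> hom L2 M2" "p1 \<in> hom L1 M1"
    and inj: "inj_on i0 (carrier K0)" and surj: "carrier M2 \<subseteq> p2 ` carrier L2"
    and exact: "kernel L1 M1 p1 \<subseteq> i1 ` carrier K1"
    and comm_i: "\<And>x. x \<in> carrier K1 \<Longrightarrow> dL1 (i1 x) = i0 (dK x)"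
    and comm_p: "\<And>y. y \<in> carrier L2 \<Longrightarrow> p1 (dL2 y) = dM (p2 y)"
    and dd: "\<And>y. y \<in> carrier L2 \<Longrightarrow> dL1 (dL2 y) = \<one>\<^bsub>L0\<^esub>"
    and y: "y \<in> carrier L1" and w: "w \<in> carrier K0" and wy: "i0 w = dL1 y"
  shows "connecting L1 p1 dL1 K0 i0 (dK ` carrier K1) (dM ` carrier M2 #>\<^bsub>M1\<^esub> p1 y)
    = dK ` carrier K1 #>\<^bsub>K0\<^esub> w"
proof -
  interpret dK: group_hom K1 K0 dK using groups homs by (simp add: group_hom_def group_hom_axioms_def)
  interpret dL2: group_hom L2 L1 dL2 using groups homs by (simp add: group_hom_def group_hom_axioms_def)
  interpret dL1: group_hom L1 L0 dL1 using groups homs by (simp add: group_hom_def group_hom_axioms_def)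
  interpret dM: group_hom M2 M1 dM using groups homs by (simp add: group_hom_def group_hom_axioms_def)
  interpret i1: group_hom K1 L1 i1 using groups homs by (simp add: group_hom_def group_hom_axioms_def)
  interpret i0: group_hom K0 L0 i0 using groups homs by (simp add: group_hom_def group_hom_axioms_def)
  interpret p2: group_hom L2 M2 p2 using groups homs by (simp add: group_hom_def group_hom_axioms_def)
  interpret p1: group_hom L1 M1 p1 using groups homs by (simp add: group_hom_def group_hom_axioms_def)
  let ?R = "dK ` carrier K1"
  have const: "?R #>\<^bsub>K0\<^esub> w' = ?R #>\<^bsub>K0\<^esub> w"
    if z': "p1 y' \<in> dM ` carrier M2 #>\<^bsub>M1\<^esub> p1 y" and y': "y' \<in> carrier L1"
      and w': "w' \<in> carrier K0" and wy': "i0 w' = dL1 y'" for y' w'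
  proof -
    obtain u where u: "u \<in> carrier M2" "p1 y' = dM u \<otimes>\<^bsub>M1\<^esub> p1 y"
      using z' by (auto simp: r_coset_def)
    obtain v where v: "v \<in> carrier L2" "p2 v = u"
      using surj u by auto
    \<comment> \<open>Correcting \<open>y\<close> by the boundary of a lift of \<open>u\<close>
      gives it the same projection as \<open>y'\<close>, so the quotient of the two comes from
      \<open>K1\<close>. The correction disappears under \<open>dL1\<close> by
      \<open>dd\<close>.\<close>
    let ?x = "dL2 v \<otimes>\<^bsub>L1\<^esub> y"
    have x: "?x \<in> carrier L1" using v y by simp
    have "p1 (y' \<otimes>\<^bsub>L1\<^esub> inv\<^bsub>L1\<^esub> ?x) = \<one>\<^bsub>M1\<^esub>"
      using v y y' u x comm_p[OF v(1)] by simp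
    then have "y' \<otimes>\<^bsub>L1\<^esub> inv\<^bsub>L1\<^esub> ?x \<in> kernel L1 M1 p1"
      unfolding kernel_def using x y' by blast
    then obtain \<kappa> where \<kappa>: "\<kappa> \<in> carrier K1" "y' \<otimes>\<^bsub>L1\<^esub> inv\<^bsub>L1\<^esub> ?x = i1 \<kappa>"
      using exact by blast
    then have "y' = i1 \<kappa> \<otimes>\<^bsub>L1\<^esub> ?x"
      using group.inv_solve_right[OF groups(4), of "i1 \<kappa>" y' ?x] x y' by simp
    then have "dL1 y' = i0 (dK \<kappa>) \<otimes>\<^bsub>L0\<^esub> dL1 y"
      using x y v \<kappa> by (simp add: comm_i dd)
    then have "i0 w' = i0 (dK \<kappa> \<otimes>\<^bsub>K0\<^esub> w)"
      using wy wy' w \<kappa> by simp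
    then have "w' = dK \<kappa> \<otimes>\<^bsub>K0\<^esub> w"
      using inj w w' \<kappa> by (simp add: inj_on_def)
    then have "w' \<in> ?R #>\<^bsub>K0\<^esub> w"
      using \<kappa> by (auto simp: r_coset_def)
    then show ?thesis
      using dK.H.repr_independence[OF _ w dK.img_is_subgroup] by simp
  qed
  have "p1 y \<in> dM ` carrier M2 #>\<^bsub>M1\<^esub> p1 y"
    by (rule dM.H.rcos_self) (use y dM.img_is_subgroup in auto)
  then show ?thesis
    unfolding connecting_def
    by (intro the_equality) (use y w wy const in blast)+
qed

text \<open>Lets an exponent in the homology group be evaluated on representatives: the coset map on
  cycles is a homomorphism. Here \<open>gf\<close> places the image inside the kernel and
  commutativity makes it normal there.\<close>

lemma rcoset_int_pow_homology_at:
  assumes "group G1" "comm_group G" "group G2" "f \<in> hom G1 G" "g \<in> hom G G2"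
    and gf: "\<And>x. x \<in> carrier G1 \<Longrightarrow> g (f x) = \<one>\<^bsub>G2\<^esub>"
    and z: "z \<in> kernel G G2 g"
  shows "(f ` carrier G1 #>\<^bsub>G\<^esub> z) [^]\<^bsub>homology_at G1 f G g G2\<^esub> (i::int)
    = f ` carrier G1 #>\<^bsub>G\<^esub> (z [^]\<^bsub>G\<^esub> i)"
proof -
  interpret G: comm_group G by fact
  interpret f: group_hom G1 G f
    using assms by (simp add: group_hom_def group_hom_axioms_def comm_group_def)
  interpret g: group_hom G G2 g
    using assms by (simp add: group_hom_def group_hom_axioms_def comm_group_def)
  let ?Z = "kernel G G2 g" and ?R = "f ` carrier G1"
  let ?G = "G\<lparr>carrier := ?Z\<rparr>"
  have ZG: "subgroup ?Z G" by (rule g.subgroup_kernel)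
  interpret Z: comm_group ?G
    using subgroup.subgroup_is_group[OF ZG G.group_axioms]
    by (rule group.group_comm_groupI) (auto simp: kernel_def G.m_comm)
  have "?R \<subseteq> ?Z" by (auto simp: kernel_def gf)
  then have "subgroup ?R ?G"
    using G.subgroup_incl[OF f.img_is_subgroup ZG] by simp
  then interpret R: normal ?R ?G by (rule Z.subgroup_imp_normal)
  have coset: "?R #>\<^bsub>?G\<^esub> x = ?R #>\<^bsub>G\<^esub> x" for x
    by (simp add: r_coset_def)
  have "?R #>\<^bsub>?G\<^esub> (z [^]\<^bsub>?G\<^esub> i) = (?R #>\<^bsub>?G\<^esub> z) [^]\<^bsub>?G Mod ?R\<^esub> i"
    using hom_int_pow[OF R.r_coset_hom_Mod _ Z.group_axioms R.factorgroup_is_group] z by simp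
  then show ?thesis
    unfolding homology_at_def coset using G.int_pow_consistent[OF ZG z] by simp
qed

lemma carrier_homology_atE:
  assumes "X \<in> carrier (homology_at A f B g C)"
  obtains z where "z \<in> kernel B C g" "X = f ` carrier A #>\<^bsub>B\<^esub> z"
proof -
  have "f ` carrier A #>\<^bsub>B\<lparr>carrier := Z\<rparr>\<^esub> z = f ` carrier A #>\<^bsub>B\<^esub> z" for Z z
    by (simp add: r_coset_def)
  then show thesis
    using assms that by (auto simp: homology_at_def FactGroup_def RCOSETS_def)
qed


section \<open>Integer combinations\<close>

text \<open>Differences are the closure step of \<open>free_Abelian_group_induct\<close> and also
  the shape of the tensor relators, hence a rule for them.\<close>

lemma hom_free_Abelian_group_diff:
  assumes "h \<in> hom (free_Abelian_group S) G" "group G"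
    and "Poly_Mapping.keys x \<subseteq> S" "Poly_Mapping.keys y \<subseteq> S"
  shows "h (x - y) = h x \<otimes>\<^bsub>G\<^esub> inv\<^bsub>G\<^esub> h y"
proof -
  interpret h: group_hom "free_Abelian_group S" G h
    using assms(1,2) by (simp add: group_hom_def group_hom_axioms_def)
  show ?thesis
    using h.hom_mult[of x "- y"] h.hom_inv[of y] assms(3,4) by simp
qed

lemma hom_free_Abelian_group_eqI:
  assumes "h \<in> hom (free_Abelian_group S) G" "h' \<in> hom (free_Abelian_group S) G" "group G"
    and eq: "\<And>s. s \<in> S \<Longrightarrow> h (frag_of s) = h' (frag_of s)"
    and u: "Poly_Mapping.keys u \<subseteq> S"
  shows "h u = h' u"
proof (rule free_Abelian_group_induct[OF u])
  note hom_one = Group.hom_one[OF _ group_free_Abelian_group assms(3)]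
  show "h 0 = h' 0"
    using hom_one[OF assms(1)] hom_one[OF assms(2)] by simp
  show "h (x - y) = h' (x - y)"
    if "Poly_Mapping.keys x \<subseteq> S" "Poly_Mapping.keys y \<subseteq> S" "h x = h' x" "h y = h' y" for x y
    unfolding hom_free_Abelian_group_diff[OF assms(1,3) that(1,2)]
      hom_free_Abelian_group_diff[OF assms(2,3) that(1,2)] that ..
qed (rule eq)

context abelian_group
begin

text \<open>Padding with zero coefficients lets combinations with different key sets be added over
  one common index set.\<close>

lemma int_comb_superset:
  assumes "f \<in> A \<rightarrow> carrier G" "finite A" "Poly_Mapping.keys u \<subseteq> A"
  shows "int_comb G f u = (\<Oplus>i\<in>A. [Poly_Mapping.lookup u i] \<cdot> f i)"
  unfolding int_comb_def
  by (rule add.finprod_mono_neutral_cong_left)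
    (use assms in \<open>auto simp: in_keys_iff add_pow_def[of _ 0] intro!: add.int_pow_closed\<close>)

lemma int_comb_closed:
  "f \<in> S \<rightarrow> carrier G \<Longrightarrow> Poly_Mapping.keys u \<subseteq> S \<Longrightarrow> int_comb G f u \<in> carrier G"
  unfolding int_comb_def by (intro finsum_closed) (auto intro!: add.int_pow_closed)

lemma int_comb_add:
  assumes f: "f \<in> S \<rightarrow> carrier G" and "Poly_Mapping.keys u \<subseteq> S" "Poly_Mapping.keys v \<subseteq> S"
  shows "int_comb G f (u + v) = int_comb G f u \<oplus> int_comb G f v"
proof -
  let ?A = "Poly_Mapping.keys u \<union> Poly_Mapping.keys v"
  have fA: "f \<in> ?A \<rightarrow> carrier G" using assms by auto
  have "int_comb G f (u + v)
    = (\<Oplus>i\<in>?A. [Poly_Mapping.lookup u i] \<cdot> f i \<oplus> [Poly_Mapping.lookup v i] \<cdot> f i)"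
    unfolding int_comb_superset[OF fA finite_UnI[OF finite_keys finite_keys] keys_add]
    by (intro finsum_cong) (use fA in \<open>auto simp: lookup_add add.int_pow_mult Pi_iff simp_implies_def\<close>)
  also have "\<dots> = int_comb G f u \<oplus> int_comb G f v"
    using fA by (subst finsum_addf) (auto simp: int_comb_superset[OF fA] intro!: add.int_pow_closed)
  finally show ?thesis .
qed

lemma int_comb_hom:
  "f \<in> S \<rightarrow> carrier G \<Longrightarrow> int_comb G f \<in> hom (free_Abelian_group S) (add_monoid G)"
  by (intro homI) (auto simp: int_comb_add intro: int_comb_closed)

lemma int_comb_zero [simp]: "int_comb G f 0 = \<zero>"
  by (simp add: int_comb_def)

lemma int_comb_frag_of: "f s \<in> carrier G \<Longrightarrow> int_comb G f (frag_of s) = f s"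
  by (simp add: int_comb_def)

lemma int_comb_uminus:
  assumes "f \<in> S \<rightarrow> carrier G" "Poly_Mapping.keys u \<subseteq> S"
  shows "int_comb G f (- u) = \<ominus> int_comb G f u"
proof -
  have "int_comb G f (- u) \<oplus> int_comb G f u = \<zero>"
    using int_comb_add[of f S "- u" u] assms by simp
  then show ?thesis
    using minus_equality int_comb_closed assms by (metis keys_minus)
qed

lemma int_comb_cong:
  assumes "Poly_Mapping.keys u \<subseteq> S" "\<And>s. s \<in> S \<Longrightarrow> f s = g s" "g \<in> S \<rightarrow> carrier G"
  shows "int_comb G f u = int_comb G g u"
  unfolding int_comb_def
  by (intro finsum_cong) (use assms in \<open>force simp: simp_implies_def\<close>)+

lemma int_comb_fun_add:
  assumes "f \<in> S \<rightarrow> carrier G" "g \<in> S \<rightarrow> carrier G" "Poly_Mapping.keys u \<subseteq> S"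
  shows "int_comb G (\<lambda>s. f s \<oplus> g s) u = int_comb G f u \<oplus> int_comb G g u"
proof -
  have "int_comb G (\<lambda>s. f s \<oplus> g s) u = (\<Oplus>i\<in>Poly_Mapping.keys u.
      [Poly_Mapping.lookup u i] \<cdot> f i \<oplus> [Poly_Mapping.lookup u i] \<cdot> g i)"
    unfolding int_comb_def
    by (intro finsum_cong)
      (use assms in \<open>auto simp: add.int_pow_distrib Pi_iff subset_eq simp_implies_def\<close>)
  also have "\<dots> = int_comb G f u \<oplus> int_comb G g u"
    unfolding int_comb_def
    by (rule finsum_addf) (use assms in \<open>auto intro!: add.int_pow_closed\<close>)
  finally show ?thesis .
qed

text \<open>Both sides are additive in \<open>u\<close> and agree on generators. This finite
  interchange of sums lies behind the transposition of the boundary and the equivariance of lifts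
  from a free module.\<close>

lemma int_comb_frag_extend:
  assumes z: "z \<in> T \<rightarrow> carrier G" and r: "\<And>s. s \<in> S \<Longrightarrow> Poly_Mapping.keys (r s) \<subseteq> T"
    and u: "Poly_Mapping.keys u \<subseteq> S"
  shows "int_comb G (\<lambda>s. int_comb G z (r s)) u = int_comb G z (frag_extend r u)"
proof (rule hom_free_Abelian_group_eqI[OF int_comb_hom _ a_group _ u])
  show "(\<lambda>s. int_comb G z (r s)) \<in> S \<rightarrow> carrier G"
    using int_comb_closed[OF z r] by auto
  have keys: "Poly_Mapping.keys (frag_extend r v) \<subseteq> T" if "Poly_Mapping.keys v \<subseteq> S" for v
    using keys_frag_extend[of r v] r that by fastforce
  show "(\<lambda>u. int_comb G z (frag_extend r u)) \<in> hom (free_Abelian_group S) (add_monoid G)"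
    by (intro homI) (simp_all add: frag_extend_add int_comb_add[OF z] keys int_comb_closed[OF z])
  show "int_comb G (\<lambda>s. int_comb G z (r s)) (frag_of s) = int_comb G z (frag_extend r (frag_of s))"
    if "s \<in> S" for s
    using int_comb_closed[OF z r[OF that]] by (simp add: int_comb_frag_of)
qed

end

lemma hom_int_comb:
  assumes "abelian_group G" "abelian_group H" and h: "h \<in> hom (add_monoid G) (add_monoid H)"
    and f: "f \<in> S \<rightarrow> carrier G" and u: "Poly_Mapping.keys u \<subseteq> S"
  shows "h (int_comb G f u) = int_comb H (\<lambda>s. h (f s)) u"
proof -
  interpret G: abelian_group G by fact
  interpret H: abelian_group H by fact
  have hf: "(\<lambda>s. h (f s)) \<in> S \<rightarrow> carrier H"
    using h f by (auto simp: hom_def)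
  show ?thesis
  proof (rule hom_free_Abelian_group_eqI[OF _ H.int_comb_hom[OF hf] H.a_group _ u])
    show "(\<lambda>u. h (int_comb G f u)) \<in> hom (free_Abelian_group S) (add_monoid H)"
      using hom_compose[OF G.int_comb_hom[OF f] h] by (simp add: comp_def)
    show "h (int_comb G f (frag_of s)) = int_comb H (\<lambda>s. h (f s)) (frag_of s)" if "s \<in> S" for s
      using f hf that by (auto simp: G.int_comb_frag_of H.int_comb_frag_of Pi_iff)
  qed
qed

lemma hom_int_comb_integer:
  fixes f :: "'i \<Rightarrow> 'a"
  assumes "abelian_group G" and h: "h \<in> hom (add_monoid G) integer_group"
    and f: "f \<in> S \<rightarrow> carrier G" and u: "Poly_Mapping.keys u \<subseteq> S"
  shows "h (int_comb G f u)
    = (\<Sum>s\<in>Poly_Mapping.keys u. Poly_Mapping.lookup u s * h (f s))"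
proof -
  interpret G: abelian_group G by fact
  \<comment> \<open>\<open>integer_group\<close> is a multiplicative record, whereas
    \<open>int_comb\<close> takes values in an additive one. \<open>trivial_Z\<close> carries the
    same integers additively, with \<open>unit\<close> as a placeholder for the acting type.\<close>
  let ?Z = "trivial_Z :: (unit, int) module"
  interpret Z: abelian_group ?Z
    by (rule abelian_groupI) (auto simp: trivial_Z_def intro: exI[of _ "- x" for x])
  have hZ: "h \<in> hom (add_monoid G) (add_monoid ?Z)"
    using h by (auto simp: hom_def integer_group_def trivial_Z_def)
  have pow: "[m] \<cdot>\<^bsub>?Z\<^esub> x = m * x" for m x :: int
  proof -
    have "(\<lambda>x. x) \<in> hom integer_group (add_monoid ?Z)"
      by (auto simp: hom_def integer_group_def trivial_Z_def)
    then show ?thesis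
      using hom_int_pow[of "\<lambda>x. x" integer_group "add_monoid ?Z" x m] Z.a_group
      by (simp add: add_pow_def)
  qed
  have sum: "finsum ?Z g A = sum g A" if "finite A" for g :: "'i \<Rightarrow> int" and A
    using that
  proof induction
    case empty
    then show ?case by (simp only: Z.finsum_empty) (simp add: trivial_Z_def)
  next
    case (insert x F)
    then show ?case by (subst Z.finsum_insert) (simp_all add: trivial_Z_def)
  qed
  have "h (int_comb G f u) = int_comb ?Z (\<lambda>s. h (f s)) u"
    by (rule hom_int_comb[OF assms(1) Z.abelian_group_axioms hZ f u])
  also have "\<dots> = (\<Sum>s\<in>Poly_Mapping.keys u. Poly_Mapping.lookup u s * h (f s))"
    unfolding int_comb_def pow by (rule sum) simp
  finally show ?thesis .
qed


section \<open>Pairing finitely supported functions with formal sums\<close>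

text \<open>Common form of two sums: with incidence numbers as \<open>h\<close> it is a coefficient
  of the boundary of a formal sum, with values of the cocycle as \<open>h\<close> it is a slant
  product. The index set is the support of \<open>h\<close>, since that of \<open>z\<close> may be
  infinite.\<close>

definition pairing ::
  "('n, 'z) ring_scheme \<Rightarrow> 'i set \<Rightarrow> ('i \<Rightarrow> int) \<Rightarrow> ('i \<Rightarrow> 'n) \<Rightarrow> 'n"
  where "pairing N S h z = (\<Oplus>\<^bsub>N\<^esub>\<sigma>\<in>{\<sigma> \<in> S. h \<sigma> \<noteq> 0}. [h \<sigma>] \<cdot>\<^bsub>N\<^esub> z \<sigma>)"

text \<open>Views \<open>h\<close>, cut off outside \<open>S\<close>, as an element of the free
  abelian group on \<open>S\<close>. \<open>Abs_poly_mapping\<close> is meaningful only for finite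
  support, so the facts about it assume that.\<close>

definition frag_on :: "'i set \<Rightarrow> ('i \<Rightarrow> int) \<Rightarrow> ('i \<Rightarrow>\<^sub>0 int)"
  where "frag_on S h = Abs_poly_mapping (\<lambda>s. if s \<in> S then h s else 0)"

lemma lookup_frag_on:
  assumes "finite {s \<in> S. h s \<noteq> 0}"
  shows "Poly_Mapping.lookup (frag_on S h) s = (if s \<in> S then h s else 0)"
proof -
  have "finite {s. (if s \<in> S then h s else 0) \<noteq> 0}"
    by (rule finite_subset[OF _ assms]) (auto split: if_splits)
  then show ?thesis
    unfolding frag_on_def by (simp add: Abs_poly_mapping_inverse)
qed

lemma keys_frag_on:
  assumes "finite {s \<in> S. h s \<noteq> 0}"
  shows "Poly_Mapping.keys (frag_on S h) = {s \<in> S. h s \<noteq> 0}"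
  using lookup_frag_on[OF assms] by (auto simp: in_keys_iff split: if_splits)

lemma lookup_frag_extend:
  "Poly_Mapping.lookup (frag_extend b c) k
    = (\<Sum>i\<in>Poly_Mapping.keys c. Poly_Mapping.lookup c i * Poly_Mapping.lookup (b i) k)"
  by (simp add: frag_extend_def lookup_sum)

context abelian_group
begin

text \<open>Moves a pairing into the free abelian group on \<open>S\<close>, where additivity and
  naturality are already known; the linearity rules for pairings come from there.\<close>

lemma pairing_eq_int_comb:
  assumes "finite {s \<in> S. h s \<noteq> 0}" "z \<in> S \<rightarrow> carrier G"
  shows "pairing G S h z = int_comb G z (frag_on S h)"
  unfolding pairing_def int_comb_def keys_frag_on[OF assms(1)]
  by (intro finsum_cong)
    (use assms in \<open>auto simp: lookup_frag_on simp_implies_def intro!: add.int_pow_closed\<close>)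

lemma pairing_closed:
  "z \<in> S \<rightarrow> carrier G \<Longrightarrow> pairing G S h z \<in> carrier G"
  unfolding pairing_def by (intro finsum_closed) (auto intro!: add.int_pow_closed)

lemma pairing_cong:
  assumes "\<And>s. s \<in> S \<Longrightarrow> h s = h' s" "\<And>s. s \<in> S \<Longrightarrow> z s = z' s" "z' \<in> S \<rightarrow> carrier G"
  shows "pairing G S h z = pairing G S h' z'"
  unfolding pairing_def
  by (intro finsum_cong)
    (use assms in \<open>auto simp: simp_implies_def intro!: add.int_pow_closed\<close>)

text \<open>Cancellation can shrink the support of the sum, so the three pairings have different
  index sets; in the free abelian group the addition is plain.\<close>

lemma pairing_add_left:
  assumes z: "z \<in> S \<rightarrow> carrier G"
    and h: "finite {s \<in> S. h s \<noteq> 0}" and h': "finite {s \<in> S. h' s \<noteq> 0}"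
  shows "pairing G S (\<lambda>s. h s + h' s) z = pairing G S h z \<oplus> pairing G S h' z"
proof -
  have fin: "finite {s \<in> S. h s + h' s \<noteq> 0}"
    by (rule finite_subset[OF _ finite_UnI[OF h h']]) auto
  have "frag_on S (\<lambda>s. h s + h' s) = frag_on S h + frag_on S h'"
    by (rule poly_mapping_eqI) (simp add: lookup_frag_on[OF fin] lookup_frag_on[OF h]
        lookup_frag_on[OF h'] lookup_add)
  then show ?thesis
    using int_comb_add[OF z, of "frag_on S h" "frag_on S h'"]
    by (simp add: pairing_eq_int_comb h h' fin z keys_frag_on)
qed

lemma pairing_uminus_left:
  assumes z: "z \<in> S \<rightarrow> carrier G" and h: "finite {s \<in> S. h s \<noteq> 0}"
  shows "pairing G S (\<lambda>s. - h s) z = \<ominus> pairing G S h z"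
proof -
  have fin: "finite {s \<in> S. - h s \<noteq> 0}"
    using h by simp
  have "frag_on S (\<lambda>s. - h s) = - frag_on S h"
    by (rule poly_mapping_eqI) (simp add: lookup_frag_on[OF fin] lookup_frag_on[OF h])
  then show ?thesis
    using int_comb_uminus[OF z, of "frag_on S h"]
    by (simp add: pairing_eq_int_comb h z keys_frag_on)
qed

lemma pairing_add_right:
  assumes z: "z \<in> S \<rightarrow> carrier G" and w: "w \<in> S \<rightarrow> carrier G" and h: "finite {s \<in> S. h s \<noteq> 0}"
  shows "pairing G S h (\<lambda>s\<in>S. z s \<oplus> w s) = pairing G S h z \<oplus> pairing G S h w"
proof -
  have zw: "(\<lambda>s. z s \<oplus> w s) \<in> S \<rightarrow> carrier G" using z w by auto
  have "pairing G S h (\<lambda>s\<in>S. z s \<oplus> w s) = pairing G S h (\<lambda>s. z s \<oplus> w s)"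
    by (rule pairing_cong) (use zw in auto)
  also have "\<dots> = pairing G S h z \<oplus> pairing G S h w"
    using int_comb_fun_add[OF z w, of "frag_on S h"]
    by (simp add: pairing_eq_int_comb h z w zw keys_frag_on)
  finally show ?thesis .
qed

lemma pairing_reindex:
  assumes z: "z \<in> S \<rightarrow> carrier G" and g: "bij_betw g S S" and h: "\<And>s. s \<in> S \<Longrightarrow> h' (g s) = h s"
  shows "pairing G S h' z = pairing G S h (\<lambda>s. z (g s))"
proof -
  have im: "{s \<in> S. h' s \<noteq> 0} = g ` {s \<in> S. h s \<noteq> 0}"
    using g h by (force simp: bij_betw_def)
  have gS: "g s \<in> S" if "s \<in> S" for s
    using bij_betwE[OF g] that by blast
  have "inj_on g {s \<in> S. h s \<noteq> 0}"
    using g by (auto simp: bij_betw_def inj_on_def)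
  then have "pairing G S h' z = (\<Oplus>s\<in>{s \<in> S. h s \<noteq> 0}. [h' (g s)] \<cdot> z (g s))"
    unfolding pairing_def im
    by (intro finsum_reindex) (use z gS in \<open>auto intro!: add.int_pow_closed\<close>)
  also have "\<dots> = pairing G S h (\<lambda>s. z (g s))"
    unfolding pairing_def
    by (intro finsum_cong)
      (use z gS in \<open>auto intro!: add.int_pow_closed simp: simp_implies_def h\<close>)
  finally show ?thesis .
qed

end

lemma hom_pairing:
  assumes "abelian_group G" "abelian_group H" "f \<in> hom (add_monoid G) (add_monoid H)"
    and z: "z \<in> S \<rightarrow> carrier G" and h: "finite {s \<in> S. h s \<noteq> 0}"
  shows "f (pairing G S h z) = pairing H S h (\<lambda>s. f (z s))"
proof -
  have fz: "(\<lambda>s. f (z s)) \<in> S \<rightarrow> carrier H"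
    using assms(3) z by (auto simp: hom_def)
  show ?thesis
    using hom_int_comb[OF assms(1-3) z, of "frag_on S h"]
    by (simp add: abelian_group.pairing_eq_int_comb assms(1,2) h z fz keys_frag_on)
qed


section \<open>Coordinates with respect to a basis over the integers\<close>

lemma basis_coeff_int_comb:
  assumes "Z_basis D S" "Poly_Mapping.keys u \<subseteq> S"
  shows "basis_coeff D S (int_comb D (\<lambda>b. b) u) = Poly_Mapping.lookup u"
  using assms unfolding Z_basis_def basis_coeff_def bij_betw_def
  by (auto simp: inv_into_f_f)

lemma Z_basis_expansion:
  assumes "Z_basis D S" "x \<in> carrier D"
  obtains u where "Poly_Mapping.keys u \<subseteq> S" "x = int_comb D (\<lambda>b. b) u"
    "Poly_Mapping.lookup u = basis_coeff D S x"
proof -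
  have "x \<in> int_comb D (\<lambda>b. b) ` carrier (free_Abelian_group S)"
    using assms unfolding Z_basis_def bij_betw_def by simp
  then obtain u where "Poly_Mapping.keys u \<subseteq> S" "x = int_comb D (\<lambda>b. b) u"
    by auto
  then show thesis
    using that basis_coeff_int_comb[OF assms(1)] by metis
qed

lemma finite_basis_coeff:
  assumes "Z_basis D S" "x \<in> carrier D"
  shows "finite {\<tau> \<in> S. basis_coeff D S x \<tau> \<noteq> 0}"
proof -
  obtain u where "Poly_Mapping.lookup u = basis_coeff D S x"
    using Z_basis_expansion[OF assms] .
  then have "{\<tau> \<in> S. basis_coeff D S x \<tau> \<noteq> 0} \<subseteq> Poly_Mapping.keys u"
    by (auto simp: in_keys_iff)
  then show ?thesis
    using finite_keys finite_subset by blast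
qed

lemma hom_eq_sum_basis_coeff:
  assumes "abelian_group D" "Z_basis D S" "x \<in> carrier D" "h \<in> hom (add_monoid D) integer_group"
  shows "h x = (\<Sum>\<tau>\<in>{\<tau> \<in> S. basis_coeff D S x \<tau> \<noteq> 0}. basis_coeff D S x \<tau> * h \<tau>)"
proof -
  obtain u where u: "Poly_Mapping.keys u \<subseteq> S" "x = int_comb D (\<lambda>b. b) u"
    "Poly_Mapping.lookup u = basis_coeff D S x"
    using Z_basis_expansion[OF assms(2,3)] .
  have "(\<lambda>b. b) \<in> S \<rightarrow> carrier D"
    using assms(2) by (auto simp: Z_basis_def)
  then have "h x = (\<Sum>\<tau>\<in>Poly_Mapping.keys u. Poly_Mapping.lookup u \<tau> * h \<tau>)"
    using hom_int_comb_integer[OF assms(1,4) _ u(1)] u(2) by simp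
  moreover have "Poly_Mapping.keys u = {\<tau> \<in> S. basis_coeff D S x \<tau> \<noteq> 0}"
    using u(1) unfolding u(3)[symmetric] by (auto simp: in_keys_iff)
  ultimately show ?thesis
    using u(3) by simp
qed

text \<open>Uniqueness of the expansion makes coordinates additive. As integer functionals they can
  be compared on basis elements alone, or transposed across a boundary.\<close>

lemma basis_coeff_hom:
  assumes "abelian_group D" "Z_basis D S"
  shows "(\<lambda>x. basis_coeff D S x \<tau>) \<in> hom (add_monoid D) integer_group"
proof (intro homI)
  interpret D: abelian_group D by fact
  fix x y assume "x \<in> carrier (add_monoid D)" "y \<in> carrier (add_monoid D)"
  then have "x \<in> carrier D" "y \<in> carrier D" by simp_all
  obtain u where u: "Poly_Mapping.keys u \<subseteq> S" "x = int_comb D (\<lambda>b. b) u"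
    using Z_basis_expansion[OF assms(2) \<open>x \<in> carrier D\<close>] .
  obtain v where v: "Poly_Mapping.keys v \<subseteq> S" "y = int_comb D (\<lambda>b. b) v"
    using Z_basis_expansion[OF assms(2) \<open>y \<in> carrier D\<close>] .
  have "(\<lambda>b. b) \<in> S \<rightarrow> carrier D"
    using assms(2) by (auto simp: Z_basis_def)
  then have "x \<oplus>\<^bsub>D\<^esub> y = int_comb D (\<lambda>b. b) (u + v)"
    using D.int_comb_add u v by metis
  moreover have "Poly_Mapping.keys (u + v) \<subseteq> S"
    using keys_add[of u v] u v by auto
  ultimately show "basis_coeff D S (x \<otimes>\<^bsub>add_monoid D\<^esub> y) \<tau>
      = basis_coeff D S x \<tau> \<otimes>\<^bsub>integer_group\<^esub> basis_coeff D S y \<tau>"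
    using u v basis_coeff_int_comb[OF assms(2)] by (simp add: lookup_add)
qed simp

lemma basis_coeff_basis:
  assumes "abelian_group D" "Z_basis D S" "\<sigma> \<in> S"
  shows "basis_coeff D S \<sigma> \<tau> = (if \<tau> = \<sigma> then 1 else 0)"
proof -
  have "\<sigma> \<in> carrier D" using assms by (auto simp: Z_basis_def)
  then have "int_comb D (\<lambda>b. b) (frag_of \<sigma>) = \<sigma>"
    using abelian_group.int_comb_frag_of[OF assms(1), of "\<lambda>b. b"] by simp
  then show ?thesis
    using basis_coeff_int_comb[OF assms(2), of "frag_of \<sigma>"] assms(3) by simp
qed

text \<open>Both sides are additive in \<open>x\<close>, so basis elements suffice; there both are
  Kronecker symbols, matched by injectivity on \<open>S\<close>.\<close>

lemma basis_coeff_automorphism: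
  assumes D: "abelian_group D" and S: "Z_basis D S" and f: "f \<in> hom (add_monoid D) (add_monoid D)"
    and fS: "f ` S \<subseteq> S" "inj_on f S" and x: "x \<in> carrier D" and \<tau>: "\<tau> \<in> S"
  shows "basis_coeff D S (f x) (f \<tau>) = basis_coeff D S x \<tau>"
proof -
  have "(\<lambda>x. basis_coeff D S (f x) (f \<tau>)) \<in> hom (add_monoid D) integer_group"
    using hom_compose[OF f basis_coeff_hom[OF D S, of "f \<tau>"]] by (simp add: comp_def)
  note sum_f = hom_eq_sum_basis_coeff[OF D S x this]
  have "basis_coeff D S (f \<sigma>) (f \<tau>) = basis_coeff D S \<sigma> \<tau>" if "\<sigma> \<in> S" for \<sigma>
    using fS that \<tau> by (auto simp: basis_coeff_basis[OF D S] inj_on_def image_subset_iff)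
  then show ?thesis
    unfolding sum_f hom_eq_sum_basis_coeff[OF D S x basis_coeff_hom[OF D S, of \<tau>]]
    by (intro sum.cong) auto
qed

text \<open>The exchange of summation on which the whole proof rests: the terms
  \<open>h \<tau>\<close> times the incidence of \<open>\<sigma>\<close> and \<open>\<tau>\<close>
  times \<open>z \<sigma>\<close> are summed in either order. Local finiteness bounds the inner sums
  and the support of \<open>h\<close> the outer one, so only finitely many \<open>\<sigma>\<close>
  occur even when \<open>z\<close> is an infinite sum. The finiteness claim is read off from the
  same double sum.\<close>

lemma pairing_transpose:
  fixes D :: "('d, 'y) ring_scheme" and D' :: "('d, 'y') ring_scheme"
  assumes D: "abelian_group D" "Z_basis D S" and D': "abelian_group D'" "Z_basis D' S'"
    and d: "d \<in> hom (add_monoid D) (add_monoid D')"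
    and fin: "\<And>\<tau>. \<tau> \<in> S' \<Longrightarrow> finite {\<sigma> \<in> S. basis_coeff D' S' (d \<sigma>) \<tau> \<noteq> 0}"
    and N: "abelian_group N" and z: "z \<in> S \<rightarrow> carrier N"
    and h: "h \<in> hom (add_monoid D') integer_group" "finite {\<tau> \<in> S'. h \<tau> \<noteq> 0}"
  shows "finite {\<sigma> \<in> S. h (d \<sigma>) \<noteq> 0}"
    and "pairing N S' h (\<lambda>\<tau>\<in>S'. pairing N S (\<lambda>\<sigma>. basis_coeff D' S' (d \<sigma>) \<tau>) z)
      = pairing N S (\<lambda>\<sigma>. h (d \<sigma>)) z"
proof -
  interpret N: abelian_group N by fact
  let ?r = "\<lambda>\<tau>. frag_on S (\<lambda>\<sigma>. basis_coeff D' S' (d \<sigma>) \<tau>)"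
  \<comment> \<open>The transpose of \<open>d\<close> applied to \<open>h\<close>: each
    \<open>\<tau>\<close> contributes \<open>h \<tau>\<close> times its function of incidences. The
    value at \<open>\<sigma>\<close> will be \<open>h (d \<sigma>)\<close>.\<close>
  let ?u = "frag_extend ?r (frag_on S' h)"
  have r: "Poly_Mapping.keys (?r \<tau>) \<subseteq> S" if "\<tau> \<in> S'" for \<tau>
    using keys_frag_on[OF fin[OF that]] by auto
  have keys_h: "Poly_Mapping.keys (frag_on S' h) \<subseteq> S'"
    by (auto simp: keys_frag_on[OF h(2)])
  have u: "Poly_Mapping.keys ?u \<subseteq> S"
    using keys_frag_extend[of ?r "frag_on S' h"] r keys_h by fastforce
  have lookup: "Poly_Mapping.lookup ?u \<sigma> = h (d \<sigma>)" if \<sigma>: "\<sigma> \<in> S" for \<sigma>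
  proof -
    have "\<sigma> \<in> carrier D" using D(2) \<sigma> by (auto simp: Z_basis_def)
    then have d\<sigma>: "d \<sigma> \<in> carrier D'" using d by (auto simp: hom_def)
    have "Poly_Mapping.lookup ?u \<sigma> = (\<Sum>\<tau>\<in>{\<tau> \<in> S'. h \<tau> \<noteq> 0}. h \<tau> * basis_coeff D' S' (d \<sigma>) \<tau>)"
      unfolding lookup_frag_extend keys_frag_on[OF h(2)]
      by (intro sum.cong) (use \<sigma> in \<open>auto simp: lookup_frag_on h(2) fin\<close>)
    \<comment> \<open>One sum runs over the support of \<open>h\<close>, the other over the basis
      elements occurring in \<open>d \<sigma>\<close>; the products vanish off the
      intersection.\<close>
    also have "\<dots> = (\<Sum>\<tau>\<in>{\<tau> \<in> S'. basis_coeff D' S' (d \<sigma>) \<tau> \<noteq> 0}. basis_coeff D' S' (d \<sigma>) \<tau> * h \<tau>)"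
      by (intro sum.mono_neutral_cong) (auto simp: h(2) finite_basis_coeff[OF D'(2) d\<sigma>])
    also have "\<dots> = h (d \<sigma>)"
      using hom_eq_sum_basis_coeff[OF D' d\<sigma> h(1)] by simp
    finally show ?thesis .
  qed
  have "{\<sigma> \<in> S. h (d \<sigma>) \<noteq> 0} \<subseteq> Poly_Mapping.keys ?u"
    by (auto simp: in_keys_iff lookup)
  then show fin': "finite {\<sigma> \<in> S. h (d \<sigma>) \<noteq> 0}"
    using finite_keys finite_subset by blast
  have "?u = frag_on S (\<lambda>\<sigma>. h (d \<sigma>))"
    by (rule poly_mapping_eqI) (use u in \<open>auto simp: lookup_frag_on[OF fin'] lookup not_in_keys_iff_lookup_eq_zero[symmetric]\<close>)
  then have "int_comb N z ?u = pairing N S (\<lambda>\<sigma>. h (d \<sigma>)) z"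
    by (simp add: N.pairing_eq_int_comb z fin')
  moreover have "pairing N S' h (\<lambda>\<tau>\<in>S'. pairing N S (\<lambda>\<sigma>. basis_coeff D' S' (d \<sigma>) \<tau>) z)
      = pairing N S' h (\<lambda>\<tau>. int_comb N z (?r \<tau>))"
    by (rule N.pairing_cong) (auto simp: N.pairing_eq_int_comb z fin intro: N.int_comb_closed[OF z r])
  moreover have "\<dots> = int_comb N z ?u"
    by (subst N.pairing_eq_int_comb[OF h(2)])
      (auto intro: N.int_comb_closed[OF z r] N.int_comb_frag_extend[OF z r keys_h])
  ultimately show "pairing N S' h (\<lambda>\<tau>\<in>S'. pairing N S (\<lambda>\<sigma>. basis_coeff D' S' (d \<sigma>) \<tau>) z)
      = pairing N S (\<lambda>\<sigma>. h (d \<sigma>)) z"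
    by simp
qed


section \<open>Modules over the group ring\<close>

context ZG_module
begin

lemma act_hom: "\<gamma> \<in> carrier \<Gamma> \<Longrightarrow> (\<lambda>x. \<gamma> \<odot>\<^bsub>M\<^esub> x) \<in> hom (add_monoid M) (add_monoid M)"
  by (auto simp: hom_def act_closed act_add)

lemma act_group_hom:
  "\<gamma> \<in> carrier \<Gamma> \<Longrightarrow> group_hom (add_monoid M) (add_monoid M) (\<lambda>x. \<gamma> \<odot>\<^bsub>M\<^esub> x)"
  using act_hom by (simp add: group_hom_def group_hom_axioms_def a_group)

lemma act_zero: "\<gamma> \<in> carrier \<Gamma> \<Longrightarrow> \<gamma> \<odot>\<^bsub>M\<^esub> \<zero>\<^bsub>M\<^esub> = \<zero>\<^bsub>M\<^esub>"
  using group_hom.hom_one[OF act_group_hom] by simp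

lemma act_a_inv:
  "\<gamma> \<in> carrier \<Gamma> \<Longrightarrow> x \<in> carrier M \<Longrightarrow> \<gamma> \<odot>\<^bsub>M\<^esub> (\<ominus>\<^bsub>M\<^esub> x) = \<ominus>\<^bsub>M\<^esub> (\<gamma> \<odot>\<^bsub>M\<^esub> x)"
  using group_hom.hom_inv[OF act_group_hom] by (simp add: a_inv_def)

lemma act_inv_act:
  "\<gamma> \<in> carrier \<Gamma> \<Longrightarrow> x \<in> carrier M \<Longrightarrow> inv\<^bsub>\<Gamma>\<^esub> \<gamma> \<odot>\<^bsub>M\<^esub> (\<gamma> \<odot>\<^bsub>M\<^esub> x) = x"
  using act_mult[of "inv\<^bsub>\<Gamma>\<^esub> \<gamma>" \<gamma> x] by (simp add: act_one)

lemma act_act_inv: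
  "\<gamma> \<in> carrier \<Gamma> \<Longrightarrow> x \<in> carrier M \<Longrightarrow> \<gamma> \<odot>\<^bsub>M\<^esub> (inv\<^bsub>\<Gamma>\<^esub> \<gamma> \<odot>\<^bsub>M\<^esub> x) = x"
  using act_mult[of \<gamma> "inv\<^bsub>\<Gamma>\<^esub> \<gamma>" x] by (simp add: act_one)

lemma act_inj: "\<gamma> \<in> carrier \<Gamma> \<Longrightarrow> inj_on (\<lambda>x. \<gamma> \<odot>\<^bsub>M\<^esub> x) (carrier M)"
  by (rule inj_on_inverseI[where g = "\<lambda>x. inv\<^bsub>\<Gamma>\<^esub> \<gamma> \<odot>\<^bsub>M\<^esub> x"]) (rule act_inv_act)

lemma act_bij_betw:
  assumes "\<gamma> \<in> carrier \<Gamma>" "S \<subseteq> carrier M"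
    and S: "\<And>\<gamma> \<sigma>. \<gamma> \<in> carrier \<Gamma> \<Longrightarrow> \<sigma> \<in> S \<Longrightarrow> \<gamma> \<odot>\<^bsub>M\<^esub> \<sigma> \<in> S"
  shows "bij_betw (\<lambda>\<sigma>. \<gamma> \<odot>\<^bsub>M\<^esub> \<sigma>) S S"
  by (rule bij_betw_byWitness[where f' = "\<lambda>\<sigma>. inv\<^bsub>\<Gamma>\<^esub> \<gamma> \<odot>\<^bsub>M\<^esub> \<sigma>"])
    (use assms in \<open>auto simp: act_inv_act act_act_inv subset_eq\<close>)

end

lemma ZG_hom_closed: "f \<in> ZG_hom \<Gamma> M N \<Longrightarrow> x \<in> carrier M \<Longrightarrow> f x \<in> carrier N"
  by (auto simp: ZG_hom_def hom_def)

lemma ZG_hom_add: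
  "f \<in> ZG_hom \<Gamma> M N \<Longrightarrow> x \<in> carrier M \<Longrightarrow> y \<in> carrier M \<Longrightarrow> f (x \<oplus>\<^bsub>M\<^esub> y) = f x \<oplus>\<^bsub>N\<^esub> f y"
  by (auto simp: ZG_hom_def hom_def)

lemma ZG_hom_act:
  "f \<in> ZG_hom \<Gamma> M N \<Longrightarrow> \<gamma> \<in> carrier \<Gamma> \<Longrightarrow> x \<in> carrier M \<Longrightarrow> f (\<gamma> \<odot>\<^bsub>M\<^esub> x) = \<gamma> \<odot>\<^bsub>N\<^esub> f x"
  by (auto simp: ZG_hom_def)

lemma ZG_hom_hom: "f \<in> ZG_hom \<Gamma> M N \<Longrightarrow> f \<in> hom (add_monoid M) (add_monoid N)"
  by (auto simp: ZG_hom_def)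

lemma ZG_short_exactD:
  assumes "ZG_short_exact \<Gamma> K \<iota> L \<phi> M"
  shows "ZG_module \<Gamma> K" "ZG_module \<Gamma> L" "ZG_module \<Gamma> M" "\<iota> \<in> ZG_hom \<Gamma> K L" "\<phi> \<in> ZG_hom \<Gamma> L M"
    "inj_on \<iota> (carrier K)" "\<phi> ` carrier L = carrier M"
    "\<And>y. y \<in> carrier L \<Longrightarrow> \<phi> y = \<zero>\<^bsub>M\<^esub> \<Longrightarrow> \<exists>x\<in>carrier K. \<iota> x = y"
proof -
  have im: "\<iota> ` carrier K = {x \<in> carrier L. \<phi> x = \<zero>\<^bsub>M\<^esub>}"
    using assms by (simp add: ZG_short_exact_def kernel_def)
  show "\<exists>x\<in>carrier K. \<iota> x = y" if "y \<in> carrier L" "\<phi> y = \<zero>\<^bsub>M\<^esub>" for y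
    using equalityD2[OF im] that by force
qed (use assms in \<open>auto simp: ZG_short_exact_def\<close>)

text \<open>Selecting preimages by \<open>inv_into\<close> yields a function at once, so chains and
  cochains can be factored through \<open>\<iota>\<close> pointwise.\<close>

lemma ZG_short_exact_factor:
  assumes exact: "ZG_short_exact \<Gamma> K \<iota> L \<phi> M" and "y \<in> carrier L" "\<phi> y = \<zero>\<^bsub>M\<^esub>"
  defines "x \<equiv> inv_into (carrier K) \<iota> y"
  shows "x \<in> carrier K" "\<iota> x = y"
proof -
  have "y \<in> \<iota> ` carrier K"
    using ZG_short_exactD(8)[OF exact assms(2,3)] by blast
  then show "x \<in> carrier K" "\<iota> x = y"
    unfolding x_def by (simp_all add: inv_into_into f_inv_into_f)
qed


section \<open>Invariant infinite chains\<close>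

lemma mem_inv_chains_iff:
  "z \<in> carrier (inv_chains \<Gamma> D S N) \<longleftrightarrow> z \<in> S \<rightarrow>\<^sub>E carrier N \<and>
    (\<forall>\<gamma>\<in>carrier \<Gamma>. \<forall>\<sigma>\<in>S. z (\<gamma> \<odot>\<^bsub>D\<^esub> \<sigma>) = \<gamma> \<odot>\<^bsub>N\<^esub> z \<sigma>)"
  by (simp add: inv_chains_def)

lemma mult_inv_chains: "z \<otimes>\<^bsub>inv_chains \<Gamma> D S N\<^esub> w = (\<lambda>\<sigma>\<in>S. z \<sigma> \<oplus>\<^bsub>N\<^esub> w \<sigma>)"
  and one_inv_chains: "\<one>\<^bsub>inv_chains \<Gamma> D S N\<^esub> = (\<lambda>\<sigma>\<in>S. \<zero>\<^bsub>N\<^esub>)"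
  by (simp_all add: inv_chains_def)

lemma inv_chains_PiE: "z \<in> carrier (inv_chains \<Gamma> D S N) \<Longrightarrow> z \<in> S \<rightarrow>\<^sub>E carrier N"
  by (simp add: mem_inv_chains_iff)

lemma inv_chains_value: "z \<in> carrier (inv_chains \<Gamma> D S N) \<Longrightarrow> \<sigma> \<in> S \<Longrightarrow> z \<sigma> \<in> carrier N"
  by (auto simp: mem_inv_chains_iff)

lemma inv_chains_funcset: "z \<in> carrier (inv_chains \<Gamma> D S N) \<Longrightarrow> z \<in> S \<rightarrow> carrier N"
  by (auto simp: mem_inv_chains_iff)

lemma inv_chains_act:
  "z \<in> carrier (inv_chains \<Gamma> D S N) \<Longrightarrow> \<gamma> \<in> carrier \<Gamma> \<Longrightarrow> \<sigma> \<in> S \<Longrightarrow> z (\<gamma> \<odot>\<^bsub>D\<^esub> \<sigma>) = \<gamma> \<odot>\<^bsub>N\<^esub> z \<sigma>"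
  by (simp add: mem_inv_chains_iff)

lemma inv_chains_undefined: "z \<in> carrier (inv_chains \<Gamma> D S N) \<Longrightarrow> \<sigma> \<notin> S \<Longrightarrow> z \<sigma> = undefined"
  by (auto simp: mem_inv_chains_iff intro: PiE_arb)

lemma comm_group_inv_chains:
  assumes "ZG_module \<Gamma> N"
    and S: "\<And>\<gamma> \<sigma>. \<gamma> \<in> carrier \<Gamma> \<Longrightarrow> \<sigma> \<in> S \<Longrightarrow> \<gamma> \<odot>\<^bsub>D\<^esub> \<sigma> \<in> S"
  shows "comm_group (inv_chains \<Gamma> D S N)"
proof -
  interpret N: ZG_module \<Gamma> N by fact
  let ?G = "inv_chains \<Gamma> D S N"
  note [simp] = mult_inv_chains one_inv_chains S
  show ?thesis
  proof (rule comm_groupI)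
    fix z w assume z: "z \<in> carrier ?G" and w: "w \<in> carrier ?G"
    note [simp] = inv_chains_value[OF z] inv_chains_value[OF w] inv_chains_act[OF z] inv_chains_act[OF w]
    show "z \<otimes>\<^bsub>?G\<^esub> w \<in> carrier ?G"
      by (simp add: mem_inv_chains_iff N.act_add)
    show "z \<otimes>\<^bsub>?G\<^esub> w = w \<otimes>\<^bsub>?G\<^esub> z"
      by (auto simp: fun_eq_iff restrict_def N.a_comm)
    fix v assume v: "v \<in> carrier ?G"
    show "z \<otimes>\<^bsub>?G\<^esub> w \<otimes>\<^bsub>?G\<^esub> v = z \<otimes>\<^bsub>?G\<^esub> (w \<otimes>\<^bsub>?G\<^esub> v)"
      using inv_chains_value[OF v] by (auto simp: fun_eq_iff restrict_def N.a_assoc)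
  next
    show "\<one>\<^bsub>?G\<^esub> \<in> carrier ?G"
      by (auto simp: mem_inv_chains_iff N.act_zero)
  next
    fix z assume z: "z \<in> carrier ?G"
    note [simp] = inv_chains_value[OF z] inv_chains_act[OF z]
    show "\<one>\<^bsub>?G\<^esub> \<otimes>\<^bsub>?G\<^esub> z = z"
      by (rule ext) (simp add: restrict_def inv_chains_undefined[OF z])
    have "(\<lambda>\<sigma>\<in>S. \<ominus>\<^bsub>N\<^esub> z \<sigma>) \<in> carrier ?G"
      by (simp add: mem_inv_chains_iff N.act_a_inv)
    moreover have "(\<lambda>\<sigma>\<in>S. \<ominus>\<^bsub>N\<^esub> z \<sigma>) \<otimes>\<^bsub>?G\<^esub> z = \<one>\<^bsub>?G\<^esub>"
      by (auto simp: fun_eq_iff restrict_def N.l_neg)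
    ultimately show "\<exists>w\<in>carrier ?G. w \<otimes>\<^bsub>?G\<^esub> z = \<one>\<^bsub>?G\<^esub>"
      by blast
  qed
qed

lemma inv_boundary_eq_pairing:
  "inv_boundary D S d N m z = (\<lambda>\<tau>\<in>S (m - 1). pairing N (S m)
    (\<lambda>\<sigma>. basis_coeff (D (m - 1)) (S (m - 1)) (d m \<sigma>) \<tau>) z)"
  by (simp add: inv_boundary_def pairing_def incidence_def)

section \<open>The boundary operator on invariant infinite chains\<close>

locale based_complex =
  fixes \<Gamma> :: "('g, 'x) monoid_scheme" and D :: "int \<Rightarrow> ('g, 'd, 'z) module_scheme"
    and S :: "int \<Rightarrow> 'd set" and d :: "int \<Rightarrow> 'd \<Rightarrow> 'd"
  assumes complex: "free_chain_complex \<Gamma> D d"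
    and basis: "\<And>m. freely_permuted_basis \<Gamma> (D m) (S m)"
    and locally_finite: "\<And>m \<tau>. \<tau> \<in> S (m - 1) \<Longrightarrow> finite {\<sigma> \<in> S m. incidence D S d m \<sigma> \<tau> \<noteq> 0}"
begin

lemma ZG_module_D: "ZG_module \<Gamma> (D m)"
  using complex by (simp add: free_chain_complex_def ZG_free_def)

lemma abelian_group_D: "abelian_group (D m)"
  using ZG_module_D by (simp add: ZG_module_def)

lemma Z_basis_S: "Z_basis (D m) (S m)"
  using basis by (simp add: freely_permuted_basis_def)

lemma S_carrier: "\<sigma> \<in> S m \<Longrightarrow> \<sigma> \<in> carrier (D m)"
  using Z_basis_S by (auto simp: Z_basis_def)

lemma act_S: "\<gamma> \<in> carrier \<Gamma> \<Longrightarrow> \<sigma> \<in> S m \<Longrightarrow> \<gamma> \<odot>\<^bsub>D m\<^esub> \<sigma> \<in> S m"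
  using basis by (simp add: freely_permuted_basis_def)

lemma d_ZG_hom: "d m \<in> ZG_hom \<Gamma> (D m) (D (m - 1))"
  using complex by (simp add: free_chain_complex_def)

lemma d_d: "x \<in> carrier (D m) \<Longrightarrow> d (m - 1) (d m x) = \<zero>\<^bsub>D (m - 2)\<^esub>"
  using complex by (simp add: free_chain_complex_def)

lemma comm_group_chains: "ZG_module \<Gamma> N \<Longrightarrow> comm_group (inv_chains \<Gamma> (D m) (S m) N)"
  using comm_group_inv_chains act_S by blast

lemma group_chains: "ZG_module \<Gamma> N \<Longrightarrow> group (inv_chains \<Gamma> (D m) (S m) N)"
  using comm_group_chains by (blast intro: comm_group.axioms)

lemma finite_incidence:
  "\<tau> \<in> S (m - 1) \<Longrightarrow> finite {\<sigma> \<in> S m. basis_coeff (D (m - 1)) (S (m - 1)) (d m \<sigma>) \<tau> \<noteq> 0}"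
  using locally_finite by (simp add: incidence_def)

text \<open>Substitute the translate of \<open>\<sigma>\<close> by \<open>\<gamma>\<close> for
  \<open>\<sigma>\<close> in the sum. With \<open>h'\<close> the translate of \<open>h\<close>, one
  argument covers the invariance of boundaries and the equivariance of slant products.\<close>

lemma pairing_act:
  assumes N: "ZG_module \<Gamma> N" and \<gamma>: "\<gamma> \<in> carrier \<Gamma>" and z: "z \<in> carrier (inv_chains \<Gamma> (D m) (S m) N)"
    and h: "finite {\<sigma> \<in> S m. h \<sigma> \<noteq> 0}"
    and eq: "\<And>\<sigma>. \<sigma> \<in> S m \<Longrightarrow> h' (\<gamma> \<odot>\<^bsub>D m\<^esub> \<sigma>) = h \<sigma>"
  shows "pairing N (S m) h' z = \<gamma> \<odot>\<^bsub>N\<^esub> pairing N (S m) h z"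
proof -
  interpret N: ZG_module \<Gamma> N by fact
  interpret D: ZG_module \<Gamma> "D m" by (rule ZG_module_D)
  note z' = inv_chains_funcset[OF z]
  have bij: "bij_betw (\<lambda>\<sigma>. \<gamma> \<odot>\<^bsub>D m\<^esub> \<sigma>) (S m) (S m)"
    by (rule D.act_bij_betw[OF \<gamma>]) (auto simp: S_carrier act_S)
  have "pairing N (S m) h' z = pairing N (S m) h (\<lambda>\<sigma>. z (\<gamma> \<odot>\<^bsub>D m\<^esub> \<sigma>))"
    by (rule N.pairing_reindex[OF z' bij]) (rule eq)
  also have "\<dots> = pairing N (S m) h (\<lambda>\<sigma>. \<gamma> \<odot>\<^bsub>N\<^esub> z \<sigma>)"
    by (rule N.pairing_cong) (auto simp: inv_chains_act[OF z \<gamma>] N.act_closed[OF \<gamma>] inv_chains_value[OF z])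
  also have "\<dots> = \<gamma> \<odot>\<^bsub>N\<^esub> pairing N (S m) h z"
    using hom_pairing[OF N.abelian_group_axioms N.abelian_group_axioms N.act_hom[OF \<gamma>] z' h] by simp
  finally show ?thesis .
qed

lemma boundary_closed:
  assumes N: "ZG_module \<Gamma> N" and z: "z \<in> carrier (inv_chains \<Gamma> (D m) (S m) N)"
  shows "inv_boundary D S d N m z \<in> carrier (inv_chains \<Gamma> (D (m - 1)) (S (m - 1)) N)"
  unfolding mem_inv_chains_iff
proof (intro conjI ballI)
  interpret N: ZG_module \<Gamma> N by fact
  interpret D: ZG_module \<Gamma> "D m" by (rule ZG_module_D)
  interpret D': ZG_module \<Gamma> "D (m - 1)" by (rule ZG_module_D)
  show "inv_boundary D S d N m z \<in> S (m - 1) \<rightarrow>\<^sub>E carrier N"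
    by (auto simp: inv_boundary_eq_pairing N.pairing_closed inv_chains_funcset[OF z])
  fix \<gamma> \<tau> assume \<gamma>: "\<gamma> \<in> carrier \<Gamma>" and \<tau>: "\<tau> \<in> S (m - 1)"
  \<comment> \<open>Incidence numbers are invariant under the simultaneous action on both arguments,
    since \<open>d\<close> is equivariant and \<open>\<gamma>\<close> permutes the basis.\<close>
  have inc: "basis_coeff (D (m - 1)) (S (m - 1)) (d m (\<gamma> \<odot>\<^bsub>D m\<^esub> \<sigma>)) (\<gamma> \<odot>\<^bsub>D (m - 1)\<^esub> \<tau>)
      = basis_coeff (D (m - 1)) (S (m - 1)) (d m \<sigma>) \<tau>" if \<sigma>: "\<sigma> \<in> S m" for \<sigma>
  proof -
    have "inj_on (\<lambda>x. \<gamma> \<odot>\<^bsub>D (m - 1)\<^esub> x) (S (m - 1))"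
      by (rule inj_on_subset[OF D'.act_inj[OF \<gamma>]]) (auto simp: S_carrier)
    moreover have "(\<lambda>x. \<gamma> \<odot>\<^bsub>D (m - 1)\<^esub> x) ` S (m - 1) \<subseteq> S (m - 1)"
      using act_S[OF \<gamma>] by auto
    ultimately show ?thesis
      using basis_coeff_automorphism[OF D'.abelian_group_axioms Z_basis_S D'.act_hom[OF \<gamma>] _ _ _ \<tau>]
        S_carrier[OF \<sigma>] by (simp add: ZG_hom_act[OF d_ZG_hom \<gamma>] ZG_hom_closed[OF d_ZG_hom])
  qed
  show "inv_boundary D S d N m z (\<gamma> \<odot>\<^bsub>D (m - 1)\<^esub> \<tau>) = \<gamma> \<odot>\<^bsub>N\<^esub> inv_boundary D S d N m z \<tau>"
    using pairing_act[OF N \<gamma> z finite_incidence[OF \<tau>] inc] \<tau> act_S[OF \<gamma>]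
    by (simp add: inv_boundary_eq_pairing)
qed

lemma boundary_hom:
  assumes N: "ZG_module \<Gamma> N"
  shows "inv_boundary D S d N m
    \<in> hom (inv_chains \<Gamma> (D m) (S m) N) (inv_chains \<Gamma> (D (m - 1)) (S (m - 1)) N)"
proof (rule homI)
  interpret N: ZG_module \<Gamma> N by fact
  fix z w assume "z \<in> carrier (inv_chains \<Gamma> (D m) (S m) N)" "w \<in> carrier (inv_chains \<Gamma> (D m) (S m) N)"
  note zw = this[THEN inv_chains_funcset]
  show "inv_boundary D S d N m (z \<otimes>\<^bsub>inv_chains \<Gamma> (D m) (S m) N\<^esub> w)
      = inv_boundary D S d N m z \<otimes>\<^bsub>inv_chains \<Gamma> (D (m - 1)) (S (m - 1)) N\<^esub> inv_boundary D S d N m w"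
    by (auto simp: inv_boundary_eq_pairing mult_inv_chains fun_eq_iff restrict_def
        N.pairing_add_right[OF zw finite_incidence, unfolded restrict_def])
qed (rule boundary_closed[OF N])

lemma pairing_boundary:
  assumes N: "ZG_module \<Gamma> N" and z: "z \<in> carrier (inv_chains \<Gamma> (D m) (S m) N)"
    and h: "h \<in> hom (add_monoid (D (m - 1))) integer_group" "finite {\<tau> \<in> S (m - 1). h \<tau> \<noteq> 0}"
  shows "pairing N (S (m - 1)) h (inv_boundary D S d N m z) = pairing N (S m) (\<lambda>\<sigma>. h (d m \<sigma>)) z"
    and "finite {\<sigma> \<in> S m. h (d m \<sigma>) \<noteq> 0}"
  using pairing_transpose[OF abelian_group_D Z_basis_S abelian_group_D Z_basis_S
      ZG_hom_hom[OF d_ZG_hom] finite_incidence _ inv_chains_funcset[OF z] h] N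
  by (simp_all add: inv_boundary_eq_pairing ZG_module_def)

text \<open>Each coefficient is a pairing with the functional that takes a coordinate after one more
  \<open>d\<close>. Transposing this functional leaves \<open>d\<close> applied twice to basis
  elements, and the pairing becomes an empty sum.\<close>

lemma boundary_boundary:
  assumes N: "ZG_module \<Gamma> N" and z: "z \<in> carrier (inv_chains \<Gamma> (D m) (S m) N)"
  shows "inv_boundary D S d N (m - 1) (inv_boundary D S d N m z)
    = \<one>\<^bsub>inv_chains \<Gamma> (D (m - 1 - 1)) (S (m - 1 - 1)) N\<^esub>"
proof -
  interpret N: ZG_module \<Gamma> N by fact
  let ?c = "\<lambda>\<tau> x. basis_coeff (D (m - 1 - 1)) (S (m - 1 - 1)) x \<tau>"
  have c: "?c \<tau> \<in> hom (add_monoid (D (m - 1 - 1))) integer_group" for \<tau>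
    by (rule basis_coeff_hom[OF abelian_group_D Z_basis_S])
  have c0: "?c \<tau> \<zero>\<^bsub>D (m - 2)\<^esub> = 0" for \<tau>
    using hom_one[OF c[of \<tau>] abelian_group.a_group[OF abelian_group_D] group_integer_group] by simp
  have "pairing N (S (m - 1)) (\<lambda>\<sigma>. ?c \<tau> (d (m - 1) \<sigma>)) (inv_boundary D S d N m z) = \<zero>\<^bsub>N\<^esub>"
    if \<tau>: "\<tau> \<in> S (m - 1 - 1)" for \<tau>
  proof -
    have "(\<lambda>\<sigma>. ?c \<tau> (d (m - 1) \<sigma>)) \<in> hom (add_monoid (D (m - 1))) integer_group"
      using hom_compose[OF ZG_hom_hom[OF d_ZG_hom] c] by (simp add: comp_def)
    then have "pairing N (S (m - 1)) (\<lambda>\<sigma>. ?c \<tau> (d (m - 1) \<sigma>)) (inv_boundary D S d N m z)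
        = pairing N (S m) (\<lambda>\<sigma>. ?c \<tau> (d (m - 1) (d m \<sigma>))) z"
      by (rule pairing_boundary(1)[OF N z _ finite_incidence[OF \<tau>]])
    also have "\<dots> = \<zero>\<^bsub>N\<^esub>"
    proof -
      have "{\<sigma> \<in> S m. ?c \<tau> (d (m - 1) (d m \<sigma>)) \<noteq> 0} = {}"
        using c0 by (auto simp: d_d S_carrier)
      then show ?thesis by (simp only: pairing_def N.finsum_empty)
    qed
    finally show ?thesis .
  qed
  then show ?thesis
    unfolding inv_boundary_eq_pairing[of _ _ _ _ "m - 1"] one_inv_chains
    by (simp add: fun_eq_iff restrict_def)
qed

section \<open>Change of coefficients on invariant chains and its exactness\<close>

lemma compose_hom_inv_chains:
  assumes N: "ZG_module \<Gamma> N" and f: "f \<in> ZG_hom \<Gamma> N N'"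
  shows "compose (S m) f \<in> hom (inv_chains \<Gamma> (D m) (S m) N) (inv_chains \<Gamma> (D m) (S m) N')"
proof (rule homI)
  fix z assume z: "z \<in> carrier (inv_chains \<Gamma> (D m) (S m) N)"
  note [simp] = inv_chains_value[OF z] inv_chains_act[OF z] ZG_hom_closed[OF f] ZG_hom_act[OF f] act_S
  show "compose (S m) f z \<in> carrier (inv_chains \<Gamma> (D m) (S m) N')"
    by (simp add: mem_inv_chains_iff compose_def)
  fix w assume w: "w \<in> carrier (inv_chains \<Gamma> (D m) (S m) N)"
  show "compose (S m) f (z \<otimes>\<^bsub>inv_chains \<Gamma> (D m) (S m) N\<^esub> w)
      = compose (S m) f z \<otimes>\<^bsub>inv_chains \<Gamma> (D m) (S m) N'\<^esub> compose (S m) f w"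
    by (auto simp: mult_inv_chains compose_def fun_eq_iff ZG_hom_add[OF f] inv_chains_value[OF w])
qed

lemma pairing_compose:
  assumes N: "ZG_module \<Gamma> N" and N': "ZG_module \<Gamma> N'" and f: "f \<in> ZG_hom \<Gamma> N N'"
    and z: "z \<in> carrier (inv_chains \<Gamma> (D m) (S m) N)" and h: "finite {\<sigma> \<in> S m. h \<sigma> \<noteq> 0}"
  shows "pairing N' (S m) h (compose (S m) f z) = f (pairing N (S m) h z)"
proof -
  interpret N: ZG_module \<Gamma> N by fact
  interpret N': ZG_module \<Gamma> N' by fact
  show ?thesis
    unfolding hom_pairing[OF N.abelian_group_axioms N'.abelian_group_axioms ZG_hom_hom[OF f]
        inv_chains_funcset[OF z] h]
    by (rule N'.pairing_cong) (auto simp: compose_def intro: ZG_hom_closed[OF f] inv_chains_value[OF z])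
qed

lemma boundary_natural:
  assumes N: "ZG_module \<Gamma> N" and N': "ZG_module \<Gamma> N'" and f: "f \<in> ZG_hom \<Gamma> N N'"
    and z: "z \<in> carrier (inv_chains \<Gamma> (D m) (S m) N)"
  shows "inv_boundary D S d N' m (compose (S m) f z) = compose (S (m - 1)) f (inv_boundary D S d N m z)"
  using pairing_compose[OF assms]
  by (auto simp: inv_boundary_eq_pairing fun_eq_iff compose_def[of "S (m - 1)"] finite_incidence)

lemma compose_inj_inv_chains:
  assumes "inj_on \<iota> (carrier N)"
  shows "inj_on (compose (S m) \<iota>) (carrier (inv_chains \<Gamma> (D m) (S m) N))"
proof (rule inj_onI)
  fix z w
  assume z: "z \<in> carrier (inv_chains \<Gamma> (D m) (S m) N)" and w: "w \<in> carrier (inv_chains \<Gamma> (D m) (S m) N)"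
    and eq: "compose (S m) \<iota> z = compose (S m) \<iota> w"
  show "z = w"
  proof (rule PiE_ext[OF inv_chains_PiE[OF z] inv_chains_PiE[OF w]])
    fix \<sigma> assume \<sigma>: "\<sigma> \<in> S m"
    have "\<iota> (z \<sigma>) = \<iota> (w \<sigma>)"
      using fun_cong[OF eq, of \<sigma>] \<sigma> by (simp add: compose_def)
    then show "z \<sigma> = w \<sigma>"
      using assms inv_chains_value[OF z \<sigma>] inv_chains_value[OF w \<sigma>] by (simp add: inj_on_def)
  qed
qed

text \<open>Values killed by \<open>\<phi>\<close> have unique preimages under
  \<open>\<iota>\<close>, and uniqueness makes the family of preimages invariant.\<close>

lemma compose_exact_inv_chains:
  assumes exact: "ZG_short_exact \<Gamma> K \<iota> L \<phi> M"
  shows "kernel (inv_chains \<Gamma> (D m) (S m) L) (inv_chains \<Gamma> (D m) (S m) M) (compose (S m) \<phi>)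
    \<subseteq> compose (S m) \<iota> ` carrier (inv_chains \<Gamma> (D m) (S m) K)"
proof
  note ex = ZG_short_exactD[OF exact]
  interpret K: ZG_module \<Gamma> K by (rule ex)
  fix y assume "y \<in> kernel (inv_chains \<Gamma> (D m) (S m) L) (inv_chains \<Gamma> (D m) (S m) M) (compose (S m) \<phi>)"
  then have y: "y \<in> carrier (inv_chains \<Gamma> (D m) (S m) L)" and \<phi>y: "compose (S m) \<phi> y = (\<lambda>\<sigma>\<in>S m. \<zero>\<^bsub>M\<^esub>)"
    by (auto simp: kernel_def one_inv_chains)
  have \<phi>y: "\<phi> (y \<sigma>) = \<zero>\<^bsub>M\<^esub>" if "\<sigma> \<in> S m" for \<sigma>
    using that fun_cong[OF \<phi>y, of \<sigma>] by (simp add: compose_def)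
  define x where "x = (\<lambda>\<sigma>\<in>S m. inv_into (carrier K) \<iota> (y \<sigma>))"
  have x: "x \<sigma> \<in> carrier K" "\<iota> (x \<sigma>) = y \<sigma>" if "\<sigma> \<in> S m" for \<sigma>
    using ZG_short_exact_factor[OF exact inv_chains_value[OF y that] \<phi>y[OF that]] that by (simp_all add: x_def)
  have "x (\<gamma> \<odot>\<^bsub>D m\<^esub> \<sigma>) = \<gamma> \<odot>\<^bsub>K\<^esub> x \<sigma>" if \<gamma>: "\<gamma> \<in> carrier \<Gamma>" and \<sigma>: "\<sigma> \<in> S m" for \<gamma> \<sigma>
    using ex(6) \<gamma> \<sigma> x act_S[OF \<gamma> \<sigma>] inv_chains_act[OF y \<gamma> \<sigma>] ZG_hom_act[OF ex(4) \<gamma>] K.act_closed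
    by (auto simp: inj_on_def)
  then have "x \<in> carrier (inv_chains \<Gamma> (D m) (S m) K)"
    using x(1) by (auto simp: mem_inv_chains_iff x_def)
  moreover have "compose (S m) \<iota> x = y"
    by (rule ext) (simp add: compose_def x(2) inv_chains_undefined[OF y])
  ultimately show "y \<in> compose (S m) \<iota> ` carrier (inv_chains \<Gamma> (D m) (S m) K)"
    by blast
qed

text \<open>Trivial stabilisers in torsor form: an element of an orbit determines the group element
  that carries a chosen base point to it.\<close>

lemma act_S_free:
  assumes "\<gamma> \<in> carrier \<Gamma>" "\<gamma>' \<in> carrier \<Gamma>" "\<sigma> \<in> S m" "\<gamma> \<odot>\<^bsub>D m\<^esub> \<sigma> = \<gamma>' \<odot>\<^bsub>D m\<^esub> \<sigma>"
  shows "\<gamma> = \<gamma>'"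
proof -
  interpret D: ZG_module \<Gamma> "D m" by (rule ZG_module_D)
  have "(inv\<^bsub>\<Gamma>\<^esub> \<gamma>' \<otimes>\<^bsub>\<Gamma>\<^esub> \<gamma>) \<odot>\<^bsub>D m\<^esub> \<sigma> = \<sigma>"
    using assms S_carrier by (simp add: D.act_mult D.act_inv_act)
  then have "inv\<^bsub>\<Gamma>\<^esub> \<gamma>' \<otimes>\<^bsub>\<Gamma>\<^esub> \<gamma> = \<one>\<^bsub>\<Gamma>\<^esub>"
    using basis assms by (auto simp: freely_permuted_basis_def)
  then show ?thesis
    using assms D.m_assoc[of \<gamma>' "inv\<^bsub>\<Gamma>\<^esub> \<gamma>'" \<gamma>] by simp
qed

text \<open>An equivariant lift is determined by arbitrary lifts of the values at orbit representatives.\<close>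

lemma compose_surj_inv_chains:
  assumes L: "ZG_module \<Gamma> L" and M: "ZG_module \<Gamma> M" and \<phi>: "\<phi> \<in> ZG_hom \<Gamma> L M"
    and surj: "\<phi> ` carrier L = carrier M"
  shows "carrier (inv_chains \<Gamma> (D m) (S m) M)
    \<subseteq> compose (S m) \<phi> ` carrier (inv_chains \<Gamma> (D m) (S m) L)"
proof
  interpret L: ZG_module \<Gamma> L by fact
  interpret D: ZG_module \<Gamma> "D m" by (rule ZG_module_D)
  fix z assume z: "z \<in> carrier (inv_chains \<Gamma> (D m) (S m) M)"
  define orb where "orb \<sigma> = (\<lambda>\<gamma>. \<gamma> \<odot>\<^bsub>D m\<^esub> \<sigma>) ` carrier \<Gamma>" for \<sigma>
  \<comment> \<open>The choice depends on the orbit as a set, so all elements of one orbit receive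
    the same representative; \<open>rep_act\<close> relies on this.\<close>
  define rep where "rep \<sigma> = (SOME \<rho>. \<rho> \<in> orb \<sigma>)" for \<sigma>
  have orb_act: "orb (\<gamma> \<odot>\<^bsub>D m\<^esub> \<sigma>) = orb \<sigma>" if \<gamma>: "\<gamma> \<in> carrier \<Gamma>" and \<sigma>: "\<sigma> \<in> S m" for \<gamma> \<sigma>
  proof -
    have sub: "orb (\<gamma> \<odot>\<^bsub>D m\<^esub> \<sigma>) \<subseteq> orb \<sigma>" if "\<gamma> \<in> carrier \<Gamma>" "\<sigma> \<in> S m" for \<gamma> \<sigma>
      using that S_carrier D.act_mult[symmetric, of _ \<gamma> \<sigma>] by (auto simp: orb_def)
    then show ?thesis
      using sub[OF \<gamma> \<sigma>] sub[of "inv\<^bsub>\<Gamma>\<^esub> \<gamma>" "\<gamma> \<odot>\<^bsub>D m\<^esub> \<sigma>"] \<gamma> \<sigma> act_S S_carrier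
      by (auto simp: D.act_inv_act)
  qed
  have rep: "rep \<sigma> \<in> orb \<sigma>" for \<sigma>
    unfolding rep_def by (rule someI_ex) (auto simp: orb_def)
  have rep_S: "rep \<sigma> \<in> S m" if "\<sigma> \<in> S m" for \<sigma>
    using rep[of \<sigma>] act_S that by (auto simp: orb_def)
  have "\<exists>\<gamma>\<in>carrier \<Gamma>. \<gamma> \<odot>\<^bsub>D m\<^esub> rep \<sigma> = \<sigma>" if \<sigma>: "\<sigma> \<in> S m" for \<sigma>
  proof -
    obtain \<gamma> where "\<gamma> \<in> carrier \<Gamma>" "rep \<sigma> = \<gamma> \<odot>\<^bsub>D m\<^esub> \<sigma>"
      using rep[of \<sigma>] by (auto simp: orb_def)
    then show ?thesis
      using \<sigma> S_carrier by (intro bexI[of _ "inv\<^bsub>\<Gamma>\<^esub> \<gamma>"]) (simp_all add: D.act_inv_act)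
  qed
  then obtain g where g: "\<And>\<sigma>. \<sigma> \<in> S m \<Longrightarrow> g \<sigma> \<in> carrier \<Gamma>"
    "\<And>\<sigma>. \<sigma> \<in> S m \<Longrightarrow> g \<sigma> \<odot>\<^bsub>D m\<^esub> rep \<sigma> = \<sigma>"
    by metis
  have rep_act: "rep (\<gamma> \<odot>\<^bsub>D m\<^esub> \<sigma>) = rep \<sigma>" if "\<gamma> \<in> carrier \<Gamma>" "\<sigma> \<in> S m" for \<gamma> \<sigma>
    using orb_act[OF that] by (simp add: rep_def)
  \<comment> \<open>Both group elements carry \<open>rep \<sigma>\<close> to the translate of
    \<open>\<sigma>\<close>, so freeness forces them to agree. With nontrivial stabilisers the lift
    \<open>y\<close> below could fail to be invariant.\<close>
  have g_act: "g (\<gamma> \<odot>\<^bsub>D m\<^esub> \<sigma>) = \<gamma> \<otimes>\<^bsub>\<Gamma>\<^esub> g \<sigma>" if \<gamma>: "\<gamma> \<in> carrier \<Gamma>" and \<sigma>: "\<sigma> \<in> S m" for \<gamma> \<sigma>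
    by (rule act_S_free[OF _ _ rep_S[OF \<sigma>]])
      (use g[OF act_S[OF \<gamma> \<sigma>]] g[OF \<sigma>] rep_act[OF \<gamma> \<sigma>] \<gamma> S_carrier[OF rep_S[OF \<sigma>]] in
        \<open>simp_all add: D.act_mult\<close>)
  define l where "l = inv_into (carrier L) \<phi>"
  have l: "l x \<in> carrier L" "\<phi> (l x) = x" if "x \<in> carrier M" for x
    using that surj unfolding l_def by (auto simp: inv_into_into f_inv_into_f)
  define y where "y = (\<lambda>\<sigma>\<in>S m. g \<sigma> \<odot>\<^bsub>L\<^esub> l (z (rep \<sigma>)))"
  have lz: "l (z (rep \<sigma>)) \<in> carrier L" "\<phi> (l (z (rep \<sigma>))) = z (rep \<sigma>)" if "\<sigma> \<in> S m" for \<sigma>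
    using l inv_chains_value[OF z rep_S[OF that]] by auto
  have "y \<in> carrier (inv_chains \<Gamma> (D m) (S m) L)"
    by (auto simp: mem_inv_chains_iff y_def act_S rep_act g_act g(1) lz(1) L.act_closed L.act_mult)
  moreover have "compose (S m) \<phi> y = z"
  proof (rule ext)
    fix \<sigma>
    show "compose (S m) \<phi> y \<sigma> = z \<sigma>"
    proof (cases "\<sigma> \<in> S m")
      case True
      then have "\<phi> (y \<sigma>) = z (g \<sigma> \<odot>\<^bsub>D m\<^esub> rep \<sigma>)"
        by (simp add: y_def ZG_hom_act[OF \<phi>] g(1) lz inv_chains_act[OF z _ rep_S])
      then show ?thesis
        using True by (simp add: compose_def g(2))
    qed (simp add: compose_def inv_chains_undefined[OF z])
  qed
  ultimately show "z \<in> compose (S m) \<phi> ` carrier (inv_chains \<Gamma> (D m) (S m) L)"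
    by blast
qed

end


section \<open>Equivariant cochains\<close>

lemma mem_Hom_G_iff:
  "f \<in> carrier (Hom_G \<Gamma> P N) \<longleftrightarrow> f \<in> ZG_hom \<Gamma> P N \<and> f \<in> extensional (carrier P)"
  by (simp add: Hom_G_def)

lemma mult_Hom_G: "f \<otimes>\<^bsub>Hom_G \<Gamma> P N\<^esub> g = (\<lambda>x\<in>carrier P. f x \<oplus>\<^bsub>N\<^esub> g x)"
  and one_Hom_G: "\<one>\<^bsub>Hom_G \<Gamma> P N\<^esub> = (\<lambda>x\<in>carrier P. \<zero>\<^bsub>N\<^esub>)"
  by (simp_all add: Hom_G_def hom_group_def)

lemma Hom_G_ZG_hom: "f \<in> carrier (Hom_G \<Gamma> P N) \<Longrightarrow> f \<in> ZG_hom \<Gamma> P N"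
  by (simp add: mem_Hom_G_iff)

lemma Hom_G_undefined: "f \<in> carrier (Hom_G \<Gamma> P N) \<Longrightarrow> x \<notin> carrier P \<Longrightarrow> f x = undefined"
  by (auto simp: mem_Hom_G_iff extensional_def)

lemma ZG_homI:
  assumes "\<And>x. x \<in> carrier P \<Longrightarrow> f x \<in> carrier N"
    and "\<And>x y. x \<in> carrier P \<Longrightarrow> y \<in> carrier P \<Longrightarrow> f (x \<oplus>\<^bsub>P\<^esub> y) = f x \<oplus>\<^bsub>N\<^esub> f y"
    and "\<And>\<gamma> x. \<gamma> \<in> carrier \<Gamma> \<Longrightarrow> x \<in> carrier P \<Longrightarrow> f (\<gamma> \<odot>\<^bsub>P\<^esub> x) = \<gamma> \<odot>\<^bsub>N\<^esub> f x"
  shows "f \<in> ZG_hom \<Gamma> P N"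
  using assms by (simp add: ZG_hom_def hom_def)

lemma comm_group_Hom_G:
  assumes "ZG_module \<Gamma> P" "ZG_module \<Gamma> N"
  shows "comm_group (Hom_G \<Gamma> P N)"
proof -
  interpret P: ZG_module \<Gamma> P by fact
  interpret N: ZG_module \<Gamma> N by fact
  let ?G = "Hom_G \<Gamma> P N"
  note [simp] = mult_Hom_G one_Hom_G P.act_closed
  show ?thesis
  proof (rule comm_groupI)
    fix f g assume f: "f \<in> carrier ?G" and g: "g \<in> carrier ?G"
    note fg [simp] = ZG_hom_closed[OF Hom_G_ZG_hom[OF f]] ZG_hom_closed[OF Hom_G_ZG_hom[OF g]]
      ZG_hom_act[OF Hom_G_ZG_hom[OF f]] ZG_hom_act[OF Hom_G_ZG_hom[OF g]]
      ZG_hom_add[OF Hom_G_ZG_hom[OF f]] ZG_hom_add[OF Hom_G_ZG_hom[OF g]]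
    have "(\<lambda>x\<in>carrier P. f x \<oplus>\<^bsub>N\<^esub> g x) \<in> ZG_hom \<Gamma> P N"
      by (rule ZG_homI) (simp_all add: N.act_add N.a_ac)
    then show "f \<otimes>\<^bsub>?G\<^esub> g \<in> carrier ?G"
      by (simp add: mem_Hom_G_iff)
    show "f \<otimes>\<^bsub>?G\<^esub> g = g \<otimes>\<^bsub>?G\<^esub> f"
      by (auto simp: fun_eq_iff restrict_def N.a_comm)
    fix h assume h: "h \<in> carrier ?G"
    show "f \<otimes>\<^bsub>?G\<^esub> g \<otimes>\<^bsub>?G\<^esub> h = f \<otimes>\<^bsub>?G\<^esub> (g \<otimes>\<^bsub>?G\<^esub> h)"
      using ZG_hom_closed[OF Hom_G_ZG_hom[OF h]] by (auto simp: fun_eq_iff restrict_def N.a_assoc)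
  next
    have "(\<lambda>x\<in>carrier P. \<zero>\<^bsub>N\<^esub>) \<in> ZG_hom \<Gamma> P N"
      by (rule ZG_homI) (simp_all add: N.act_zero)
    then show "\<one>\<^bsub>?G\<^esub> \<in> carrier ?G"
      by (simp add: mem_Hom_G_iff)
  next
    fix f assume f: "f \<in> carrier ?G"
    note f' [simp] = ZG_hom_closed[OF Hom_G_ZG_hom[OF f]]
      ZG_hom_act[OF Hom_G_ZG_hom[OF f]] ZG_hom_add[OF Hom_G_ZG_hom[OF f]]
    show "\<one>\<^bsub>?G\<^esub> \<otimes>\<^bsub>?G\<^esub> f = f"
      by (rule ext) (simp add: restrict_def Hom_G_undefined[OF f])
    have "(\<lambda>x\<in>carrier P. \<ominus>\<^bsub>N\<^esub> f x) \<in> ZG_hom \<Gamma> P N"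
      by (rule ZG_homI) (simp_all add: N.act_a_inv N.minus_add N.a_comm)
    then have "(\<lambda>x\<in>carrier P. \<ominus>\<^bsub>N\<^esub> f x) \<in> carrier ?G"
      by (simp add: mem_Hom_G_iff)
    moreover have "(\<lambda>x\<in>carrier P. \<ominus>\<^bsub>N\<^esub> f x) \<otimes>\<^bsub>?G\<^esub> f = \<one>\<^bsub>?G\<^esub>"
      by (auto simp: fun_eq_iff restrict_def N.l_neg)
    ultimately show "\<exists>g\<in>carrier ?G. g \<otimes>\<^bsub>?G\<^esub> f = \<one>\<^bsub>?G\<^esub>"
      by blast
  qed
qed

lemma inv_Hom_G:
  assumes "ZG_module \<Gamma> P" "ZG_module \<Gamma> N" and f: "f \<in> carrier (Hom_G \<Gamma> P N)" and x: "x \<in> carrier P"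
  shows "(inv\<^bsub>Hom_G \<Gamma> P N\<^esub> f) x = \<ominus>\<^bsub>N\<^esub> f x"
proof -
  interpret N: ZG_module \<Gamma> N by fact
  interpret G: comm_group "Hom_G \<Gamma> P N" by (rule comm_group_Hom_G) fact+
  have "(inv\<^bsub>Hom_G \<Gamma> P N\<^esub> f \<otimes>\<^bsub>Hom_G \<Gamma> P N\<^esub> f) x = \<zero>\<^bsub>N\<^esub>"
    using f x by (simp add: one_Hom_G)
  then have "(inv\<^bsub>Hom_G \<Gamma> P N\<^esub> f) x \<oplus>\<^bsub>N\<^esub> f x = \<zero>\<^bsub>N\<^esub>"
    using x by (simp add: mult_Hom_G)
  then show ?thesis
    using N.minus_equality ZG_hom_closed[OF Hom_G_ZG_hom[OF f] x]
      ZG_hom_closed[OF Hom_G_ZG_hom[OF G.inv_closed[OF f]] x] by simp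
qed

section \<open>Change of coefficients on equivariant cochains and its exactness\<close>

lemma compose_hom_Hom_G:
  assumes P: "ZG_module \<Gamma> P" and f: "f \<in> ZG_hom \<Gamma> N N'"
  shows "compose (carrier P) f \<in> hom (Hom_G \<Gamma> P N) (Hom_G \<Gamma> P N')"
proof (rule homI)
  interpret P: ZG_module \<Gamma> P by fact
  fix g assume g: "g \<in> carrier (Hom_G \<Gamma> P N)"
  note [simp] = ZG_hom_closed[OF Hom_G_ZG_hom[OF g]] ZG_hom_act[OF Hom_G_ZG_hom[OF g]]
    ZG_hom_add[OF Hom_G_ZG_hom[OF g]] ZG_hom_closed[OF f] ZG_hom_act[OF f] ZG_hom_add[OF f]
  have "compose (carrier P) f g \<in> ZG_hom \<Gamma> P N'"
    by (rule ZG_homI) (simp_all add: compose_def P.act_closed)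
  then show "compose (carrier P) f g \<in> carrier (Hom_G \<Gamma> P N')"
    by (simp add: mem_Hom_G_iff)
  fix h assume h: "h \<in> carrier (Hom_G \<Gamma> P N)"
  show "compose (carrier P) f (g \<otimes>\<^bsub>Hom_G \<Gamma> P N\<^esub> h)
      = compose (carrier P) f g \<otimes>\<^bsub>Hom_G \<Gamma> P N'\<^esub> compose (carrier P) f h"
    using ZG_hom_closed[OF Hom_G_ZG_hom[OF h]] by (auto simp: fun_eq_iff compose_def mult_Hom_G)
qed

lemma compose_inj_Hom_G:
  assumes "inj_on \<iota> (carrier N)"
  shows "inj_on (compose (carrier P) \<iota>) (carrier (Hom_G \<Gamma> P N))"
proof (rule inj_onI)
  fix f g
  assume f: "f \<in> carrier (Hom_G \<Gamma> P N)" and g: "g \<in> carrier (Hom_G \<Gamma> P N)"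
    and eq: "compose (carrier P) \<iota> f = compose (carrier P) \<iota> g"
  show "f = g"
  proof (rule extensionalityI)
    fix x assume x: "x \<in> carrier P"
    have "\<iota> (f x) = \<iota> (g x)"
      using fun_cong[OF eq, of x] x by (simp add: compose_def)
    then show "f x = g x"
      using assms ZG_hom_closed[OF Hom_G_ZG_hom[OF f] x] ZG_hom_closed[OF Hom_G_ZG_hom[OF g] x]
      by (simp add: inj_on_def)
  qed (use f g in \<open>simp_all add: mem_Hom_G_iff\<close>)
qed

text \<open>As for chains, uniqueness of preimages under \<open>\<iota>\<close> makes the pointwise
  choice additive and equivariant.\<close>

lemma compose_exact_Hom_G:
  assumes P: "ZG_module \<Gamma> P" and exact: "ZG_short_exact \<Gamma> K \<iota> L \<phi> M"
  shows "kernel (Hom_G \<Gamma> P L) (Hom_G \<Gamma> P M) (compose (carrier P) \<phi>)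
    \<subseteq> compose (carrier P) \<iota> ` carrier (Hom_G \<Gamma> P K)"
proof
  note ex = ZG_short_exactD[OF exact]
  interpret P: ZG_module \<Gamma> P by fact
  interpret K: ZG_module \<Gamma> K by (rule ex)
  fix g assume "g \<in> kernel (Hom_G \<Gamma> P L) (Hom_G \<Gamma> P M) (compose (carrier P) \<phi>)"
  then have g: "g \<in> carrier (Hom_G \<Gamma> P L)" and \<phi>g: "compose (carrier P) \<phi> g = (\<lambda>x\<in>carrier P. \<zero>\<^bsub>M\<^esub>)"
    by (auto simp: kernel_def one_Hom_G)
  have \<phi>g: "\<phi> (g x) = \<zero>\<^bsub>M\<^esub>" if "x \<in> carrier P" for x
    using that fun_cong[OF \<phi>g, of x] by (simp add: compose_def)
  note g' = ZG_hom_closed[OF Hom_G_ZG_hom[OF g]] ZG_hom_act[OF Hom_G_ZG_hom[OF g]]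
    ZG_hom_add[OF Hom_G_ZG_hom[OF g]]
  define f where "f = (\<lambda>x\<in>carrier P. inv_into (carrier K) \<iota> (g x))"
  have f: "f x \<in> carrier K" "\<iota> (f x) = g x" if "x \<in> carrier P" for x
    using ZG_short_exact_factor[OF exact g'(1)[OF that] \<phi>g[OF that]] that by (simp_all add: f_def)
  have \<iota>_eq: "u = v" if "u \<in> carrier K" "v \<in> carrier K" "\<iota> u = \<iota> v" for u v
    using ex(6) that by (simp add: inj_on_def)
  have "f \<in> ZG_hom \<Gamma> P K"
  proof (rule ZG_homI)
    show "f (x \<oplus>\<^bsub>P\<^esub> y) = f x \<oplus>\<^bsub>K\<^esub> f y" if "x \<in> carrier P" "y \<in> carrier P" for x y
      by (rule \<iota>_eq) (use that in \<open>simp_all add: f g' ZG_hom_add[OF ex(4)]\<close>)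
    show "f (\<gamma> \<odot>\<^bsub>P\<^esub> x) = \<gamma> \<odot>\<^bsub>K\<^esub> f x" if "\<gamma> \<in> carrier \<Gamma>" "x \<in> carrier P" for \<gamma> x
      by (rule \<iota>_eq) (use that in \<open>simp_all add: f g' ZG_hom_act[OF ex(4)] P.act_closed K.act_closed\<close>)
  qed (rule f)
  then have "f \<in> carrier (Hom_G \<Gamma> P K)"
    by (simp add: mem_Hom_G_iff f_def)
  moreover have "compose (carrier P) \<iota> f = g"
    by (rule ext) (simp add: compose_def f(2) Hom_G_undefined[OF g])
  ultimately show "g \<in> compose (carrier P) \<iota> ` carrier (Hom_G \<Gamma> P K)"
    by blast
qed

text \<open>Free modules are projective. A lift is chosen at each \<open>b\<close> in
  \<open>B\<close>, carried to the translates of \<open>b\<close> by the action, and extended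
  additively; the family of translates is an integer basis of \<open>P\<close>.\<close>

lemma compose_surj_Hom_G:
  assumes P: "ZG_free \<Gamma> P" and L: "ZG_module \<Gamma> L" and M: "ZG_module \<Gamma> M"
    and \<phi>: "\<phi> \<in> ZG_hom \<Gamma> L M" and surj: "\<phi> ` carrier L = carrier M"
  shows "carrier (Hom_G \<Gamma> P M) \<subseteq> compose (carrier P) \<phi> ` carrier (Hom_G \<Gamma> P L)"
proof
  interpret P: ZG_module \<Gamma> P using P by (simp add: ZG_free_def)
  interpret L: ZG_module \<Gamma> L by fact
  interpret M: ZG_module \<Gamma> M by fact
  obtain B where B: "B \<subseteq> carrier P" and bij: "bij_betw (int_comb P (\<lambda>(\<gamma>, b). \<gamma> \<odot>\<^bsub>P\<^esub> b))
      (carrier (free_Abelian_group (carrier \<Gamma> \<times> B))) (carrier P)"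
    using P by (auto simp: ZG_free_def)
  fix f assume f: "f \<in> carrier (Hom_G \<Gamma> P M)"
  note f' = ZG_hom_closed[OF Hom_G_ZG_hom[OF f]] ZG_hom_act[OF Hom_G_ZG_hom[OF f]]
  let ?T = "carrier \<Gamma> \<times> B"
  let ?e = "\<lambda>(\<gamma>, b). \<gamma> \<odot>\<^bsub>P\<^esub> b"
  define l where "l b = inv_into (carrier L) \<phi> (f b)" for b
  have l: "l b \<in> carrier L" "\<phi> (l b) = f b" if "b \<in> B" for b
    using f'(1)[of b] B that surj unfolding l_def by (auto simp: inv_into_into f_inv_into_f)
  let ?l = "\<lambda>(\<gamma>, b). \<gamma> \<odot>\<^bsub>L\<^esub> l b"
  have e_in: "?e \<in> ?T \<rightarrow> carrier P" and l_in: "?l \<in> ?T \<rightarrow> carrier L"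
    using B l(1) by (auto simp: P.act_closed L.act_closed)
  \<comment> \<open>\<open>inv_into\<close> reads off the integer coordinates of \<open>x\<close>
    with respect to the translates, which are unique by \<open>bij\<close>.\<close>
  define g where "g = (\<lambda>x\<in>carrier P. int_comb L ?l
    (inv_into (carrier (free_Abelian_group ?T)) (int_comb P ?e) x))"
  have g_comb: "g (int_comb P ?e u) = int_comb L ?l u" if "Poly_Mapping.keys u \<subseteq> ?T" for u
    using bij that P.int_comb_closed[OF e_in that] unfolding g_def bij_betw_def
    by (simp add: inv_into_f_f)
  have rep: "\<exists>u. Poly_Mapping.keys u \<subseteq> ?T \<and> x = int_comb P ?e u" if "x \<in> carrier P" for x
  proof -
    have "x \<in> int_comb P ?e ` carrier (free_Abelian_group ?T)"
      using bij that by (simp add: bij_betw_def)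
    then obtain u where "u \<in> carrier (free_Abelian_group ?T)" "x = int_comb P ?e u"
      by blast
    then show ?thesis by (intro exI[of _ u]) simp
  qed
  have "g \<in> ZG_hom \<Gamma> P L"
  proof (rule ZG_homI)
    fix x assume x: "x \<in> carrier P"
    obtain u where u: "Poly_Mapping.keys u \<subseteq> ?T" "x = int_comb P ?e u"
      using rep[OF x] by blast
    show "g x \<in> carrier L"
      using g_comb[OF u(1)] u(2) L.int_comb_closed[OF l_in u(1)] by simp
    show "g (x \<oplus>\<^bsub>P\<^esub> y) = g x \<oplus>\<^bsub>L\<^esub> g y" if y: "y \<in> carrier P" for y
    proof -
      obtain v where v: "Poly_Mapping.keys v \<subseteq> ?T" "y = int_comb P ?e v"
        using rep[OF y] by blast
      have "Poly_Mapping.keys (u + v) \<subseteq> ?T"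
        using keys_add[of u v] u v by blast
      then have "g (int_comb P ?e (u + v)) = int_comb L ?l u \<oplus>\<^bsub>L\<^esub> int_comb L ?l v"
        using g_comb L.int_comb_add[OF l_in u(1) v(1)] by metis
      then show ?thesis
        using P.int_comb_add[OF e_in u(1) v(1)] g_comb[OF u(1)] g_comb[OF v(1)] u(2) v(2) by simp
    qed
    show "g (\<gamma> \<odot>\<^bsub>P\<^esub> x) = \<gamma> \<odot>\<^bsub>L\<^esub> g x" if \<gamma>: "\<gamma> \<in> carrier \<Gamma>" for \<gamma>
    proof -
      \<comment> \<open>Left translation by \<open>\<gamma>\<close> on the index set
        \<open>?T\<close>. It expresses the action in coordinates for both families
        \<open>?e\<close> and \<open>?l\<close>, and this makes \<open>g\<close>
        equivariant.\<close>
      let ?r = "\<lambda>(\<gamma>', b). frag_of (\<gamma> \<otimes>\<^bsub>\<Gamma>\<^esub> \<gamma>', b)"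
      have r: "Poly_Mapping.keys (?r s) \<subseteq> ?T" if "s \<in> ?T" for s
        using that \<gamma> by auto
      have keys: "Poly_Mapping.keys (frag_extend ?r u) \<subseteq> ?T"
        using keys_frag_extend[of ?r u] r u(1) by blast
      have "\<gamma> \<odot>\<^bsub>P\<^esub> x = int_comb P (\<lambda>s. \<gamma> \<odot>\<^bsub>P\<^esub> ?e s) u"
        using hom_int_comb[OF P.abelian_group_axioms P.abelian_group_axioms P.act_hom[OF \<gamma>] e_in u(1)] u(2) by simp
      also have "\<dots> = int_comb P (\<lambda>s. int_comb P ?e (?r s)) u"
        by (rule P.int_comb_cong[OF u(1)])
          (use B \<gamma> in \<open>auto simp: P.int_comb_frag_of P.act_mult P.act_closed subset_eq\<close>)
      also have "\<dots> = int_comb P ?e (frag_extend ?r u)"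
        by (rule P.int_comb_frag_extend[OF e_in r u(1)])
      finally have "g (\<gamma> \<odot>\<^bsub>P\<^esub> x) = int_comb L ?l (frag_extend ?r u)"
        using g_comb[OF keys] by simp
      also have "\<dots> = int_comb L (\<lambda>s. int_comb L ?l (?r s)) u"
        by (rule L.int_comb_frag_extend[OF l_in r u(1), symmetric])
      also have "\<dots> = int_comb L (\<lambda>s. \<gamma> \<odot>\<^bsub>L\<^esub> ?l s) u"
        by (rule L.int_comb_cong[OF u(1)])
          (use l(1) \<gamma> in \<open>auto simp: L.int_comb_frag_of L.act_mult L.act_closed\<close>)
      also have "\<dots> = \<gamma> \<odot>\<^bsub>L\<^esub> g x"
        using hom_int_comb[OF L.abelian_group_axioms L.abelian_group_axioms L.act_hom[OF \<gamma>] l_in u(1)]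
          g_comb[OF u(1)] u(2) by simp
      finally show ?thesis .
    qed
  qed
  then have "g \<in> carrier (Hom_G \<Gamma> P L)"
    by (simp add: mem_Hom_G_iff g_def)
  moreover have "compose (carrier P) \<phi> g = f"
  proof (rule ext)
    fix x
    show "compose (carrier P) \<phi> g x = f x"
    proof (cases "x \<in> carrier P")
      case True
      obtain u where u: "Poly_Mapping.keys u \<subseteq> ?T" "x = int_comb P ?e u"
        using rep[OF True] by blast
      have "\<phi> (g x) = int_comb M (\<lambda>s. \<phi> (?l s)) u"
        using hom_int_comb[OF L.abelian_group_axioms M.abelian_group_axioms ZG_hom_hom[OF \<phi>] l_in u(1)]
          g_comb[OF u(1)] u(2) by simp
      also have "\<dots> = int_comb M (\<lambda>s. f (?e s)) u"
        by (rule M.int_comb_cong[OF u(1)])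
          (use B l f' in \<open>auto simp: ZG_hom_act[OF \<phi>] M.act_closed P.act_closed subset_eq\<close>)
      also have "\<dots> = f x"
        using hom_int_comb[OF P.abelian_group_axioms M.abelian_group_axioms ZG_hom_hom[OF Hom_G_ZG_hom[OF f]] e_in u(1)]
          u(2) by simp
      finally show ?thesis
        using True by (simp add: compose_def)
    qed (simp add: compose_def Hom_G_undefined[OF f])
  qed
  ultimately show "f \<in> compose (carrier P) \<phi> ` carrier (Hom_G \<Gamma> P L)"
    by blast
qed

section \<open>The coboundary operator on equivariant cochains\<close>

lemma free_chain_complexD:
  assumes "free_chain_complex \<Gamma> C d"
  shows "ZG_free \<Gamma> (C m)" "ZG_module \<Gamma> (C m)" "abelian_group (C m)"
    "d m \<in> ZG_hom \<Gamma> (C m) (C (m - 1))" "d (m + 1) \<in> ZG_hom \<Gamma> (C (m + 1)) (C m)"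
    "x \<in> carrier (C m) \<Longrightarrow> d (m - 1) (d m x) = \<zero>\<^bsub>C (m - 2)\<^esub>"
proof -
  have all: "ZG_free \<Gamma> (C m) \<and> d m \<in> ZG_hom \<Gamma> (C m) (C (m - 1)) \<and>
      (\<forall>x\<in>carrier (C m). d (m - 1) (d m x) = \<zero>\<^bsub>C (m - 2)\<^esub>)" for m
    using assms by (simp add: free_chain_complex_def)
  then show "ZG_free \<Gamma> (C m)" "d m \<in> ZG_hom \<Gamma> (C m) (C (m - 1))" "ZG_module \<Gamma> (C m)"
    "x \<in> carrier (C m) \<Longrightarrow> d (m - 1) (d m x) = \<zero>\<^bsub>C (m - 2)\<^esub>"
    by (simp_all add: ZG_free_def)
  then show "abelian_group (C m)"
    by (simp add: ZG_module_def)
  show "d (m + 1) \<in> ZG_hom \<Gamma> (C (m + 1)) (C m)"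
    using all[of "m + 1"] by simp
qed

lemma coboundary_hom:
  assumes C: "free_chain_complex \<Gamma> C d"
  shows "coboundary C d m \<in> hom (Hom_G \<Gamma> (C m) N) (Hom_G \<Gamma> (C (m + 1)) N)"
proof (rule homI)
  interpret P: ZG_module \<Gamma> "C (m + 1)" by (rule free_chain_complexD[OF C])
  note d = free_chain_complexD(5)[OF C, of m]
  note [simp] = ZG_hom_closed[OF d] ZG_hom_act[OF d] ZG_hom_add[OF d]
  fix f assume f: "f \<in> carrier (Hom_G \<Gamma> (C m) N)"
  note [simp] = ZG_hom_closed[OF Hom_G_ZG_hom[OF f]] ZG_hom_act[OF Hom_G_ZG_hom[OF f]]
    ZG_hom_add[OF Hom_G_ZG_hom[OF f]]
  have "coboundary C d m f \<in> ZG_hom \<Gamma> (C (m + 1)) N"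
    by (rule ZG_homI) (simp_all add: coboundary_def compose_def P.act_closed)
  then show "coboundary C d m f \<in> carrier (Hom_G \<Gamma> (C (m + 1)) N)"
    by (simp add: mem_Hom_G_iff coboundary_def)
  fix g
  show "coboundary C d m (f \<otimes>\<^bsub>Hom_G \<Gamma> (C m) N\<^esub> g)
      = coboundary C d m f \<otimes>\<^bsub>Hom_G \<Gamma> (C (m + 1)) N\<^esub> coboundary C d m g"
    by (auto simp: fun_eq_iff coboundary_def compose_def mult_Hom_G)
qed

lemma coboundary_coboundary:
  assumes C: "free_chain_complex \<Gamma> C d" and N: "ZG_module \<Gamma> N" and f: "f \<in> carrier (Hom_G \<Gamma> (C m) N)"
  shows "coboundary C d (m + 1) (coboundary C d m f) = \<one>\<^bsub>Hom_G \<Gamma> (C (m + 1 + 1)) N\<^esub>"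
proof -
  have "f \<zero>\<^bsub>C m\<^esub> = \<zero>\<^bsub>N\<^esub>"
    using hom_one[OF ZG_hom_hom[OF Hom_G_ZG_hom[OF f]]] free_chain_complexD(3)[OF C] N
    by (simp add: abelian_group.a_group ZG_module_def)
  moreover have "d (m + 1) (d (m + 1 + 1) x) = \<zero>\<^bsub>C m\<^esub>" if "x \<in> carrier (C (m + 1 + 1))" for x
  proof -
    have "m + 1 + 1 - 1 = m + 1" "m + 1 + 1 - 2 = m" by simp_all
    then show ?thesis using free_chain_complexD(6)[OF C that] by (simp only:)
  qed
  ultimately show ?thesis
    using ZG_hom_closed[OF free_chain_complexD(5)[OF C, of "m + 1"]]
    by (auto simp: fun_eq_iff coboundary_def compose_def one_Hom_G restrict_def)
qed

lemma coboundary_natural: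
  assumes C: "free_chain_complex \<Gamma> C d"
  shows "coboundary C d m (compose (carrier (C m)) f g) = compose (carrier (C (m + 1))) f (coboundary C d m g)"
  using ZG_hom_closed[OF free_chain_complexD(5)[OF C, of m]]
  by (auto simp: fun_eq_iff coboundary_def compose_def)


section \<open>Tensor products of complexes\<close>

locale tensor_groups =
  fixes A :: "int \<Rightarrow> ('a, 'x) monoid_scheme" and B :: "int \<Rightarrow> ('b, 'y) monoid_scheme"
  assumes group_A: "\<And>p. group (A p)" and group_B: "\<And>q. group (B q)"
begin

abbreviation generators :: "int \<Rightarrow> (int \<times> 'a \<times> 'b) set"
  where "generators n \<equiv> {(p, x, y). x \<in> carrier (A p) \<and> y \<in> carrier (B (n - p))}"

abbreviation left_relation :: "int \<Rightarrow> 'a \<Rightarrow> 'a \<Rightarrow> 'b \<Rightarrow> (int \<times> 'a \<times> 'b \<Rightarrow>\<^sub>0 int)"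
  where "left_relation p x x' y
    \<equiv> frag_of (p, x \<otimes>\<^bsub>A p\<^esub> x', y) - frag_of (p, x, y) - frag_of (p, x', y)"

abbreviation right_relation :: "int \<Rightarrow> int \<Rightarrow> 'a \<Rightarrow> 'b \<Rightarrow> 'b \<Rightarrow> (int \<times> 'a \<times> 'b \<Rightarrow>\<^sub>0 int)"
  where "right_relation n p x y y'
    \<equiv> frag_of (p, x, y \<otimes>\<^bsub>B (n - p)\<^esub> y') - frag_of (p, x, y) - frag_of (p, x, y')"

abbreviation relators :: "int \<Rightarrow> (int \<times> 'a \<times> 'b \<Rightarrow>\<^sub>0 int) set"
  where "relators n \<equiv>
    {left_relation p x x' y | p x x' y.
        x \<in> carrier (A p) \<and> x' \<in> carrier (A p) \<and> y \<in> carrier (B (n - p))} \<union>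
    {right_relation n p x y y' | p x y y'.
        x \<in> carrier (A p) \<and> y \<in> carrier (B (n - p)) \<and> y' \<in> carrier (B (n - p))}"

lemma left_relator:
  "x \<in> carrier (A p) \<Longrightarrow> x' \<in> carrier (A p) \<Longrightarrow> y \<in> carrier (B (n - p))
    \<Longrightarrow> left_relation p x x' y \<in> relators n"
  by blast

lemma right_relator:
  "x \<in> carrier (A p) \<Longrightarrow> y \<in> carrier (B (n - p)) \<Longrightarrow> y' \<in> carrier (B (n - p))
    \<Longrightarrow> right_relation n p x y y' \<in> relators n"
  by blast

lemma tensor_relations_eq: "tensor_relations A B n = generate (tensor_free A B n) (relators n)"
  by (simp add: tensor_relations_def)

lemma keys_diff3:
  assumes "a \<in> X" "b \<in> X" "c \<in> X"
  shows "Poly_Mapping.keys (frag_of a - frag_of b - frag_of c) \<subseteq> X"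
proof -
  have "frag_of a - frag_of b - frag_of c \<in> carrier (free_Abelian_group X)"
    using assms keys_diff[of "frag_of a - frag_of b" "frag_of c"] keys_diff[of "frag_of a" "frag_of b"]
    by auto
  then show ?thesis by simp
qed

lemma relators_carrier: "relators n \<subseteq> carrier (tensor_free A B n)"
proof -
  have "left_relation p x x' y \<in> carrier (tensor_free A B n)"
    if "x \<in> carrier (A p)" "x' \<in> carrier (A p)" "y \<in> carrier (B (n - p))" for p x x' y
    unfolding tensor_free_def carrier_free_Abelian_group_iff
    by (rule keys_diff3) (use that monoid.m_closed[OF group.is_monoid[OF group_A]] in auto)
  moreover have "right_relation n p x y y' \<in> carrier (tensor_free A B n)"
    if "x \<in> carrier (A p)" "y \<in> carrier (B (n - p))" "y' \<in> carrier (B (n - p))" for p x y y'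
    unfolding tensor_free_def carrier_free_Abelian_group_iff
    by (rule keys_diff3) (use that monoid.m_closed[OF group.is_monoid[OF group_B]] in auto)
  ultimately show ?thesis by blast
qed

lemma comm_group_tensor_free: "comm_group (tensor_free A B n)"
  by (simp add: tensor_free_def abelian_free_Abelian_group)

lemma subgroup_tensor_relations: "subgroup (tensor_relations A B n) (tensor_free A B n)"
  unfolding tensor_relations_eq
  by (rule group.generate_is_subgroup[OF _ relators_carrier]) (simp add: tensor_free_def)

lemma normal_tensor_relations: "tensor_relations A B n \<lhd> tensor_free A B n"
  by (rule comm_group.subgroup_imp_normal[OF comm_group_tensor_free subgroup_tensor_relations])

lemma relators_tensor_relations: "relators n \<subseteq> tensor_relations A B n"
  unfolding tensor_relations_eq by (rule subsetI) (rule generate.incl)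

text \<open>Pulling \<open>a\<close> back along the quotient map allows computation with integer
  combinations of generators instead of cosets.\<close>

lemma tensor_hom_lift:
  assumes "a \<in> hom (tensor A B n) integer_group"
  shows "(\<lambda>u. a (tensor_relations A B n #>\<^bsub>tensor_free A B n\<^esub> u)) \<in> hom (tensor_free A B n) integer_group"
  using hom_compose[OF normal.r_coset_hom_Mod[OF normal_tensor_relations] assms[unfolded tensor_def]]
  by (simp add: comp_def)

lemma tensor_hom_relation:
  assumes a: "a \<in> hom (tensor A B n) integer_group" and r: "r \<in> tensor_relations A B n"
  shows "a (tensor_relations A B n #>\<^bsub>tensor_free A B n\<^esub> r) = 0"
proof -
  interpret R: normal "tensor_relations A B n" "tensor_free A B n"
    by (rule normal_tensor_relations)
  have "tensor_relations A B n #>\<^bsub>tensor_free A B n\<^esub> r = \<one>\<^bsub>tensor A B n\<^esub>"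
    using R.rcos_const[OF R.group_axioms r] by (simp add: tensor_def)
  then show ?thesis
    using hom_one[OF a] R.factorgroup_is_group by (simp add: tensor_def)
qed

text \<open>Relators of both kinds are one generator minus two others, and a functional on the
  quotient kills them. One statement thus yields additivity in either variable.\<close>

lemma tensor_hom_relator:
  assumes a: "a \<in> hom (tensor A B n) integer_group" and r: "frag_of u - frag_of v - frag_of w \<in> relators n"
    and "u \<in> generators n" "v \<in> generators n" "w \<in> generators n"
  defines "\<alpha> \<equiv> \<lambda>u. a (tensor_relations A B n #>\<^bsub>tensor_free A B n\<^esub> u)"
  shows "\<alpha> (frag_of u) = \<alpha> (frag_of v) + \<alpha> (frag_of w)"
proof -
  have \<alpha>: "\<alpha> \<in> hom (free_Abelian_group (generators n)) integer_group"
    using tensor_hom_lift[OF a] by (simp add: \<alpha>_def tensor_free_def)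
  have "\<alpha> (frag_of u - frag_of v - frag_of w) = 0"
    unfolding \<alpha>_def using tensor_hom_relation[OF a] relators_tensor_relations r by blast
  moreover have "Poly_Mapping.keys (frag_of u - frag_of v) \<subseteq> generators n"
    using keys_diff[of "frag_of u" "frag_of v"] assms(3,4) by auto
  ultimately show ?thesis
    using hom_free_Abelian_group_diff[OF \<alpha> group_integer_group, of "frag_of u - frag_of v" "frag_of w"]
      hom_free_Abelian_group_diff[OF \<alpha> group_integer_group, of "frag_of u" "frag_of v"] assms(3-5) by simp
qed

lemma pure_tensor_carrier:
  assumes "x \<in> carrier (A p)" "y \<in> carrier (B (n - p))"
  shows "pure_tensor A B n p x y \<in> carrier (tensor A B n)"
  unfolding tensor_def pure_tensor_def FactGroup_def RCOSETS_def tensor_free_def using assms by auto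

lemma pure_tensor_add_left:
  assumes a: "a \<in> hom (tensor A B n) integer_group"
    and "x \<in> carrier (A p)" "x' \<in> carrier (A p)" "y \<in> carrier (B (n - p))"
  shows "a (pure_tensor A B n p (x \<otimes>\<^bsub>A p\<^esub> x') y) = a (pure_tensor A B n p x y) + a (pure_tensor A B n p x' y)"
  unfolding pure_tensor_def
  by (rule tensor_hom_relator[OF a])
    (use assms group.is_monoid[OF group_A] in \<open>auto simp: monoid.m_closed\<close>)

lemma pure_tensor_add_right:
  assumes a: "a \<in> hom (tensor A B n) integer_group"
    and "x \<in> carrier (A p)" "y \<in> carrier (B (n - p))" "y' \<in> carrier (B (n - p))"
  shows "a (pure_tensor A B n p x (y \<otimes>\<^bsub>B (n - p)\<^esub> y')) = a (pure_tensor A B n p x y) + a (pure_tensor A B n p x y')"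
  unfolding pure_tensor_def
  by (rule tensor_hom_relator[OF a])
    (use assms group.is_monoid[OF group_B] in \<open>auto simp: monoid.m_closed\<close>)

end

section \<open>The boundary of the tensor product and the cocycle identity\<close>

locale tensor_complexes = tensor_groups A B
  for A :: "int \<Rightarrow> ('a, 'x) monoid_scheme" and B :: "int \<Rightarrow> ('b, 'y) monoid_scheme" +
  fixes dA :: "int \<Rightarrow> 'a \<Rightarrow> 'a" and dB :: "int \<Rightarrow> 'b \<Rightarrow> 'b"
  assumes dA: "dA p \<in> hom (A p) (A (p - 1))" and dB: "dB q \<in> hom (B q) (B (q - 1))"
begin

text \<open>The map on free groups from which \<open>tensor_boundary\<close> is induced, before
  passing to the quotient.\<close>

definition leibniz :: "int \<Rightarrow> int \<times> 'a \<times> 'b \<Rightarrow> (int \<times> 'a \<times> 'b \<Rightarrow>\<^sub>0 int)"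
  where "leibniz n = (\<lambda>(p, x, y). frag_of (p - 1, dA p x, y) +
    frag_cmul (if even p then 1 else - 1) (frag_of (p, x, dB (n - p) y)))"

lemma leibniz_hom: "frag_extend (leibniz n) \<in> hom (tensor_free A B n) (tensor_free A B (n - 1))"
proof (rule homI)
  fix u assume "u \<in> carrier (tensor_free A B n)"
  then have u: "Poly_Mapping.keys u \<subseteq> generators n" by (simp add: tensor_free_def)
  have "Poly_Mapping.keys (leibniz n g) \<subseteq> generators (n - 1)" if "g \<in> generators n" for g
  proof -
    obtain p x y where g: "g = (p, x, y)" "x \<in> carrier (A p)" "y \<in> carrier (B (n - p))"
      using \<open>g \<in> generators n\<close> by auto
    have deg: "n - 1 - (p - 1) = n - p" "n - 1 - p = n - p - 1" by simp_all
    have "(p - 1, dA p x, y) \<in> generators (n - 1)" "(p, x, dB (n - p) y) \<in> generators (n - 1)"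
      using g(2,3) hom_in_carrier[OF dA g(2)] hom_in_carrier[OF dB g(3)]
      unfolding mem_Collect_eq prod.case deg by blast+
    then show ?thesis
      unfolding g leibniz_def prod.case
      by (intro order_trans[OF keys_add] Un_least order_trans[OF keys_cmul]) simp_all
  qed
  then show "frag_extend (leibniz n) u \<in> carrier (tensor_free A B (n - 1))"
    using keys_frag_extend[of "leibniz n" u] u by (fastforce simp: tensor_free_def)
qed (simp add: tensor_free_def frag_extend_add)

text \<open>Since \<open>dA\<close> and \<open>dB\<close> are additive, a relator goes to a relator
  in first degree \<open>p - 1\<close> plus or minus one in first degree \<open>p\<close>. This is
  what lets the Leibniz map descend to the tensor product.\<close>

lemma leibniz_relators: "frag_extend (leibniz n) ` relators n \<subseteq> tensor_relations A B (n - 1)"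
proof -
  let ?R = "tensor_relations A B (n - 1)"
  interpret R: subgroup ?R "tensor_free A B (n - 1)"
    by (rule subgroup_tensor_relations)
  \<comment> \<open>The degree of the second factor is not stored but computed from the total degree
    and \<open>p\<close>; these identities match it after either factor has been lowered.\<close>
  have deg: "n - 1 - (p - 1) = n - p" "n - 1 - p = n - p - 1" for p by simp_all
  have plus: "u + v \<in> ?R" if "u \<in> ?R" "v \<in> ?R" for u v
    using R.m_closed[OF that] by (simp add: tensor_free_def)
  have uminus: "- u \<in> ?R" if "u \<in> ?R" for u
    using R.m_inv_closed[OF that] R.mem_carrier[OF that] by (simp add: tensor_free_def)
  have sign: "frag_cmul (if even p then 1 else - 1) u \<in> ?R" if "u \<in> ?R" for p :: int and u
    using that uminus by simp
  show ?thesis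
  proof (clarsimp simp only: image_subset_iff Ball_def Un_iff mem_Collect_eq, elim disjE exE conjE; hypsubst)
    fix p x x' y assume xy: "x \<in> carrier (A p)" "x' \<in> carrier (A p)" "y \<in> carrier (B (n - p))"
    have d: "dA p x \<in> carrier (A (p - 1))" "dA p x' \<in> carrier (A (p - 1))"
        "y \<in> carrier (B (n - 1 - (p - 1)))" "dB (n - p) y \<in> carrier (B (n - 1 - p))"
      unfolding deg(1) deg(2)[of p] using xy dA dB hom_in_carrier by fast+
    have "frag_extend (leibniz n) (left_relation p x x' y)
      = left_relation (p - 1) (dA p x) (dA p x') y +
        frag_cmul (if even p then 1 else - 1) (left_relation p x x' (dB (n - p) y))"
      using xy by (simp add: frag_extend_diff frag_extend_add leibniz_def hom_mult[OF dA] algebra_simps)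
    moreover have "left_relation (p - 1) (dA p x) (dA p x') y \<in> relators (n - 1)"
      by (rule left_relator) (fact xy d)+
    moreover have "left_relation p x x' (dB (n - p) y) \<in> relators (n - 1)"
      by (rule left_relator) (fact xy d)+
    ultimately show "frag_extend (leibniz n) (left_relation p x x' y) \<in> ?R"
      by (simp only: plus sign relators_tensor_relations[THEN subsetD])
  next
    fix p x y y' assume xy: "x \<in> carrier (A p)" "y \<in> carrier (B (n - p))" "y' \<in> carrier (B (n - p))"
    have d: "dA p x \<in> carrier (A (p - 1))" "y \<in> carrier (B (n - 1 - (p - 1)))"
        "y' \<in> carrier (B (n - 1 - (p - 1)))" "dB (n - p) y \<in> carrier (B (n - 1 - p))"
        "dB (n - p) y' \<in> carrier (B (n - 1 - p))"
      unfolding deg(1) deg(2)[of p] using xy dA dB hom_in_carrier by fast+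
    have "frag_extend (leibniz n) (right_relation n p x y y')
      = right_relation (n - 1) (p - 1) (dA p x) y y' +
        frag_cmul (if even p then 1 else - 1) (right_relation (n - 1) p x (dB (n - p) y) (dB (n - p) y'))"
      using xy by (simp add: frag_extend_diff frag_extend_add leibniz_def hom_mult[OF dB] deg algebra_simps)
    moreover have "right_relation (n - 1) (p - 1) (dA p x) y y' \<in> relators (n - 1)"
      by (rule right_relator) (fact xy d)+
    moreover have "right_relation (n - 1) p x (dB (n - p) y) (dB (n - p) y') \<in> relators (n - 1)"
      by (rule right_relator) (fact xy d)+
    ultimately show "frag_extend (leibniz n) (right_relation n p x y y') \<in> ?R"
      by (simp only: plus sign relators_tensor_relations[THEN subsetD])
  qed
qed

lemma leibniz_relations: "frag_extend (leibniz n) ` tensor_relations A B n \<subseteq> tensor_relations A B (n - 1)"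
proof -
  interpret group_hom "tensor_free A B n" "tensor_free A B (n - 1)" "frag_extend (leibniz n)"
    using leibniz_hom by (simp add: group_hom_def group_hom_axioms_def tensor_free_def)
  show ?thesis
    unfolding tensor_relations_eq[of n] generate_img[OF relators_carrier, symmetric]
    by (rule H.generate_subgroup_incl[OF leibniz_relators subgroup_tensor_relations])
qed

lemma tensor_boundary_pure_tensor:
  assumes "x \<in> carrier (A p)" "y \<in> carrier (B (n - p))"
  shows "tensor_boundary A dA B dB n (pure_tensor A B n p x y)
    = tensor_relations A B (n - 1) #>\<^bsub>tensor_free A B (n - 1)\<^esub> leibniz n (p, x, y)"
  using induced_rcoset[OF _ _ leibniz_hom subgroup_tensor_relations subgroup_tensor_relations
      leibniz_relations, of n "frag_of (p, x, y)"] assms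
  unfolding tensor_boundary_def pure_tensor_def leibniz_def[symmetric]
  by (simp add: tensor_free_def)

text \<open>The pure tensor of \<open>x\<close> and \<open>y\<close> has degree
  \<open>n + 1\<close>, its boundary has two terms, and \<open>a\<close> vanishes on the boundary;
  one term is therefore the other up to the Leibniz sign.\<close>

lemma tensor_cocycle:
  assumes a: "a \<in> hom (tensor A B n) integer_group"
    and cocycle: "\<And>X. X \<in> carrier (tensor A B (n + 1)) \<Longrightarrow> a (tensor_boundary A dA B dB (n + 1) X) = 0"
    and x: "x \<in> carrier (A p)" and y: "y \<in> carrier (B (n + 1 - p))"
  shows "a (pure_tensor A B n (p - 1) (dA p x) y)
    = (if even p then - 1 else 1) * a (pure_tensor A B n p x (dB (n + 1 - p) y))"
proof -
  define \<alpha> where "\<alpha> u = a (tensor_relations A B n #>\<^bsub>tensor_free A B n\<^esub> u)" for u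
  have \<alpha>: "group_hom (free_Abelian_group (generators n)) integer_group \<alpha>"
    using tensor_hom_lift[OF a] by (simp add: \<alpha>_def[abs_def] group_hom_def group_hom_axioms_def tensor_free_def)
  let ?u = "frag_of (p - 1, dA p x, y)" and ?v = "frag_of (p, x, dB (n + 1 - p) y)"
  have deg: "n - (p - 1) = n + 1 - p" "n - p = n + 1 - p - 1" by simp_all
  have uv: "Poly_Mapping.keys ?u \<subseteq> generators n" "Poly_Mapping.keys ?v \<subseteq> generators n"
    using x y hom_in_carrier[OF dA x] hom_in_carrier[OF dB y]
    unfolding keys_frag_of insert_subset mem_Collect_eq prod.case deg by blast+
  have "\<alpha> (leibniz (n + 1) (p, x, y)) = 0"
    using cocycle[OF pure_tensor_carrier[OF x y]] tensor_boundary_pure_tensor[OF x y] by (simp add: \<alpha>_def)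
  then have "\<alpha> (?u + frag_cmul (if even p then 1 else - 1) ?v) = 0"
    by (simp add: leibniz_def)
  then have "\<alpha> ?u = (if even p then - 1 else 1) * \<alpha> ?v"
    using group_hom.hom_mult[OF \<alpha>, of ?u ?v] group_hom.hom_mult[OF \<alpha>, of ?u "- ?v"]
      group_hom.hom_inv[OF \<alpha>, of ?v] uv by (auto split: if_splits)
  then show ?thesis
    by (simp add: \<alpha>_def pure_tensor_def)
qed

end


section \<open>Connecting homomorphisms on representatives\<close>

lemma (in based_complex) boundary_hom_Suc:
  "ZG_module \<Gamma> N \<Longrightarrow> inv_boundary D S d N (m + 1)
    \<in> hom (inv_chains \<Gamma> (D (m + 1)) (S (m + 1)) N) (inv_chains \<Gamma> (D m) (S m) N)"
  using boundary_hom[of N "m + 1"] by simp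

lemma (in based_complex) subgroup_inv_boundaries:
  assumes "ZG_module \<Gamma> N"
  shows "subgroup (inv_boundaries \<Gamma> D S d N m) (inv_chains \<Gamma> (D m) (S m) N)"
proof -
  interpret group_hom "inv_chains \<Gamma> (D (m + 1)) (S (m + 1)) N" "inv_chains \<Gamma> (D m) (S m) N"
    "inv_boundary D S d N (m + 1)"
    using assms by (simp add: group_hom_def group_hom_axioms_def group_chains boundary_hom_Suc)
  show ?thesis
    unfolding inv_boundaries_def by (rule img_is_subgroup)
qed

text \<open>The chase runs through degrees \<open>m + 1\<close>, \<open>m\<close> and
  \<open>m - 1\<close>; chains over \<open>M\<close> are lifted in the top one, by means of orbit
  representatives.\<close>

lemma (in based_complex) inv_homology_connecting_rcoset:
  assumes exact: "ZG_short_exact \<Gamma> K \<iota> L \<phi> M"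
    and y: "y \<in> carrier (inv_chains \<Gamma> (D m) (S m) L)"
    and w: "w \<in> carrier (inv_chains \<Gamma> (D (m - 1)) (S (m - 1)) K)"
    and wy: "compose (S (m - 1)) \<iota> w = inv_boundary D S d L m y"
  shows "inv_homology_connecting \<Gamma> D S d K \<iota> L \<phi> m
      (inv_boundaries \<Gamma> D S d M m #>\<^bsub>inv_chains \<Gamma> (D m) (S m) M\<^esub> compose (S m) \<phi> y)
    = inv_boundaries \<Gamma> D S d K (m - 1) #>\<^bsub>inv_chains \<Gamma> (D (m - 1)) (S (m - 1)) K\<^esub> w"
proof -
  note ex = ZG_short_exactD[OF exact]
  have bd: "inv_boundaries \<Gamma> D S d K (m - 1) = inv_boundary D S d K m ` carrier (inv_chains \<Gamma> (D m) (S m) K)"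
    by (simp add: inv_boundaries_def)
  show ?thesis
    unfolding inv_homology_connecting_def bd inv_boundaries_def[of _ _ _ _ M]
  proof (rule connecting_rcoset[where ?L2.0 = "inv_chains \<Gamma> (D (m + 1)) (S (m + 1)) L"
        and ?L0.0 = "inv_chains \<Gamma> (D (m - 1)) (S (m - 1)) L"
        and ?dL2.0 = "inv_boundary D S d L (m + 1)" and ?i1.0 = "compose (S m) \<iota>"
        and ?p2.0 = "compose (S (m + 1)) \<phi>"])
    show "inv_boundary D S d L m (inv_boundary D S d L (m + 1) v) = \<one>\<^bsub>inv_chains \<Gamma> (D (m - 1)) (S (m - 1)) L\<^esub>"
      if "v \<in> carrier (inv_chains \<Gamma> (D (m + 1)) (S (m + 1)) L)" for v
      using boundary_boundary[OF ex(2) that] by simp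
    show "compose (S m) \<phi> (inv_boundary D S d L (m + 1) v) = inv_boundary D S d M (m + 1) (compose (S (m + 1)) \<phi> v)"
      if "v \<in> carrier (inv_chains \<Gamma> (D (m + 1)) (S (m + 1)) L)" for v
      using boundary_natural[OF ex(2,3,5) that] by simp
  qed (use ex y w wy boundary_natural compose_hom_inv_chains compose_surj_inv_chains in
      \<open>simp_all add: group_chains boundary_hom boundary_hom_Suc compose_inj_inv_chains
        compose_exact_inv_chains[OF exact]\<close>)
qed

lemma coboundaries_Suc:
  "coboundaries \<Gamma> C d N (m + 1) = coboundary C d m ` carrier (Hom_G \<Gamma> (C m) N)"
  by (simp add: coboundaries_def)

lemma coboundary_hom_pred:
  "free_chain_complex \<Gamma> C d \<Longrightarrow> coboundary C d (m - 1) \<in> hom (Hom_G \<Gamma> (C (m - 1)) N) (Hom_G \<Gamma> (C m) N)"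
  using coboundary_hom[of \<Gamma> C d "m - 1"] by simp

lemma group_Hom_G: "ZG_module \<Gamma> P \<Longrightarrow> ZG_module \<Gamma> N \<Longrightarrow> group (Hom_G \<Gamma> P N)"
  using comm_group_Hom_G by (blast intro: comm_group.axioms)

lemma subgroup_coboundaries:
  assumes "free_chain_complex \<Gamma> C d" "ZG_module \<Gamma> N"
  shows "subgroup (coboundaries \<Gamma> C d N m) (Hom_G \<Gamma> (C m) N)"
proof -
  interpret group_hom "Hom_G \<Gamma> (C (m - 1)) N" "Hom_G \<Gamma> (C m) N" "coboundary C d (m - 1)"
    using assms by (simp add: group_hom_def group_hom_axioms_def group_Hom_G
        free_chain_complexD(2) coboundary_hom_pred)
  show ?thesis
    unfolding coboundaries_def by (rule img_is_subgroup)
qed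

text \<open>The same chase with differentials that raise the degree: cochains over \<open>M\<close>
  are lifted in degree \<open>m - 1\<close>, which is possible because \<open>C (m - 1)\<close> is
  free.\<close>

lemma cohomology_connecting_rcoset:
  assumes C: "free_chain_complex \<Gamma> C d" and exact: "ZG_short_exact \<Gamma> K \<iota> L \<phi> M"
    and g: "g \<in> carrier (Hom_G \<Gamma> (C m) L)" and f: "f \<in> carrier (Hom_G \<Gamma> (C (m + 1)) K)"
    and fg: "compose (carrier (C (m + 1))) \<iota> f = coboundary C d m g"
  shows "cohomology_connecting \<Gamma> C d K \<iota> L \<phi> m
      (coboundaries \<Gamma> C d M m #>\<^bsub>Hom_G \<Gamma> (C m) M\<^esub> compose (carrier (C m)) \<phi> g)
    = coboundaries \<Gamma> C d K (m + 1) #>\<^bsub>Hom_G \<Gamma> (C (m + 1)) K\<^esub> f"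
proof -
  note ex = ZG_short_exactD[OF exact]
  note C' = free_chain_complexD[OF C]
  show ?thesis
    unfolding cohomology_connecting_def coboundaries_Suc coboundaries_def[of _ _ _ M]
  proof (rule connecting_rcoset[where ?L2.0 = "Hom_G \<Gamma> (C (m - 1)) L"
        and ?L0.0 = "Hom_G \<Gamma> (C (m + 1)) L" and ?dL2.0 = "coboundary C d (m - 1)"
        and ?i1.0 = "compose (carrier (C m)) \<iota>" and ?p2.0 = "compose (carrier (C (m - 1))) \<phi>"])
    show "coboundary C d m (coboundary C d (m - 1) v) = \<one>\<^bsub>Hom_G \<Gamma> (C (m + 1)) L\<^esub>"
      if "v \<in> carrier (Hom_G \<Gamma> (C (m - 1)) L)" for v
      using coboundary_coboundary[OF C ex(2) that] by simp
    show "compose (carrier (C m)) \<phi> (coboundary C d (m - 1) v) = coboundary C d (m - 1) (compose (carrier (C (m - 1))) \<phi> v)" for v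
      using coboundary_natural[OF C, of "m - 1" \<phi> v] by simp
    show "carrier (Hom_G \<Gamma> (C (m - 1)) M) \<subseteq> compose (carrier (C (m - 1))) \<phi> ` carrier (Hom_G \<Gamma> (C (m - 1)) L)"
      by (rule compose_surj_Hom_G[OF C'(1) ex(2,3,5,7)])
  qed (use ex C' g f fg coboundary_natural[OF C] in
      \<open>simp_all add: group_Hom_G coboundary_hom[OF C] coboundary_hom_pred[OF C] compose_inj_Hom_G
        compose_hom_Hom_G compose_exact_Hom_G[OF _ exact]\<close>)
qed


section \<open>The slant product\<close>

locale slant_cocycle = based_complex \<Gamma> D S dD
  for \<Gamma> :: "('g, 'x) monoid_scheme" and D :: "int \<Rightarrow> ('g, 'd, 'z) module_scheme"
    and S :: "int \<Rightarrow> 'd set" and dD :: "int \<Rightarrow> 'd \<Rightarrow> 'd" +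
  fixes C :: "int \<Rightarrow> ('g, 'c, 'y) module_scheme" and dC :: "int \<Rightarrow> 'c \<Rightarrow> 'c" and n :: int
    and a :: "(int \<times> 'c \<times> 'd \<Rightarrow>\<^sub>0 int) set \<Rightarrow> int"
  assumes complex_C: "free_chain_complex \<Gamma> C dC"
    and cocycle: "inv_finite_cocycle \<Gamma> C dC D S dD n a"
begin

sublocale tensor: tensor_complexes "\<lambda>m. add_monoid (C m)" "\<lambda>m. add_monoid (D m)" dC dD
  by (intro tensor_complexes.intro tensor_groups.intro tensor_complexes_axioms.intro)
    (simp_all add: abelian_group.a_group abelian_group_D free_chain_complexD(3)[OF complex_C]
      ZG_hom_hom[OF free_chain_complexD(4)[OF complex_C]] ZG_hom_hom[OF d_ZG_hom])

abbreviation (input) val :: "int \<Rightarrow> 'c \<Rightarrow> 'd \<Rightarrow> int"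
  where "val \<equiv> tensor_value C D n a"

lemma cocycle_hom: "a \<in> hom (tensor (\<lambda>m. add_monoid (C m)) (\<lambda>m. add_monoid (D m)) n) integer_group"
  using cocycle by (simp add: inv_finite_cocycle_def Let_def)

lemma val_add:
  assumes "c \<in> carrier (C p)" "c' \<in> carrier (C p)" "x \<in> carrier (D (n - p))"
  shows "val p (c \<oplus>\<^bsub>C p\<^esub> c') x = val p c x + val p c' x"
  using tensor.pure_tensor_add_left[OF cocycle_hom, of c p c' x] assms by (simp add: tensor_value_def)

lemma val_hom:
  assumes "c \<in> carrier (C p)"
  shows "val p c \<in> hom (add_monoid (D (n - p))) integer_group"
  using tensor.pure_tensor_add_right[OF cocycle_hom, of c p] assms
  by (intro homI) (simp_all add: tensor_value_def)

lemma val_act: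
  assumes "\<gamma> \<in> carrier \<Gamma>" "c \<in> carrier (C p)" "x \<in> carrier (D (n - p))"
  shows "val p (\<gamma> \<odot>\<^bsub>C p\<^esub> c) (\<gamma> \<odot>\<^bsub>D (n - p)\<^esub> x) = val p c x"
  using cocycle assms by (simp add: inv_finite_cocycle_def Let_def)

lemma finite_val: "c \<in> carrier (C p) \<Longrightarrow> finite {\<sigma> \<in> S (n - p). val p c \<sigma> \<noteq> 0}"
  using cocycle by (simp add: inv_finite_cocycle_def Let_def cocycle_support_def)

text \<open>Origin of the sign: the Leibniz sign at \<open>p = k + 1\<close>, moved to the other
  side, is \<open>-(-1)^(k + 1) = (-1)^k\<close>.\<close>

lemma val_boundary:
  assumes "c \<in> carrier (C (k + 1))" "x \<in> carrier (D (n - k))"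
  shows "val k (dC (k + 1) c) x = (if even k then 1 else - 1) * val (k + 1) c (dD (n - k) x)"
proof -
  have cocycle0: "a (tensor_boundary (\<lambda>m. add_monoid (C m)) dC (\<lambda>m. add_monoid (D m)) dD (n + 1) X) = 0"
    if "X \<in> carrier (tensor (\<lambda>m. add_monoid (C m)) (\<lambda>m. add_monoid (D m)) (n + 1))" for X
    using cocycle that by (simp add: inv_finite_cocycle_def Let_def)
  show ?thesis
    using tensor.tensor_cocycle[OF cocycle_hom cocycle0, of c "k + 1" x] assms
    by (simp add: tensor_value_def)
qed

section \<open>The slant product on chains, cochains and classes\<close>

lemma slant_chain_eq_pairing:
  "slant_chain C D S n a N k z = (\<lambda>c\<in>carrier (C k). pairing N (S (n - k)) (val k c) z)"
  by (simp add: slant_chain_def pairing_def cocycle_support_def)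

text \<open>Additivity in \<open>c\<close> is additivity of the pairing in its functional;
  equivariance is the invariance of \<open>a\<close>, fed into \<open>pairing_act\<close>.\<close>

lemma slant_chain_closed:
  assumes N: "ZG_module \<Gamma> N" and z: "z \<in> carrier (inv_chains \<Gamma> (D (n - k)) (S (n - k)) N)"
  shows "slant_chain C D S n a N k z \<in> carrier (Hom_G \<Gamma> (C k) N)"
proof -
  interpret N: ZG_module \<Gamma> N by fact
  interpret P: ZG_module \<Gamma> "C k" by (rule free_chain_complexD[OF complex_C])
  note z' = inv_chains_funcset[OF z]
  have "slant_chain C D S n a N k z \<in> ZG_hom \<Gamma> (C k) N"
    unfolding slant_chain_eq_pairing
  proof (rule ZG_homI)
    fix c assume c: "c \<in> carrier (C k)"
    show "(\<lambda>c\<in>carrier (C k). pairing N (S (n - k)) (val k c) z) c \<in> carrier N"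
      using c by (simp add: N.pairing_closed z')
    show "(\<lambda>c\<in>carrier (C k). pairing N (S (n - k)) (val k c) z) (c \<oplus>\<^bsub>C k\<^esub> c')
        = (\<lambda>c\<in>carrier (C k). pairing N (S (n - k)) (val k c) z) c
          \<oplus>\<^bsub>N\<^esub> (\<lambda>c\<in>carrier (C k). pairing N (S (n - k)) (val k c) z) c'"
      if c': "c' \<in> carrier (C k)" for c'
    proof -
      have "pairing N (S (n - k)) (val k (c \<oplus>\<^bsub>C k\<^esub> c')) z
          = pairing N (S (n - k)) (\<lambda>\<sigma>. val k c \<sigma> + val k c' \<sigma>) z"
        by (rule N.pairing_cong) (use z' c c' in \<open>simp_all add: val_add S_carrier\<close>)
      then show ?thesis
        using c c' N.pairing_add_left[OF z' finite_val[OF c] finite_val[OF c']] by simp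
    qed
    show "(\<lambda>c\<in>carrier (C k). pairing N (S (n - k)) (val k c) z) (\<gamma> \<odot>\<^bsub>C k\<^esub> c)
        = \<gamma> \<odot>\<^bsub>N\<^esub> (\<lambda>c\<in>carrier (C k). pairing N (S (n - k)) (val k c) z) c" if \<gamma>: "\<gamma> \<in> carrier \<Gamma>" for \<gamma>
      using pairing_act[OF N \<gamma> z finite_val[OF c], of "val k (\<gamma> \<odot>\<^bsub>C k\<^esub> c)"] val_act[OF \<gamma> c] c \<gamma>
      by (simp add: P.act_closed S_carrier)
  qed
  then show ?thesis
    by (simp add: mem_Hom_G_iff slant_chain_def)
qed

lemma slant_chain_hom:
  assumes N: "ZG_module \<Gamma> N"
  shows "slant_chain C D S n a N k
    \<in> hom (inv_chains \<Gamma> (D (n - k)) (S (n - k)) N) (Hom_G \<Gamma> (C k) N)"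
proof (rule homI)
  interpret N: ZG_module \<Gamma> N by fact
  fix z w
  assume "z \<in> carrier (inv_chains \<Gamma> (D (n - k)) (S (n - k)) N)"
    and "w \<in> carrier (inv_chains \<Gamma> (D (n - k)) (S (n - k)) N)"
  note zw = this[THEN inv_chains_funcset]
  show "slant_chain C D S n a N k (z \<otimes>\<^bsub>inv_chains \<Gamma> (D (n - k)) (S (n - k)) N\<^esub> w)
      = slant_chain C D S n a N k z \<otimes>\<^bsub>Hom_G \<Gamma> (C k) N\<^esub> slant_chain C D S n a N k w"
    using N.pairing_add_right[OF zw finite_val]
    by (auto simp: slant_chain_eq_pairing mult_inv_chains mult_Hom_G fun_eq_iff)
qed (rule slant_chain_closed[OF N])

lemma slant_chain_natural:
  assumes N: "ZG_module \<Gamma> N" and N': "ZG_module \<Gamma> N'" and f: "f \<in> ZG_hom \<Gamma> N N'"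
    and z: "z \<in> carrier (inv_chains \<Gamma> (D (n - k)) (S (n - k)) N)"
  shows "slant_chain C D S n a N' k (compose (S (n - k)) f z)
    = compose (carrier (C k)) f (slant_chain C D S n a N k z)"
  using pairing_compose[OF N N' f z finite_val]
  by (auto simp: slant_chain_eq_pairing fun_eq_iff compose_def[of "carrier (C k)"])

lemma slant_chain_boundary_closed:
  assumes "ZG_module \<Gamma> N" "z \<in> carrier (inv_chains \<Gamma> (D (n - k)) (S (n - k)) N)"
  shows "slant_chain C D S n a N (k + 1) (inv_boundary D S dD N (n - k) z)
    \<in> carrier (Hom_G \<Gamma> (C (k + 1)) N)"
  using slant_chain_closed[of N _ "k + 1"] boundary_closed[OF assms] assms(1)
  by (simp add: diff_diff_eq)

text \<open>An integer, because it serves as an exponent in groups written multiplicatively.\<close>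

definition slant_sign :: "int \<Rightarrow> int"
  where "slant_sign k = (if even k then 1 else - 1)"

text \<open>\<open>val_boundary\<close> moves the boundary from \<open>c\<close> to each
  \<open>\<sigma>\<close>, producing the sign, and \<open>pairing_boundary\<close> moves it on to
  the formal sum.\<close>

lemma coboundary_slant_chain:
  assumes N: "ZG_module \<Gamma> N" and z: "z \<in> carrier (inv_chains \<Gamma> (D (n - k)) (S (n - k)) N)"
  shows "coboundary C dC k (slant_chain C D S n a N k z)
    = slant_chain C D S n a N (k + 1) (inv_boundary D S dD N (n - k) z)
        [^]\<^bsub>Hom_G \<Gamma> (C (k + 1)) N\<^esub> slant_sign k"
proof -
  interpret N: ZG_module \<Gamma> N by fact
  note C' = free_chain_complexD[OF complex_C]
  interpret G: comm_group "Hom_G \<Gamma> (C (k + 1)) N" by (rule comm_group_Hom_G[OF C'(2) N])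
  let ?b = "slant_chain C D S n a N (k + 1) (inv_boundary D S dD N (n - k) z)"
  have b: "?b \<in> carrier (Hom_G \<Gamma> (C (k + 1)) N)"
    by (rule slant_chain_boundary_closed[OF N z])
  have deg: "n - (k + 1) = n - k - 1" by simp
  note z' = inv_chains_funcset[OF z]
  have eq: "slant_chain C D S n a N k z (dC (k + 1) c) = (if even k then ?b c else \<ominus>\<^bsub>N\<^esub> ?b c)"
    if c: "c \<in> carrier (C (k + 1))" for c
  proof -
    note h = val_hom[OF c, unfolded deg] finite_val[OF c, unfolded deg]
    have "slant_chain C D S n a N k z (dC (k + 1) c)
        = pairing N (S (n - k)) (\<lambda>\<sigma>. (if even k then 1 else - 1) * val (k + 1) c (dD (n - k) \<sigma>)) z"
      unfolding slant_chain_eq_pairing using ZG_hom_closed[OF C'(5) c] z' c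
      by (simp only: restrict_apply' if_True) (rule N.pairing_cong, simp_all only: val_boundary S_carrier)
    also have "\<dots> = (if even k then pairing N (S (n - k)) (\<lambda>\<sigma>. val (k + 1) c (dD (n - k) \<sigma>)) z
        else \<ominus>\<^bsub>N\<^esub> pairing N (S (n - k)) (\<lambda>\<sigma>. val (k + 1) c (dD (n - k) \<sigma>)) z)"
      using N.pairing_uminus_left[OF z' pairing_boundary(2)[OF N z h]] by simp
    also have "pairing N (S (n - k)) (\<lambda>\<sigma>. val (k + 1) c (dD (n - k) \<sigma>)) z = ?b c"
      unfolding slant_chain_eq_pairing deg using pairing_boundary(1)[OF N z h] c by simp
    finally show ?thesis .
  qed
  have "coboundary C dC k (slant_chain C D S n a N k z) c
      = (?b [^]\<^bsub>Hom_G \<Gamma> (C (k + 1)) N\<^esub> slant_sign k) c" for c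
  proof (cases "c \<in> carrier (C (k + 1))")
    case True
    then show ?thesis
      using eq[OF True] G.int_pow_neg[OF b, of 1] b inv_Hom_G[OF C'(2) N b True]
      by (simp add: coboundary_def compose_def slant_sign_def)
  next
    \<comment> \<open>Both sides are \<open>undefined\<close> here: cochains are extensional, and
      powers stay in the group of cochains.\<close>
    case False
    then show ?thesis
      using Hom_G_undefined[OF G.int_pow_closed[OF b] False] by (simp add: coboundary_def compose_def)
  qed
  then show ?thesis by (rule ext)
qed

lemma slant_sign_square: "slant_sign k * slant_sign k = 1"
  by (simp add: slant_sign_def)

text \<open>The preceding formula solved for the slant of the boundary; in this form it exhibits the
  slant of a boundary as a coboundary.\<close>

lemma slant_chain_boundary:
  assumes N: "ZG_module \<Gamma> N" and z: "z \<in> carrier (inv_chains \<Gamma> (D (n - k)) (S (n - k)) N)"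
  shows "slant_chain C D S n a N (k + 1) (inv_boundary D S dD N (n - k) z)
    = coboundary C dC k (slant_chain C D S n a N k z [^]\<^bsub>Hom_G \<Gamma> (C k) N\<^esub> slant_sign k)"
proof -
  note C' = free_chain_complexD[OF complex_C]
  interpret G: comm_group "Hom_G \<Gamma> (C (k + 1)) N" by (rule comm_group_Hom_G[OF C'(2) N])
  show ?thesis
    using hom_int_pow[OF coboundary_hom[OF complex_C] slant_chain_closed[OF N z]
        group_Hom_G[OF C'(2) N] G.group_axioms] coboundary_slant_chain[OF N z]
      G.int_pow_pow[OF slant_chain_boundary_closed[OF N z]] slant_chain_boundary_closed[OF N z]
    by (simp add: slant_sign_square)
qed

lemma slant_chain_boundaries:
  assumes N: "ZG_module \<Gamma> N"
  shows "slant_chain C D S n a N k ` inv_boundaries \<Gamma> D S dD N (n - k) \<subseteq> coboundaries \<Gamma> C dC N k"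
proof -
  \<comment> \<open>Boundaries in degree \<open>n - k\<close> come from degree \<open>n - j\<close>,
    coboundaries in degree \<open>k\<close> from degree \<open>j\<close>.\<close>
  define j where "j = k - 1"
  have k: "k = j + 1" and deg: "n - (j + 1) + 1 = n - j" by (simp_all add: j_def)
  interpret G: comm_group "Hom_G \<Gamma> (C j) N"
    by (rule comm_group_Hom_G[OF free_chain_complexD(2)[OF complex_C] N])
  show ?thesis
    unfolding k coboundaries_Suc inv_boundaries_def deg
    using slant_chain_boundary[OF N] slant_chain_closed[OF N] G.int_pow_closed by blast
qed

lemma slant_rcoset:
  assumes N: "ZG_module \<Gamma> N" and z: "z \<in> carrier (inv_chains \<Gamma> (D (n - k)) (S (n - k)) N)"
  shows "slant \<Gamma> C dC D S n a N k
      (inv_boundaries \<Gamma> D S dD N (n - k) #>\<^bsub>inv_chains \<Gamma> (D (n - k)) (S (n - k)) N\<^esub> z)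
    = coboundaries \<Gamma> C dC N k #>\<^bsub>Hom_G \<Gamma> (C k) N\<^esub> slant_chain C D S n a N k z"
  unfolding slant_def
  by (rule induced_rcoset[OF group_chains[OF N] group_Hom_G[OF free_chain_complexD(2)[OF complex_C] N]
        slant_chain_hom[OF N] subgroup_inv_boundaries[OF N] subgroup_coboundaries[OF complex_C N]
        slant_chain_boundaries[OF N] z])

lemma slant_connecting:
  assumes exact: "ZG_short_exact \<Gamma> K \<iota> L \<phi> M" and X: "X \<in> carrier (inv_homology \<Gamma> D S dD M (n - k))"
  shows "slant \<Gamma> C dC D S n a K (k + 1) (inv_homology_connecting \<Gamma> D S dD K \<iota> L \<phi> (n - k) X) =
    cohomology_connecting \<Gamma> C dC K \<iota> L \<phi> k (slant \<Gamma> C dC D S n a M k X)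
      [^]\<^bsub>cohomology \<Gamma> C dC K (k + 1)\<^esub> slant_sign k"
proof -
  note ex = ZG_short_exactD[OF exact]
  note C' = free_chain_complexD[OF complex_C]
  let ?G = "\<lambda>N k z. slant_chain C D S n a N k z"
  let ?H = "Hom_G \<Gamma> (C (k + 1)) K"
  interpret H: comm_group ?H by (rule comm_group_Hom_G[OF C'(2) ex(1)])
  have deg: "n - (k + 1) = n - k - 1" by simp
  obtain z where z: "z \<in> kernel (inv_chains \<Gamma> (D (n - k)) (S (n - k)) M)
      (inv_chains \<Gamma> (D (n - k - 1)) (S (n - k - 1)) M) (inv_boundary D S dD M (n - k))"
    and X_z: "X = inv_boundaries \<Gamma> D S dD M (n - k) #>\<^bsub>inv_chains \<Gamma> (D (n - k)) (S (n - k)) M\<^esub> z"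
    using carrier_homology_atE[OF X[unfolded inv_homology_def]] unfolding inv_boundaries_def by blast
  obtain y where y: "y \<in> carrier (inv_chains \<Gamma> (D (n - k)) (S (n - k)) L)" and z_y: "z = compose (S (n - k)) \<phi> y"
    using compose_surj_inv_chains[OF ex(2,3,5,7)] z by (auto simp: kernel_def)
  \<comment> \<open>Its image under \<open>\<phi>\<close> is the boundary of the cycle
    \<open>z\<close>, hence trivial, and exactness brings it back to \<open>K\<close>.\<close>
  have "inv_boundary D S dD L (n - k) y \<in> compose (S (n - k - 1)) \<iota> `
      carrier (inv_chains \<Gamma> (D (n - k - 1)) (S (n - k - 1)) K)"
    by (rule subsetD[OF compose_exact_inv_chains[OF exact]])
      (use boundary_closed[OF ex(2) y] boundary_natural[OF ex(2,3,5) y] z z_y in \<open>simp add: kernel_def\<close>)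
  then obtain w where w: "w \<in> carrier (inv_chains \<Gamma> (D (n - k - 1)) (S (n - k - 1)) K)"
    and w_y: "compose (S (n - k - 1)) \<iota> w = inv_boundary D S dD L (n - k) y"
    by (elim imageE) (simp add: that)
  \<comment> \<open>The sign is placed so that \<open>\<iota>\<close> takes \<open>f\<close> exactly
    to the coboundary of the slant of \<open>y\<close>; hence \<open>f\<close> represents the
    connecting class of the slant of \<open>z\<close>.\<close>
  define f where "f = ?G K (k + 1) w [^]\<^bsub>?H\<^esub> slant_sign k"
  have Gw: "?G K (k + 1) w \<in> carrier ?H"
    using slant_chain_closed[OF ex(1), of w "k + 1"] w by (simp only: deg)
  then have f: "f \<in> carrier ?H"
    unfolding f_def by (rule H.int_pow_closed)
  have f_y: "compose (carrier (C (k + 1))) \<iota> f = coboundary C dC k (?G L k y)"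
    using coboundary_slant_chain[OF ex(2) y]
      slant_chain_natural[OF ex(1,2,4), of w "k + 1"] w w_y
      hom_int_pow[OF compose_hom_Hom_G[OF C'(2) ex(4)] Gw H.group_axioms group_Hom_G[OF C'(2) ex(2)]]
    unfolding f_def deg by simp
  \<comment> \<open>The exponent in cohomology acts on classes of cocycles, so \<open>f\<close> must
    be one: \<open>\<iota>\<close> takes its coboundary to a double coboundary, and
    \<open>\<iota>\<close> is injective on cochains.\<close>
  have "compose (carrier (C (k + 1 + 1))) \<iota> (coboundary C dC (k + 1) f) = \<one>\<^bsub>Hom_G \<Gamma> (C (k + 1 + 1)) L\<^esub>"
    using coboundary_natural[OF complex_C, of "k + 1" \<iota> f] f_y
      coboundary_coboundary[OF complex_C ex(2) slant_chain_closed[OF ex(2) y]] by simp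
  moreover have "compose (carrier (C (k + 1 + 1))) \<iota> \<one>\<^bsub>Hom_G \<Gamma> (C (k + 1 + 1)) K\<^esub> = \<one>\<^bsub>Hom_G \<Gamma> (C (k + 1 + 1)) L\<^esub>"
    by (rule hom_one[OF compose_hom_Hom_G[OF C'(2) ex(4)] group_Hom_G[OF C'(2) ex(1)] group_Hom_G[OF C'(2) ex(2)]])
  ultimately have "coboundary C dC (k + 1) f = \<one>\<^bsub>Hom_G \<Gamma> (C (k + 1 + 1)) K\<^esub>"
    using inj_onD[OF compose_inj_Hom_G[OF ex(6)]] hom_in_carrier[OF coboundary_hom[OF complex_C] f]
      group.is_monoid[OF group_Hom_G[OF C'(2) ex(1)]] by (metis monoid.one_closed)
  then have ker: "f \<in> kernel ?H (Hom_G \<Gamma> (C (k + 1 + 1)) K) (coboundary C dC (k + 1))"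
    using f by (simp add: kernel_def)
  have "slant \<Gamma> C dC D S n a K (k + 1) (inv_homology_connecting \<Gamma> D S dD K \<iota> L \<phi> (n - k) X)
      = coboundaries \<Gamma> C dC K (k + 1) #>\<^bsub>?H\<^esub> ?G K (k + 1) w"
    unfolding X_z z_y inv_homology_connecting_rcoset[OF exact y w w_y]
    using slant_rcoset[OF ex(1), of w "k + 1"] w by (simp only: deg)
  moreover have "cohomology_connecting \<Gamma> C dC K \<iota> L \<phi> k (slant \<Gamma> C dC D S n a M k X)
      = coboundaries \<Gamma> C dC K (k + 1) #>\<^bsub>?H\<^esub> f"
    using slant_rcoset[OF ex(3), of z k] z slant_chain_natural[OF ex(2,3,5) y]
      cohomology_connecting_rcoset[OF complex_C exact slant_chain_closed[OF ex(2) y] f f_y]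
    by (simp add: X_z z_y kernel_def)
  moreover have "(coboundaries \<Gamma> C dC K (k + 1) #>\<^bsub>?H\<^esub> f) [^]\<^bsub>cohomology \<Gamma> C dC K (k + 1)\<^esub> slant_sign k
      = coboundaries \<Gamma> C dC K (k + 1) #>\<^bsub>?H\<^esub> (f [^]\<^bsub>?H\<^esub> slant_sign k)"
    unfolding cohomology_def coboundaries_def
  proof (rule rcoset_int_pow_homology_at)
    show "coboundary C dC (k + 1) (coboundary C dC (k + 1 - 1) x) = \<one>\<^bsub>Hom_G \<Gamma> (C (k + 1 + 1)) K\<^esub>"
      if "x \<in> carrier (Hom_G \<Gamma> (C (k + 1 - 1)) K)" for x
      using coboundary_coboundary[OF complex_C ex(1)] that by simp
    show "coboundary C dC (k + 1) \<in> hom ?H (Hom_G \<Gamma> (C (k + 1 + 1)) K)"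
      by (rule coboundary_hom[OF complex_C])
  qed (use ker ex(1) C'(2) coboundary_hom_pred[OF complex_C, of "k + 1"] in
      \<open>simp_all add: group_Hom_G comm_group_Hom_G\<close>)
  \<comment> \<open>The square of the sign is 1, so applying it again recovers the slant of
    \<open>w\<close>, which represents the other way around the square.\<close>
  moreover have "f [^]\<^bsub>?H\<^esub> slant_sign k = ?G K (k + 1) w"
    using Gw by (simp add: f_def H.int_pow_pow slant_sign_square)
  ultimately show ?thesis
    by simp
qed

end

text \<open>The witness is \<open>slant_sign k\<close>, fixed before the class \<open>X\<close> is
  given: it depends only on the parity of \<open>k\<close>.\<close>

theorem theorem4p6:
  fixes \<Gamma> :: "('g, 'x) monoid_scheme"
    and K :: "('g, 'k, 'u) module_scheme" and L :: "('g, 'l, 'v) module_scheme"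
    and M :: "('g, 'm, 'w) module_scheme" and \<iota> :: "'k \<Rightarrow> 'l" and \<phi> :: "'l \<Rightarrow> 'm"
    and C :: "int \<Rightarrow> ('g, 'c, 'y) module_scheme" and dC :: "int \<Rightarrow> 'c \<Rightarrow> 'c"
    and D :: "int \<Rightarrow> ('g, 'd, 'z) module_scheme" and dD :: "int \<Rightarrow> 'd \<Rightarrow> 'd"
    and S :: "int \<Rightarrow> 'd set" and n k :: int
    and astar :: "((int \<times> 'c \<times> ('d \<Rightarrow> int) \<Rightarrow>\<^sub>0 int) set \<Rightarrow> int) set"
    and a :: "(int \<times> 'c \<times> 'd \<Rightarrow>\<^sub>0 int) set \<Rightarrow> int"
  assumes "group \<Gamma>"
    and "ZG_short_exact \<Gamma> K \<iota> L \<phi> M"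
    and "free_chain_complex \<Gamma> C dC"
    and "free_chain_complex \<Gamma> D dD"
    and "\<And>m. freely_permuted_basis \<Gamma> (D m) (S m)"
    and "\<And>m \<tau>. \<tau> \<in> S (m - 1) \<Longrightarrow> finite {\<sigma> \<in> S m. incidence D S dD m \<sigma> \<tau> \<noteq> 0}"
    and "inv_finite_cocycle \<Gamma> C dC D S dD n a"
    and "represents_class \<Gamma> C dC D S dD n a astar"
  shows "\<exists>\<epsilon>\<in>{1, - 1 :: int}. \<forall>X\<in>carrier (inv_homology \<Gamma> D S dD M (n - k)).
    slant \<Gamma> C dC D S n a K (k + 1) (inv_homology_connecting \<Gamma> D S dD K \<iota> L \<phi> (n - k) X) =
    cohomology_connecting \<Gamma> C dC K \<iota> L \<phi> k (slant \<Gamma> C dC D S n a M k X)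
      [^]\<^bsub>cohomology \<Gamma> C dC K (k + 1)\<^esub> \<epsilon>"
proof (intro bexI ballI)
  interpret slant_cocycle \<Gamma> D S dD C dC n a
    using assms(3-7) by (intro slant_cocycle.intro based_complex.intro slant_cocycle_axioms.intro)
  show "slant_sign k \<in> {1, - 1}"
    by (simp add: slant_sign_def)
  show "slant \<Gamma> C dC D S n a K (k + 1) (inv_homology_connecting \<Gamma> D S dD K \<iota> L \<phi> (n - k) X) =
      cohomology_connecting \<Gamma> C dC K \<iota> L \<phi> k (slant \<Gamma> C dC D S n a M k X)
        [^]\<^bsub>cohomology \<Gamma> C dC K (k + 1)\<^esub> slant_sign k"
    if "X \<in> carrier (inv_homology \<Gamma> D S dD M (n - k))" for X
    by (rule slant_connecting[OF assms(2) that])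
qed

end
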